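(* Let $E$ be a Banach space. Suppose that the pair $(E, F)$ satisfies the WMP for every Banach space $F$. If (a) $E$ satisfies the compact approximation property and is isometrically isomorphic to $E \oplus_p E$ for some $p \in (1, \infty)$, or (b) $E^*$ has the Kadec-Klee property (in particular, if the norm of $E$ is Fréchet differentiable or locally uniformly rotund), then $E$ is finite dimensional.
   Context: Banach spaces are over $\mathbb{K} = \mathbb{R}$ or $\mathbb{C}$. $E\oplus_p E$ has norm $\|(x,y)\|=(\|x\|^p+\|y\|^p)^{1/p}$. A Banach space $E$ has the compact approximation property (CAP) if for every compact set $K\subset E$ and every $\varepsilon>0$ there is a compact operator $T$ on $E$ with $\|T(x)-x\|<\varepsilon$ for every $x\in K$. $E^*$ has the Kadec-Klee property if weakly and norm convergent sequences coincide on its unit sphere $S_{E^*}$: whenever $x_n^*,x^*\in S_{E^*}$ and $x_n^*\to x^*$ weakly, then $\|x_n^*-x^*\|\to0$. A norm is Fréchet differentiable if it is so at every nonzero point; it is locally uniformly rotund (LUR) if $\|x_n-x\|\to0$ whenever $x,x_n$ are in the unit sphere and $\|x_n+x\|\to2$. A bounded linear operator $T:E\to F$ attains its norm if there is $x_0\in S_E$ with $\|T(x_0)\|=\|T\|$. A maximizing sequence for $T$ is a sequence $(x_n)\subset S_E$ with $\|T(x_n)\|\to\|T\|$. A pair $(E,F)$ of Banach spaces has the weak maximizing property (WMP) if every bounded linear operator $T:E\to F$ that admits a non-weakly null maximizing sequence (i.e. one not converging weakly to $0$) attains its norm. *)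

theory Defs
  imports "HOL-Analysis.Analysis" "HOL-Algebra.Module"
begin

section \<open>Banach spaces over \<open>K\<close>, where \<open>K\<close> is the real or the complex field\<close>

text \<open>
  The scalar field is a subset \<open>K\<close> of the complex numbers: \<open>K = \<real>\<close> (the real
  numbers inside \<^typ>\<open>complex\<close>) or \<open>K = UNIV\<close>. The space \<open>E\<close> is a type of class
  \<^class>\<open>banach\<close>; its multiplication by scalars from \<open>K\<close> is an explicit function \<open>s\<close>
  that extends the real scalar multiplication of the class. Values of \<open>s\<close> outside \<open>K\<close> are
  never used.
\<close>

definition scalar_mult :: "complex set \<Rightarrow> (complex \<Rightarrow> 'e::real_normed_vector \<Rightarrow> 'e) \<Rightarrow> bool" where
  "scalar_mult K s \<longleftrightarrow>
     (\<forall>r x. s (complex_of_real r) x = r *\<^sub>R x) \<and>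
     (\<forall>c\<in>K. \<forall>x y. s c (x + y) = s c x + s c y) \<and>
     (\<forall>c\<in>K. \<forall>d\<in>K. \<forall>x. s (c + d) x = s c x + s d x) \<and>
     (\<forall>c\<in>K. \<forall>d\<in>K. \<forall>x. s (c * d) x = s c (s d x)) \<and>
     (\<forall>c\<in>K. \<forall>x. norm (s c x) = cmod c * norm x)"

text \<open>
  The target spaces \<open>F\<close> are quantified inside a formula, so they are
  modules on an explicit carrier, with an explicit norm. (The ring record underlying the module
  record also has a multiplication and a unit; they are ignored by the \<^locale>\<open>module\<close> locale.)
\<close>

record 'f normed_module = "(complex, 'f) module" +
  nrm :: "'f \<Rightarrow> real"

definition scalar_ring :: "complex set \<Rightarrow> complex ring" where
  "scalar_ring K = \<lparr>carrier = K, mult = (*), one = 1, zero = 0, add = (+)\<rparr>"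

definition banach_module :: "complex set \<Rightarrow> 'f normed_module \<Rightarrow> bool" where
  "banach_module K F \<longleftrightarrow>
     module (scalar_ring K) F \<and>
     (\<forall>x\<in>carrier F. 0 \<le> nrm F x \<and> (nrm F x = 0 \<longleftrightarrow> x = \<zero>\<^bsub>F\<^esub>)) \<and>
     (\<forall>x\<in>carrier F. \<forall>y\<in>carrier F. nrm F (x \<oplus>\<^bsub>F\<^esub> y) \<le> nrm F x + nrm F y) \<and>
     (\<forall>c\<in>K. \<forall>x\<in>carrier F. nrm F (c \<odot>\<^bsub>F\<^esub> x) = cmod c * nrm F x) \<and>
     (\<forall>X::nat \<Rightarrow> 'f. (\<forall>n. X n \<in> carrier F) \<longrightarrow>
        (\<forall>e>0. \<exists>M. \<forall>m\<ge>M. \<forall>n\<ge>M. nrm F (X m \<ominus>\<^bsub>F\<^esub> X n) < e) \<longrightarrow>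
        (\<exists>x\<in>carrier F. (\<lambda>n. nrm F (X n \<ominus>\<^bsub>F\<^esub> x)) \<longlonglongrightarrow> 0))"


section \<open>Duals and weak convergence\<close>

text \<open>
  The dual \<open>E\<^sup>*\<close>, as a set of bounded real-linear maps into \<^typ>\<open>complex\<close>; its norm is
  the operator norm of the blinfun type.
\<close>

definition dual_space ::
    "complex set \<Rightarrow> (complex \<Rightarrow> 'e::real_normed_vector \<Rightarrow> 'e) \<Rightarrow> ('e \<Rightarrow>\<^sub>L complex) set" where
  "dual_space K s =
     {f. (\<forall>x. blinfun_apply f x \<in> K) \<and>
         (\<forall>c\<in>K. \<forall>x. blinfun_apply f (s c x) = c * blinfun_apply f x)}"

definition weakly_null ::
    "complex set \<Rightarrow> (complex \<Rightarrow> 'e::real_normed_vector \<Rightarrow> 'e) \<Rightarrow> (nat \<Rightarrow> 'e) \<Rightarrow> bool" where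
  "weakly_null K s x \<longleftrightarrow> (\<forall>f\<in>dual_space K s. (\<lambda>n. blinfun_apply f (x n)) \<longlonglongrightarrow> 0)"

text \<open>
  The bounded \<open>K\<close>-linear functionals on \<open>E\<^sup>*\<close>, represented by functions whose values outside
  \<^term>\<open>dual_space K s\<close> are irrelevant. The operator \<open>blinfun_mult_right c o\<^sub>L f\<close> is
  the scalar multiple of \<open>f\<close> by \<open>c\<close>.
\<close>

definition bidual_functional ::
    "complex set \<Rightarrow> (complex \<Rightarrow> 'e::real_normed_vector \<Rightarrow> 'e) \<Rightarrow>
     (('e \<Rightarrow>\<^sub>L complex) \<Rightarrow> complex) \<Rightarrow> bool" where
  "bidual_functional K s \<phi> \<longleftrightarrow>
     (\<forall>f\<in>dual_space K s. \<phi> f \<in> K) \<and>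
     (\<forall>f\<in>dual_space K s. \<forall>g\<in>dual_space K s. \<phi> (f + g) = \<phi> f + \<phi> g) \<and>
     (\<forall>c\<in>K. \<forall>f\<in>dual_space K s. \<phi> (blinfun_mult_right c o\<^sub>L f) = c * \<phi> f) \<and>
     (\<exists>C. \<forall>f\<in>dual_space K s. cmod (\<phi> f) \<le> C * norm f)"

definition kadec_klee_dual ::
    "complex set \<Rightarrow> (complex \<Rightarrow> 'e::real_normed_vector \<Rightarrow> 'e) \<Rightarrow> bool" where
  "kadec_klee_dual K s \<longleftrightarrow>
     (\<forall>f. \<forall>g. (\<forall>n::nat. f n \<in> dual_space K s \<and> norm (f n) = 1) \<longrightarrow>
        g \<in> dual_space K s \<longrightarrow> norm g = 1 \<longrightarrow>
        (\<forall>\<phi>. bidual_functional K s \<phi> \<longrightarrow> (\<lambda>n. \<phi> (f n)) \<longlonglongrightarrow> \<phi> g) \<longrightarrow>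
        (\<lambda>n. norm (f n - g)) \<longlonglongrightarrow> 0)"


section \<open>Operators and the weak maximizing property\<close>

definition bounded_op ::
    "complex set \<Rightarrow> (complex \<Rightarrow> 'e::real_normed_vector \<Rightarrow> 'e) \<Rightarrow> 'f normed_module \<Rightarrow>
     ('e \<Rightarrow> 'f) \<Rightarrow> bool" where
  "bounded_op K s F T \<longleftrightarrow>
     (\<forall>x. T x \<in> carrier F) \<and>
     (\<forall>x y. T (x + y) = T x \<oplus>\<^bsub>F\<^esub> T y) \<and>
     (\<forall>c\<in>K. \<forall>x. T (s c x) = c \<odot>\<^bsub>F\<^esub> T x) \<and>
     (\<exists>C. \<forall>x. nrm F (T x) \<le> C * norm x)"

text \<open>The quotient form of the supremum is that of the library's \<^const>\<open>onorm\<close>.\<close>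

definition opnorm :: "'f normed_module \<Rightarrow> ('e::real_normed_vector \<Rightarrow> 'f) \<Rightarrow> real" where
  "opnorm F T = (SUP x. nrm F (T x) / norm x)"

definition attains_norm :: "'f normed_module \<Rightarrow> ('e::real_normed_vector \<Rightarrow> 'f) \<Rightarrow> bool" where
  "attains_norm F T \<longleftrightarrow> (\<exists>x. norm x = 1 \<and> nrm F (T x) = opnorm F T)"

definition maximizing_sequence ::
    "'f normed_module \<Rightarrow> ('e::real_normed_vector \<Rightarrow> 'f) \<Rightarrow> (nat \<Rightarrow> 'e) \<Rightarrow> bool" where
  "maximizing_sequence F T x \<longleftrightarrow>
     (\<forall>n. norm (x n) = 1) \<and> (\<lambda>n. nrm F (T (x n))) \<longlonglongrightarrow> opnorm F T"

definition WMP ::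
    "complex set \<Rightarrow> (complex \<Rightarrow> 'e::real_normed_vector \<Rightarrow> 'e) \<Rightarrow> 'f normed_module \<Rightarrow> bool" where
  "WMP K s F \<longleftrightarrow>
     (\<forall>T. bounded_op K s F T \<longrightarrow>
        (\<exists>x. maximizing_sequence F T x \<and> \<not> weakly_null K s x) \<longrightarrow> attains_norm F T)"

text \<open>
  ``The pair \<open>(E, F)\<close> satisfies the WMP for every Banach space \<open>F\<close>.'' HOL cannot quantify over all
  types \<open>'f\<close> inside a formula, so \<open>F\<close> ranges over all Banach spaces whose elements
  are taken from the type \<open>nat \<Rightarrow> 'e\<close>. This loses nothing: the closure of the range
  of an operator on \<open>E\<close> is in bijection with a set of sequences in \<open>E\<close>. The
  lemma \<open>WMP_all_imp_WMP\<close> below derives the property for Banach spaces over every type.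
\<close>

definition WMP_all :: "complex set \<Rightarrow> (complex \<Rightarrow> 'e::real_normed_vector \<Rightarrow> 'e) \<Rightarrow> bool" where
  "WMP_all K s \<longleftrightarrow> (\<forall>F :: (nat \<Rightarrow> 'e) normed_module. banach_module K F \<longrightarrow> WMP K s F)"


section \<open>Properties of \<open>E\<close>\<close>

definition compact_op ::
    "complex set \<Rightarrow> (complex \<Rightarrow> 'e::real_normed_vector \<Rightarrow> 'e) \<Rightarrow> ('e \<Rightarrow> 'e) \<Rightarrow> bool" where
  "compact_op K s T \<longleftrightarrow>
     bounded_linear T \<and> (\<forall>c\<in>K. \<forall>x. T (s c x) = s c (T x)) \<and> compact (closure (T ` cball 0 1))"

definition CAP :: "complex set \<Rightarrow> (complex \<Rightarrow> 'e::real_normed_vector \<Rightarrow> 'e) \<Rightarrow> bool" where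
  "CAP K s \<longleftrightarrow>
     (\<forall>C. compact C \<longrightarrow> (\<forall>\<epsilon>>0. \<exists>T. compact_op K s T \<and> (\<forall>x\<in>C. norm (T x - x) < \<epsilon>)))"

definition isometric_to_lp_square ::
    "complex set \<Rightarrow> (complex \<Rightarrow> 'e::real_normed_vector \<Rightarrow> 'e) \<Rightarrow> real \<Rightarrow> bool" where
  "isometric_to_lp_square K s p \<longleftrightarrow>
     (\<exists>\<Phi> :: 'e \<Rightarrow> 'e \<times> 'e. bij \<Phi> \<and>
        (\<forall>x y. \<Phi> (x + y) = \<Phi> x + \<Phi> y) \<and>
        (\<forall>c\<in>K. \<forall>x. \<Phi> (s c x) = (s c (fst (\<Phi> x)), s c (snd (\<Phi> x)))) \<and>
        (\<forall>x. norm x = (norm (fst (\<Phi> x)) powr p + norm (snd (\<Phi> x)) powr p) powr (1 / p)))"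

definition frechet_differentiable_norm :: "'e::real_normed_vector itself \<Rightarrow> bool" where
  "frechet_differentiable_norm _ \<longleftrightarrow>
     (\<forall>x::'e. x \<noteq> 0 \<longrightarrow> (norm :: 'e \<Rightarrow> real) differentiable (at x))"

definition LUR_norm :: "'e::real_normed_vector itself \<Rightarrow> bool" where
  "LUR_norm _ \<longleftrightarrow>
     (\<forall>(x::'e) y. norm x = 1 \<longrightarrow> (\<forall>n::nat. norm (y n) = 1) \<longrightarrow>
        (\<lambda>n. norm (y n + x)) \<longlonglongrightarrow> 2 \<longrightarrow> (\<lambda>n. norm (y n - x)) \<longlonglongrightarrow> 0)"

definition finite_dim :: "complex set \<Rightarrow> (complex \<Rightarrow> 'e::real_normed_vector \<Rightarrow> 'e) \<Rightarrow> bool" where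
  "finite_dim K s \<longleftrightarrow>
     (\<exists>B. finite B \<and> (\<forall>x. \<exists>a. (\<forall>b\<in>B. a b \<in> K) \<and> x = (\<Sum>b\<in>B. s (a b) b)))"

section \<open>Adequacy of the universe \<open>nat \<Rightarrow> 'e\<close>\<close>

lemma banach_moduleD:
  assumes "banach_module K F"
  shows "module (scalar_ring K) F"
    and "x \<in> carrier F \<Longrightarrow> 0 \<le> nrm F x"
    and "x \<in> carrier F \<Longrightarrow> nrm F x = 0 \<longleftrightarrow> x = \<zero>\<^bsub>F\<^esub>"
    and "x \<in> carrier F \<Longrightarrow> y \<in> carrier F \<Longrightarrow> nrm F (x \<oplus>\<^bsub>F\<^esub> y) \<le> nrm F x + nrm F y"
    and "c \<in> K \<Longrightarrow> x \<in> carrier F \<Longrightarrow> nrm F (c \<odot>\<^bsub>F\<^esub> x) = cmod c * nrm F x"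
    and "(\<And>n. X n \<in> carrier F) \<Longrightarrow>
        (\<And>e. e > 0 \<Longrightarrow> \<exists>M. \<forall>m\<ge>M. \<forall>n\<ge>M. nrm F (X m \<ominus>\<^bsub>F\<^esub> X n) < e) \<Longrightarrow>
        (\<exists>x\<in>carrier F. (\<lambda>n. nrm F (X n \<ominus>\<^bsub>F\<^esub> x)) \<longlonglongrightarrow> 0)"
  using assms unfolding banach_module_def by blast+

lemma scalar_ring_sel [simp]:
  "carrier (scalar_ring K) = K"
  "c \<otimes>\<^bsub>scalar_ring K\<^esub> d = c * d"
  "c \<oplus>\<^bsub>scalar_ring K\<^esub> d = c + d"
  "\<one>\<^bsub>scalar_ring K\<^esub> = 1"
  "\<zero>\<^bsub>scalar_ring K\<^esub> = 0"
  by (simp_all add: scalar_ring_def)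

lemma banach_module_nrm_minus:
  assumes F: "banach_module K F" and x: "x \<in> carrier F"
  shows "nrm F (\<ominus>\<^bsub>F\<^esub> x) = nrm F x"
proof -
  interpret module "scalar_ring K" F by (rule banach_moduleD[OF F])
  define m where "m = \<ominus>\<^bsub>scalar_ring K\<^esub> (1::complex)"
  have one: "(1::complex) \<in> K" using R.one_closed by simp
  have m: "m \<in> K" using R.a_inv_closed[of 1] one by (simp add: m_def)
  have "m + 1 = 0" using R.l_neg[of 1] one by (simp add: m_def)
  then have "m = -1" by (simp add: add_eq_0_iff2)
  have "m \<odot>\<^bsub>F\<^esub> x = \<ominus>\<^bsub>F\<^esub> (1 \<odot>\<^bsub>F\<^esub> x)"
    using smult_l_minus[of 1 x] one x by (simp add: m_def)
  also have "1 \<odot>\<^bsub>F\<^esub> x = x" using smult_one[OF x] by simp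
  finally have "\<ominus>\<^bsub>F\<^esub> x = m \<odot>\<^bsub>F\<^esub> x" by simp
  then show ?thesis using banach_moduleD(5)[OF F m x] \<open>m = -1\<close> by simp
qed

lemma banach_module_minus_commute:
  assumes F: "banach_module K F" and x: "x \<in> carrier F" and y: "y \<in> carrier F"
  shows "nrm F (x \<ominus>\<^bsub>F\<^esub> y) = nrm F (y \<ominus>\<^bsub>F\<^esub> x)"
proof -
  interpret module "scalar_ring K" F by (rule banach_moduleD[OF F])
  have "\<ominus>\<^bsub>F\<^esub> (x \<ominus>\<^bsub>F\<^esub> y) = y \<ominus>\<^bsub>F\<^esub> x"
    using x y by (simp add: a_minus_def M.minus_add M.a_comm)
  then show ?thesis
    using banach_module_nrm_minus[OF F, of "x \<ominus>\<^bsub>F\<^esub> y"] x y by simp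
qed

lemma banach_module_triangle:
  assumes F: "banach_module K F"
    and x: "x \<in> carrier F" and y: "y \<in> carrier F" and z: "z \<in> carrier F"
  shows "nrm F (x \<ominus>\<^bsub>F\<^esub> z) \<le> nrm F (x \<ominus>\<^bsub>F\<^esub> y) + nrm F (y \<ominus>\<^bsub>F\<^esub> z)"
proof -
  interpret module "scalar_ring K" F by (rule banach_moduleD[OF F])
  have "(x \<ominus>\<^bsub>F\<^esub> y) \<oplus>\<^bsub>F\<^esub> (y \<ominus>\<^bsub>F\<^esub> z) = x \<oplus>\<^bsub>F\<^esub> ((\<ominus>\<^bsub>F\<^esub> y \<oplus>\<^bsub>F\<^esub> y) \<oplus>\<^bsub>F\<^esub> \<ominus>\<^bsub>F\<^esub> z)"
    using x y z by (simp add: a_minus_def M.a_assoc del: M.l_neg)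
  also have "\<dots> = x \<ominus>\<^bsub>F\<^esub> z" using x y z by (simp add: a_minus_def M.l_neg)
  finally have "(x \<ominus>\<^bsub>F\<^esub> y) \<oplus>\<^bsub>F\<^esub> (y \<ominus>\<^bsub>F\<^esub> z) = x \<ominus>\<^bsub>F\<^esub> z" .
  then show ?thesis
    using banach_moduleD(4)[OF F, of "x \<ominus>\<^bsub>F\<^esub> y" "y \<ominus>\<^bsub>F\<^esub> z"] x y z by simp
qed

lemma banach_module_limit_unique:
  assumes F: "banach_module K F" and X: "\<And>n. X n \<in> carrier F"
    and x: "x \<in> carrier F" and y: "y \<in> carrier F"
    and limx: "(\<lambda>n. nrm F (X n \<ominus>\<^bsub>F\<^esub> x)) \<longlonglongrightarrow> 0"
    and limy: "(\<lambda>n. nrm F (X n \<ominus>\<^bsub>F\<^esub> y)) \<longlonglongrightarrow> 0"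
  shows "x = y"
proof -
  interpret module "scalar_ring K" F by (rule banach_moduleD[OF F])
  have "nrm F (x \<ominus>\<^bsub>F\<^esub> y) \<le> nrm F (X n \<ominus>\<^bsub>F\<^esub> x) + nrm F (X n \<ominus>\<^bsub>F\<^esub> y)" for n
    using banach_module_triangle[OF F x X y] banach_module_minus_commute[OF F x X] by simp
  then have "nrm F (x \<ominus>\<^bsub>F\<^esub> y) \<le> 0"
    using tendsto_add[OF limx limy] by (intro LIMSEQ_le_const[of _ 0]) auto
  then have "x \<ominus>\<^bsub>F\<^esub> y = \<zero>\<^bsub>F\<^esub>"
    using banach_moduleD(2,3)[OF F, of "x \<ominus>\<^bsub>F\<^esub> y"] x y by simp
  then have "x \<oplus>\<^bsub>F\<^esub> \<ominus>\<^bsub>F\<^esub> y = \<zero>\<^bsub>F\<^esub>" by (simp add: a_minus_def)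
  then have "\<ominus>\<^bsub>F\<^esub> (\<ominus>\<^bsub>F\<^esub> y) = x" using x y by (intro M.minus_equality) auto
  then show ?thesis using y by simp
qed

definition transport_module :: "('f \<Rightarrow> 'g) \<Rightarrow> 'f normed_module \<Rightarrow> 'g normed_module" where
  "transport_module g F =
     (let h = inv_into (carrier F) g in
      \<lparr>carrier = g ` carrier F, mult = (\<lambda>u v. u), one = g \<zero>\<^bsub>F\<^esub>, zero = g \<zero>\<^bsub>F\<^esub>,
       add = (\<lambda>u v. g (h u \<oplus>\<^bsub>F\<^esub> h v)), smult = (\<lambda>c u. g (c \<odot>\<^bsub>F\<^esub> h u)),
       nrm = (\<lambda>u. nrm F (h u))\<rparr>)"

lemma transport_module_sel:
  assumes "inj_on g (carrier F)"
  shows "carrier (transport_module g F) = g ` carrier F"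
    and "\<zero>\<^bsub>transport_module g F\<^esub> = g \<zero>\<^bsub>F\<^esub>"
    and "x \<in> carrier F \<Longrightarrow> y \<in> carrier F \<Longrightarrow>
           g x \<oplus>\<^bsub>transport_module g F\<^esub> g y = g (x \<oplus>\<^bsub>F\<^esub> y)"
    and "x \<in> carrier F \<Longrightarrow> c \<odot>\<^bsub>transport_module g F\<^esub> g x = g (c \<odot>\<^bsub>F\<^esub> x)"
    and "x \<in> carrier F \<Longrightarrow> nrm (transport_module g F) (g x) = nrm F x"
  using assms by (simp_all add: transport_module_def Let_def)

lemma banach_transport_module:
  assumes F: "banach_module K F" and inj: "inj_on g (carrier F)"
  shows "banach_module K (transport_module g F)"
proof -
  interpret module "scalar_ring K" F by (rule banach_moduleD[OF F])
  let ?H = "transport_module g F"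
  note sel = transport_module_sel[OF inj]
  have ag: "abelian_group ?H"
  proof (rule abelian_groupI)
    fix u assume "u \<in> carrier ?H"
    then obtain x where "x \<in> carrier F" "u = g x" by (auto simp: sel)
    then show "\<exists>v\<in>carrier ?H. v \<oplus>\<^bsub>?H\<^esub> u = \<zero>\<^bsub>?H\<^esub>"
      by (intro bexI[of _ "g (\<ominus>\<^bsub>F\<^esub> x)"]) (auto simp: sel M.l_neg)
  qed (auto simp: sel M.a_ac)
  have mod: "module (scalar_ring K) ?H"
  proof (rule moduleI[OF _ ag])
    show "cring (scalar_ring K)" by (rule R.is_cring)
  next
    fix a u assume "a \<in> carrier (scalar_ring K)" "u \<in> carrier ?H"
    then show "a \<odot>\<^bsub>?H\<^esub> u \<in> carrier ?H" by (auto simp: sel)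
  next
    fix a b u
    assume *: "a \<in> carrier (scalar_ring K)" "b \<in> carrier (scalar_ring K)" "u \<in> carrier ?H"
    then obtain x where x: "x \<in> carrier F" "u = g x" by (auto simp: sel)
    show "(a \<oplus>\<^bsub>scalar_ring K\<^esub> b) \<odot>\<^bsub>?H\<^esub> u = a \<odot>\<^bsub>?H\<^esub> u \<oplus>\<^bsub>?H\<^esub> b \<odot>\<^bsub>?H\<^esub> u"
      using * x smult_l_distr[of a b x] by (simp add: sel)
    show "(a \<otimes>\<^bsub>scalar_ring K\<^esub> b) \<odot>\<^bsub>?H\<^esub> u = a \<odot>\<^bsub>?H\<^esub> (b \<odot>\<^bsub>?H\<^esub> u)"
      using * x smult_assoc1[of a b x] by (simp add: sel)
  next
    fix a u v
    assume *: "a \<in> carrier (scalar_ring K)" "u \<in> carrier ?H" "v \<in> carrier ?H"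
    then obtain x y where "x \<in> carrier F" "u = g x" "y \<in> carrier F" "v = g y"
      by (auto simp: sel)
    then show "a \<odot>\<^bsub>?H\<^esub> (u \<oplus>\<^bsub>?H\<^esub> v) = a \<odot>\<^bsub>?H\<^esub> u \<oplus>\<^bsub>?H\<^esub> a \<odot>\<^bsub>?H\<^esub> v"
      using * smult_r_distr[of a x y] by (simp add: sel)
  next
    fix u assume "u \<in> carrier ?H"
    then obtain x where "x \<in> carrier F" "u = g x" by (auto simp: sel)
    then show "\<one>\<^bsub>scalar_ring K\<^esub> \<odot>\<^bsub>?H\<^esub> u = u"
      using smult_one[of x] by (simp add: sel)
  qed
  interpret H: module "scalar_ring K" ?H by (rule mod)
  have neg: "\<ominus>\<^bsub>?H\<^esub> g x = g (\<ominus>\<^bsub>F\<^esub> x)" if "x \<in> carrier F" for x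
    using that by (intro H.M.minus_equality) (auto simp: sel M.l_neg)
  have minus: "g x \<ominus>\<^bsub>?H\<^esub> g y = g (x \<ominus>\<^bsub>F\<^esub> y)" if "x \<in> carrier F" "y \<in> carrier F" for x y
    using that by (simp add: a_minus_def neg sel)
  have complete: "\<exists>u\<in>carrier ?H. (\<lambda>n. nrm ?H (X n \<ominus>\<^bsub>?H\<^esub> u)) \<longlonglongrightarrow> 0"
    if X: "\<forall>n. X n \<in> carrier ?H"
      and cauchy: "\<forall>e>0. \<exists>M. \<forall>m\<ge>M. \<forall>n\<ge>M. nrm ?H (X m \<ominus>\<^bsub>?H\<^esub> X n) < e" for X :: "nat \<Rightarrow> _"
  proof -
    have "\<forall>n. \<exists>y. y \<in> carrier F \<and> X n = g y" using X by (auto simp: sel)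
    then obtain Y where Y: "\<And>n. Y n \<in> carrier F" "\<And>n. X n = g (Y n)" by metis
    have "\<exists>x\<in>carrier F. (\<lambda>n. nrm F (Y n \<ominus>\<^bsub>F\<^esub> x)) \<longlonglongrightarrow> 0"
      using cauchy Y by (intro banach_moduleD(6)[OF F]) (simp_all add: minus sel)
    then obtain x where "x \<in> carrier F" "(\<lambda>n. nrm F (Y n \<ominus>\<^bsub>F\<^esub> x)) \<longlonglongrightarrow> 0" by blast
    then show ?thesis using Y by (intro bexI[of _ "g x"]) (simp_all add: minus sel)
  qed
  show ?thesis
    unfolding banach_module_def
  proof (intro conjI allI impI ballI)
    fix u assume "u \<in> carrier ?H"
    then obtain x where x: "x \<in> carrier F" "u = g x" by (auto simp: sel)
    then show "0 \<le> nrm ?H u" using banach_moduleD(2)[OF F, of x] by (simp add: sel)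
    show "nrm ?H u = 0 \<longleftrightarrow> u = \<zero>\<^bsub>?H\<^esub>"
      using x banach_moduleD(3)[OF F, of x] inj by (auto simp: sel inj_on_eq_iff)
    fix v assume "v \<in> carrier ?H"
    then obtain y where y: "y \<in> carrier F" "v = g y" by (auto simp: sel)
    then show "nrm ?H (u \<oplus>\<^bsub>?H\<^esub> v) \<le> nrm ?H u + nrm ?H v"
      using x banach_moduleD(4)[OF F, of x y] by (simp add: sel)
  next
    fix c u assume c: "c \<in> K" and "u \<in> carrier ?H"
    then obtain x where x: "x \<in> carrier F" "u = g x" by (auto simp: sel)
    then show "nrm ?H (c \<odot>\<^bsub>?H\<^esub> u) = cmod c * nrm ?H u"
      using c banach_moduleD(5)[OF F c, of x] smult_closed[of c x] by (simp add: sel)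
  qed (use mod complete in auto)
qed

lemma banach_module_closed_submodule:
  assumes F: "banach_module K F" and C: "submodule C (scalar_ring K) F"
    and closed: "\<And>X x. (\<And>n. X n \<in> C) \<Longrightarrow> x \<in> carrier F \<Longrightarrow>
      (\<lambda>n. nrm F (X n \<ominus>\<^bsub>F\<^esub> x)) \<longlonglongrightarrow> 0 \<Longrightarrow> x \<in> C"
  shows "banach_module K (F\<lparr>carrier := C\<rparr>)"
proof -
  interpret module "scalar_ring K" F by (rule banach_moduleD[OF F])
  let ?H = "F\<lparr>carrier := C\<rparr>"
  have sub: "C \<subseteq> carrier F" using submoduleE(1)[OF C] .
  have mod: "module (scalar_ring K) ?H"
    using submodule.submodule_is_module[OF C] module_axioms by blast
  interpret H: module "scalar_ring K" ?H by (rule mod)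
  have minus: "x \<ominus>\<^bsub>?H\<^esub> y = x \<ominus>\<^bsub>F\<^esub> y" if "x \<in> C" "y \<in> C" for x y
  proof -
    have "\<ominus>\<^bsub>F\<^esub> y \<in> C" using submoduleE(3)[OF C] that by simp
    then have "\<ominus>\<^bsub>?H\<^esub> y = \<ominus>\<^bsub>F\<^esub> y"
      using that sub by (intro H.M.minus_equality) (auto simp: M.l_neg)
    then show ?thesis by (simp add: a_minus_def)
  qed
  have complete: "\<exists>u\<in>C. (\<lambda>n. nrm F (X n \<ominus>\<^bsub>?H\<^esub> u)) \<longlonglongrightarrow> 0"
    if X: "\<forall>n. X n \<in> C"
      and cauchy: "\<forall>e>0. \<exists>M. \<forall>m\<ge>M. \<forall>n\<ge>M. nrm F (X m \<ominus>\<^bsub>?H\<^esub> X n) < e" for X :: "nat \<Rightarrow> _"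
  proof -
    have "\<exists>x\<in>carrier F. (\<lambda>n. nrm F (X n \<ominus>\<^bsub>F\<^esub> x)) \<longlonglongrightarrow> 0"
      using X cauchy sub by (intro banach_moduleD(6)[OF F]) (auto simp: minus)
    then obtain x where x: "x \<in> carrier F" "(\<lambda>n. nrm F (X n \<ominus>\<^bsub>F\<^esub> x)) \<longlonglongrightarrow> 0" by blast
    have "x \<in> C" using closed[of X x] X x by blast
    then show ?thesis using x X by (intro bexI[of _ x]) (simp_all add: minus)
  qed
  show ?thesis
    unfolding banach_module_def
  proof (intro conjI allI impI ballI)
    fix X :: "nat \<Rightarrow> _"
    assume "\<forall>n. X n \<in> carrier ?H"
      and "\<forall>e>0. \<exists>M. \<forall>m\<ge>M. \<forall>n\<ge>M. nrm ?H (X m \<ominus>\<^bsub>?H\<^esub> X n) < e"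
    then show "\<exists>x\<in>carrier ?H. (\<lambda>n. nrm ?H (X n \<ominus>\<^bsub>?H\<^esub> x)) \<longlonglongrightarrow> 0"
      using complete[of X] by simp
  qed (use mod sub banach_moduleD(2-5)[OF F] in \<open>auto simp: subset_iff\<close>)
qed

lemma WMP_all_imp_WMP:
  fixes s :: "complex \<Rightarrow> 'e::real_normed_vector \<Rightarrow> 'e" and G :: "'g normed_module"
  assumes all: "WMP_all K s" and G: "banach_module K G"
  shows "WMP K s G"
  unfolding WMP_def
proof (intro allI impI)
  fix T :: "'e \<Rightarrow> 'g"
  assume T: "bounded_op K s G T"
    and "\<exists>x. maximizing_sequence G T x \<and> \<not> weakly_null K s x"
  then obtain x where x: "maximizing_sequence G T x" "\<not> weakly_null K s x" by blast
  interpret module "scalar_ring K" G by (rule banach_moduleD[OF G])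
  have Tc: "T u \<in> carrier G" and Tadd: "T (u + v) = T u \<oplus>\<^bsub>G\<^esub> T v"
    and Ts: "c \<in> K \<Longrightarrow> T (s c u) = c \<odot>\<^bsub>G\<^esub> T u" for u v c
    using T by (auto simp: bounded_op_def)
  have one: "(1::complex) \<in> K" using R.one_closed by simp
  have T0: "T 0 = \<zero>\<^bsub>G\<^esub>" using Tadd[of 0 0] Tc[of 0] by simp
  have Tneg: "T (- u) = \<ominus>\<^bsub>G\<^esub> T u" for u
    using Tadd[of "-u" u] T0 Tc by (intro M.minus_equality[symmetric]) auto
  define C where "C = {y \<in> carrier G. \<exists>u. (\<lambda>n. nrm G (T (u n) \<ominus>\<^bsub>G\<^esub> y)) \<longlonglongrightarrow> 0}"
  have C_sub: "C \<subseteq> carrier G" by (auto simp: C_def)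
  have squeeze: "a \<longlonglongrightarrow> 0" if "\<And>n. a n \<le> b n" "\<And>n. 0 \<le> a n" "b \<longlonglongrightarrow> 0" for a b :: "nat \<Rightarrow> real"
    using that by (intro tendsto_sandwich[of "\<lambda>_. 0" a sequentially b]) auto
  have TC: "T u \<in> C" for u
  proof -
    have "nrm G (T u \<ominus>\<^bsub>G\<^esub> T u) = 0"
      using banach_moduleD(3)[OF G, of "\<zero>\<^bsub>G\<^esub>"] Tc[of u] by (simp add: a_minus_def M.r_neg)
    then show ?thesis using Tc by (auto simp: C_def intro!: exI[of _ "\<lambda>_. u"])
  qed
  have closed: "y \<in> C" if X: "\<And>n. X n \<in> C" and y: "y \<in> carrier G"
      and lim: "(\<lambda>n. nrm G (X n \<ominus>\<^bsub>G\<^esub> y)) \<longlonglongrightarrow> 0" for X y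
  proof -
    have Xc: "X n \<in> carrier G" for n using X C_sub by blast
    have "\<exists>w. nrm G (T w \<ominus>\<^bsub>G\<^esub> X n) < inverse (real (Suc n))" for n
    proof -
      obtain u where "(\<lambda>k. nrm G (T (u k) \<ominus>\<^bsub>G\<^esub> X n)) \<longlonglongrightarrow> 0" using X[of n] by (auto simp: C_def)
      then have "eventually (\<lambda>k. nrm G (T (u k) \<ominus>\<^bsub>G\<^esub> X n) < inverse (real (Suc n))) sequentially"
        by (rule order_tendstoD) simp
      then show ?thesis by (auto simp: eventually_sequentially)
    qed
    then obtain w where w: "\<And>n. nrm G (T (w n) \<ominus>\<^bsub>G\<^esub> X n) < inverse (real (Suc n))" by metis
    have "nrm G (T (w n) \<ominus>\<^bsub>G\<^esub> y) \<le> inverse (real (Suc n)) + nrm G (X n \<ominus>\<^bsub>G\<^esub> y)" for n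
      using banach_module_triangle[OF G Tc Xc y, of "w n" n] w[of n] by simp
    moreover have "0 \<le> nrm G (T (w n) \<ominus>\<^bsub>G\<^esub> y)" for n
      using banach_moduleD(2)[OF G, of "T (w n) \<ominus>\<^bsub>G\<^esub> y"] Tc y by simp
    moreover have "(\<lambda>n. inverse (real (Suc n)) + nrm G (X n \<ominus>\<^bsub>G\<^esub> y)) \<longlonglongrightarrow> 0"
      using tendsto_add[OF LIMSEQ_inverse_real_of_nat lim] by simp
    ultimately have "(\<lambda>n. nrm G (T (w n) \<ominus>\<^bsub>G\<^esub> y)) \<longlonglongrightarrow> 0"
      by (rule squeeze)
    then show ?thesis using y by (auto simp: C_def)
  qed
  have add: "y \<oplus>\<^bsub>G\<^esub> z \<in> C" if yz: "y \<in> C" "z \<in> C" for y z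
  proof -
    obtain u v where u: "(\<lambda>n. nrm G (T (u n) \<ominus>\<^bsub>G\<^esub> y)) \<longlonglongrightarrow> 0"
      and v: "(\<lambda>n. nrm G (T (v n) \<ominus>\<^bsub>G\<^esub> z)) \<longlonglongrightarrow> 0" and c: "y \<in> carrier G" "z \<in> carrier G"
      using yz by (auto simp: C_def)
    have "T (u n + v n) \<ominus>\<^bsub>G\<^esub> (y \<oplus>\<^bsub>G\<^esub> z) = (T (u n) \<ominus>\<^bsub>G\<^esub> y) \<oplus>\<^bsub>G\<^esub> (T (v n) \<ominus>\<^bsub>G\<^esub> z)" for n
      using c Tc by (simp add: Tadd a_minus_def M.minus_add M.a_ac)
    then have "nrm G (T (u n + v n) \<ominus>\<^bsub>G\<^esub> (y \<oplus>\<^bsub>G\<^esub> z))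
        \<le> nrm G (T (u n) \<ominus>\<^bsub>G\<^esub> y) + nrm G (T (v n) \<ominus>\<^bsub>G\<^esub> z)" for n
      using banach_moduleD(4)[OF G, of "T (u n) \<ominus>\<^bsub>G\<^esub> y" "T (v n) \<ominus>\<^bsub>G\<^esub> z"] c Tc by simp
    moreover have "0 \<le> nrm G (T (u n + v n) \<ominus>\<^bsub>G\<^esub> (y \<oplus>\<^bsub>G\<^esub> z))" for n
      using banach_moduleD(2)[OF G, of "T (u n + v n) \<ominus>\<^bsub>G\<^esub> (y \<oplus>\<^bsub>G\<^esub> z)"] Tc c by simp
    moreover have "(\<lambda>n. nrm G (T (u n) \<ominus>\<^bsub>G\<^esub> y) + nrm G (T (v n) \<ominus>\<^bsub>G\<^esub> z)) \<longlonglongrightarrow> 0"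
      using tendsto_add[OF u v] by simp
    ultimately have "(\<lambda>n. nrm G (T (u n + v n) \<ominus>\<^bsub>G\<^esub> (y \<oplus>\<^bsub>G\<^esub> z))) \<longlonglongrightarrow> 0"
      by (rule squeeze)
    then show ?thesis using c by (auto simp: C_def intro!: exI[of _ "\<lambda>n. u n + v n"])
  qed
  have smult: "a \<odot>\<^bsub>G\<^esub> y \<in> C" if a: "a \<in> K" and y: "y \<in> C" for a y
  proof -
    obtain u where u: "(\<lambda>n. nrm G (T (u n) \<ominus>\<^bsub>G\<^esub> y)) \<longlonglongrightarrow> 0" and c: "y \<in> carrier G"
      using y by (auto simp: C_def)
    have ac: "a \<odot>\<^bsub>G\<^esub> z \<in> carrier G" if "z \<in> carrier G" for z using a that by simp
    have "T (s a (u n)) \<ominus>\<^bsub>G\<^esub> a \<odot>\<^bsub>G\<^esub> y = a \<odot>\<^bsub>G\<^esub> (T (u n) \<ominus>\<^bsub>G\<^esub> y)" for n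
      using smult_r_distr[of a "T (u n)" "\<ominus>\<^bsub>G\<^esub> y"] smult_r_minus[of a y] a c Tc
      by (simp add: a_minus_def Ts)
    then have "nrm G (T (s a (u n)) \<ominus>\<^bsub>G\<^esub> a \<odot>\<^bsub>G\<^esub> y) = cmod a * nrm G (T (u n) \<ominus>\<^bsub>G\<^esub> y)" for n
      using banach_moduleD(5)[OF G a, of "T (u n) \<ominus>\<^bsub>G\<^esub> y"] c Tc by simp
    then have "(\<lambda>n. nrm G (T (s a (u n)) \<ominus>\<^bsub>G\<^esub> a \<odot>\<^bsub>G\<^esub> y)) \<longlonglongrightarrow> 0"
      using tendsto_mult_left[OF u, of "cmod a"] by simp
    then show ?thesis using ac[OF c] by (auto simp: C_def intro!: exI[of _ "\<lambda>n. s a (u n)"])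
  qed
  have sub: "submodule C (scalar_ring K) G"
  proof (rule submoduleI)
    show "C \<subseteq> carrier G" by (rule C_sub)
    show "\<zero>\<^bsub>G\<^esub> \<in> C" using TC[of 0] T0 by simp
  next
    fix y assume y: "y \<in> C"
    define m where "m = \<ominus>\<^bsub>scalar_ring K\<^esub> (1::complex)"
    have m: "m \<in> K" using R.a_inv_closed[of 1] one by (simp add: m_def)
    have yc: "y \<in> carrier G" using y C_sub by blast
    have "m \<odot>\<^bsub>G\<^esub> y = \<ominus>\<^bsub>G\<^esub> y"
      using smult_l_minus[of 1 y] smult_one[OF yc] one yc by (simp add: m_def)
    then show "\<ominus>\<^bsub>G\<^esub> y \<in> C" using smult[OF m y] by simp
  qed (use add smult in auto)
  let ?G = "G\<lparr>carrier := C\<rparr>"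
  have bG: "banach_module K ?G"
    using banach_module_closed_submodule[OF G sub] closed by blast
  define g where "g y = (SOME u. (\<lambda>n. nrm G (T (u n) \<ominus>\<^bsub>G\<^esub> y)) \<longlonglongrightarrow> 0)" for y
  have g: "(\<lambda>n. nrm G (T (g y n) \<ominus>\<^bsub>G\<^esub> y)) \<longlonglongrightarrow> 0" if "y \<in> C" for y
  proof -
    have "\<exists>u. (\<lambda>n. nrm G (T (u n) \<ominus>\<^bsub>G\<^esub> y)) \<longlonglongrightarrow> 0" using that by (simp add: C_def)
    then show ?thesis unfolding g_def by (rule someI_ex)
  qed
  have inj: "inj_on g (carrier ?G)"
  proof (rule inj_onI)
    fix y z assume "y \<in> carrier ?G" "z \<in> carrier ?G" and eq: "g y = g z"
    then have yz: "y \<in> C" "z \<in> C" by auto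
    show "y = z"
      by (rule banach_module_limit_unique[OF G, of "\<lambda>n. T (g y n)"])
        (use yz C_sub Tc g[of y] g[of z] eq in auto)
  qed
  let ?H = "transport_module g ?G"
  note sel = transport_module_sel[OF inj]
  have bH: "banach_module K ?H" by (rule banach_transport_module[OF bG inj])
  have nH: "nrm ?H (g (T u)) = nrm G (T u)" for u using sel(5)[of "T u"] TC by simp
  have op: "opnorm ?H (\<lambda>u. g (T u)) = opnorm G T" by (simp add: opnorm_def nH)
  have "bounded_op K s ?H (\<lambda>u. g (T u))"
    using T TC sel unfolding bounded_op_def by (auto simp: nH)
  moreover have "maximizing_sequence ?H (\<lambda>u. g (T u)) x"
    using x(1) by (simp add: maximizing_sequence_def op nH)
  ultimately have "attains_norm ?H (\<lambda>u. g (T u))"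
    using all bH x(2) unfolding WMP_all_def WMP_def by blast
  then show "attains_norm G T" by (simp add: attains_norm_def op nH)
qed

end

theory Submission
  imports Defs
begin

text \<open>
  The weak maximizing property for all targets says that a continuous seminorm \<open>q\<close> on \<open>E\<close> attains
  its supremum over the unit sphere as soon as it has a maximizing sequence that is not weakly null;
  since \<open>q\<close> may be replaced by the maximum of \<open>q\<close> over the circle of scalars, the real scalars suffice.
  This has two consequences for functionals on \<open>E\<close>.

  First, if a bounded sequence \<open>F\<close> of functionals tends to 0 pointwise on a subspace \<open>Y\<close>, then some
  convex combination of the \<open>F n\<close> is small in norm on \<open>Y\<close>. Otherwise James' construction gives convex
  combinations \<open>g n\<close> and a limit \<open>v\<close> such that the seminorm \<open>limsup \<bar>(g n - v) x\<bar>\<close> does not attain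
  its supremum. Secondly, if the functionals \<open>g n\<close> of norm at most 1 are weak* null, then
  \<open>norm (h + g n)\<close> is eventually below \<open>max 1 (norm h) + e\<close>. Otherwise the seminorm
  \<open>sup a\<^sub>n \<bar>(h + g n) x\<bar>\<close>, scaled so that the norms of the \<open>a\<^sub>n (h + g n)\<close> increase strictly to
  their limit, does not attain its supremum.

  If \<open>E\<close> is infinite dimensional, Mazur's method gives normalized functionals \<open>f n\<close> that tend to 0
  on a subspace \<open>Y\<close> norming their span. The first property shows that they are weak* null, the second
  that a subsequence has bounded partial sums, and the first, applied to the remainders of
  the series on \<open>Y\<close>, contradicts the fact that these remainders stay away from 0.
\<close>

section \<open>Sublinear functionals and the Hahn-Banach theorem\<close>

definition sublinear :: "('a::real_vector \<Rightarrow> real) \<Rightarrow> bool" where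
  "sublinear p \<longleftrightarrow>
     (\<forall>x y. p (x + y) \<le> p x + p y) \<and> (\<forall>c\<ge>0. \<forall>x. p (c *\<^sub>R x) = c * p x)"

lemma sublinearD:
  assumes "sublinear p"
  shows "p (x + y) \<le> p x + p y" and "c \<ge> 0 \<Longrightarrow> p (c *\<^sub>R x) = c * p x" and "p 0 = 0"
    and "- p (- x) \<le> p x"
proof -
  show add: "p (x + y) \<le> p x + p y" for x y using assms by (simp add: sublinear_def)
  show hom: "c \<ge> 0 \<Longrightarrow> p (c *\<^sub>R x) = c * p x" for c x using assms by (simp add: sublinear_def)
  show zero: "p 0 = 0" using hom[of 0 0] by simp
  show "- p (- x) \<le> p x" using add[of x "- x"] zero by simp
qed

text \<open>Applying \<open>hom\<close> to \<open>inverse c\<close> and \<open>c *\<^sub>R x\<close>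
  reverses the inequality, so the upper estimate for positive scalars suffices.\<close>

lemma sublinearI:
  assumes add: "\<And>x y. p (x + y) \<le> p x + p y" and zero: "p 0 = 0"
    and hom: "\<And>c x. c > 0 \<Longrightarrow> p (c *\<^sub>R x) \<le> c * p x"
  shows "sublinear p"
proof -
  have "p (c *\<^sub>R x) = c * p x" if "c \<ge> 0" for c x
  proof (cases "c = 0")
    case False
    with that have c: "c > 0" by simp
    have "p x \<le> inverse c * p (c *\<^sub>R x)"
      using hom[of "inverse c" "c *\<^sub>R x"] c by simp
    then have "c * p x \<le> p (c *\<^sub>R x)" using c by (simp add: field_simps)
    with hom[OF c, of x] show ?thesis by simp
  qed (simp add: zero)
  then show ?thesis using add by (simp add: sublinear_def)
qed

text \<open>Writing \<open>x\<close> as \<open>(x + y) + (- y)\<close> and using oddness reverses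
  subadditivity. Oddness also carries homogeneity over to negative scalars.\<close>

lemma sublinear_odd_imp_linear:
  assumes p: "sublinear p" and odd: "\<And>x. p (- x) \<le> - p x"
  shows "linear p"
proof (rule linearI)
  have odd_eq: "p (- x) = - p x" for x
    using odd[of x] sublinearD(4)[OF p, of x] by simp
  fix x y
  show "p (x + y) = p x + p y"
    using sublinearD(1)[OF p, of x y] sublinearD(1)[OF p, of "x + y" "- y"] odd_eq[of y] by simp
  fix c :: real
  show "p (c *\<^sub>R x) = c *\<^sub>R p x"
  proof (cases "c \<ge> 0")
    case False
    then have "p ((- c) *\<^sub>R x) = (- c) * p x" by (intro sublinearD(2)[OF p]) simp
    then show ?thesis using odd_eq[of "c *\<^sub>R x"] by simp
  qed (simp add: sublinearD(2)[OF p])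
qed

text \<open>
  Serves both for the minimality argument (\<open>Z\<close> a ray) and for the extension (\<open>Z\<close> a subspace).
\<close>

lemma sublinear_infimal_convolution:
  fixes p :: "'a::real_vector \<Rightarrow> real"
  assumes p: "sublinear p"
    and Z: "0 \<in> Z" "\<And>z w. z \<in> Z \<Longrightarrow> w \<in> Z \<Longrightarrow> z + w \<in> Z"
      "\<And>c z. c > 0 \<Longrightarrow> z \<in> Z \<Longrightarrow> c *\<^sub>R z \<in> Z"
    and \<phi>: "\<phi> 0 = 0" "\<And>z w. z \<in> Z \<Longrightarrow> w \<in> Z \<Longrightarrow> \<phi> (z + w) = \<phi> z + \<phi> w"
      "\<And>c z. c > 0 \<Longrightarrow> z \<in> Z \<Longrightarrow> \<phi> (c *\<^sub>R z) = c * \<phi> z"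
    and lower: "\<And>z. z \<in> Z \<Longrightarrow> - p (- z) \<le> \<phi> z"
  obtains r where "sublinear r" "\<And>x. r x \<le> p x" "\<And>z. z \<in> Z \<Longrightarrow> r z \<le> \<phi> z"
proof -
  \<comment> \<open>The choice \<open>z = 0\<close> in the infimum gives \<open>r \<le> p\<close>,
    the choice \<open>z = x\<close> gives \<open>r \<le> \<phi>\<close> on \<open>Z\<close>, and
    \<open>lower\<close> keeps the infimum finite.\<close>
  define r where "r x = (INF z\<in>Z. p (x - z) + \<phi> z)" for x
  have ge: "- p (- x) \<le> p (x - z) + \<phi> z" if "z \<in> Z" for x z
    using sublinearD(1)[OF p, of "x - z" "- x"] lower[OF that] by simp
  then have bdd: "bdd_below ((\<lambda>z. p (x - z) + \<phi> z) ` Z)" for x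
    by (intro bdd_belowI2[of _ "- p (- x)"])
  have le: "r x \<le> p (x - z) + \<phi> z" if "z \<in> Z" for x z
    unfolding r_def using that by (rule cINF_lower[OF bdd])
  have greatest: "m \<le> r x" if "\<And>z. z \<in> Z \<Longrightarrow> m \<le> p (x - z) + \<phi> z" for m x
    unfolding r_def using Z(1) that by (intro cINF_greatest) auto
  have add: "r (x + y) \<le> r x + r y" for x y
  proof -
    have *: "r (x + y) \<le> (p (x - z) + \<phi> z) + (p (y - w) + \<phi> w)" if "z \<in> Z" "w \<in> Z" for z w
    proof -
      have "r (x + y) \<le> p ((x + y) - (z + w)) + \<phi> (z + w)" using that Z by (intro le) auto
      also have "(x + y) - (z + w) = (x - z) + (y - w)" by simp
      finally show ?thesis
        using sublinearD(1)[OF p, of "x - z" "y - w"] \<phi>(2)[OF that] by linarith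
    qed
    have "r (x + y) - r y \<le> r x"
    proof (rule greatest)
      fix z assume z: "z \<in> Z"
      have "r (x + y) - (p (x - z) + \<phi> z) \<le> r y"
        using *[OF z] by (intro greatest) (simp add: algebra_simps)
      then show "r (x + y) - r y \<le> p (x - z) + \<phi> z" by simp
    qed
    then show ?thesis by simp
  qed
  have hom: "r (c *\<^sub>R x) \<le> c * r x" if c: "c > 0" for c x
  proof -
    have "r (c *\<^sub>R x) / c \<le> r x"
    proof (rule greatest)
      fix z assume z: "z \<in> Z"
      have "r (c *\<^sub>R x) \<le> p (c *\<^sub>R x - c *\<^sub>R z) + \<phi> (c *\<^sub>R z)" using z c Z by (intro le) auto
      also have "c *\<^sub>R x - c *\<^sub>R z = c *\<^sub>R (x - z)" by (simp add: algebra_simps)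
      finally have "r (c *\<^sub>R x) \<le> c * (p (x - z) + \<phi> z)"
        using c z sublinearD(2)[OF p, of c "x - z"] by (simp add: \<phi>(3) distrib_left)
      then show "r (c *\<^sub>R x) / c \<le> p (x - z) + \<phi> z" using c by (simp add: field_simps)
    qed
    then show ?thesis using c by (simp add: field_simps)
  qed
  have "r 0 = 0"
    using le[OF Z(1), of 0] greatest[of 0 0] ge[of _ 0] by (simp add: sublinearD(3)[OF p] \<phi>(1))
  then have "sublinear r" using add hom by (intro sublinearI)
  moreover have "r x \<le> p x" for x using le[OF Z(1), of x] by (simp add: \<phi>(1))
  moreover have "r z \<le> \<phi> z" if "z \<in> Z" for z using le[OF that, of z] by (simp add: sublinearD(3)[OF p])
  ultimately show ?thesis using that by blast
qed

section \<open>Minimal sublinear functionals and Zorn's lemma\<close>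

text \<open>The function \<open>- p (- z)\<close> is additive on the ray through \<open>- y\<close>,
  because \<open>p\<close> is linear on the ray through \<open>y\<close>; its infimal convolution
  with \<open>p\<close> is the required \<open>r\<close>. Applied to a minimal sublinear functional
  this gives oddness, applied at a given point it gives a supporting functional.\<close>

lemma sublinear_odd_at:
  fixes p :: "'a::real_vector \<Rightarrow> real"
  assumes p: "sublinear p"
  obtains r where "sublinear r" "\<And>x. r x \<le> p x" "r (- y) \<le> - p y"
proof -
  define Z where "Z = (\<lambda>t. - (t *\<^sub>R y)) ` {0..}"
  obtain r where r: "sublinear r" "\<And>x. r x \<le> p x" "\<And>z. z \<in> Z \<Longrightarrow> r z \<le> - p (- z)"
  proof (rule sublinear_infimal_convolution[OF p, of Z "\<lambda>z. - p (- z)"])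
    fix z w assume "z \<in> Z" "w \<in> Z"
    then obtain t t' where t: "z = - (t *\<^sub>R y)" "t \<ge> 0" "w = - (t' *\<^sub>R y)" "t' \<ge> 0"
      by (auto simp: Z_def)
    then have eq: "z + w = - ((t + t') *\<^sub>R y)" by (simp add: algebra_simps)
    then show "z + w \<in> Z" using t by (auto simp: Z_def)
    have "p (- (z + w)) = (t + t') * p y"
      using t sublinearD(2)[OF p, of "t + t'" y] unfolding eq by simp
    then show "- p (- (z + w)) = - p (- z) + - p (- w)"
      using t by (simp add: sublinearD(2)[OF p] distrib_right)
  next
    fix c :: real and z assume c: "c > 0" and "z \<in> Z"
    then obtain t where "z = - (t *\<^sub>R y)" "t \<ge> 0" by (auto simp: Z_def)
    then show "c *\<^sub>R z \<in> Z" using c by (auto simp: Z_def intro!: image_eqI[of _ _ "c * t"])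
    show "- p (- (c *\<^sub>R z)) = c * - p (- z)"
      using c sublinearD(2)[OF p, of c "- z"] by simp
  qed (auto simp: sublinearD(3)[OF p] Z_def intro: image_eqI[of _ _ 0])
  have "- y \<in> Z" by (auto simp: Z_def intro: image_eqI[of _ _ 1])
  then show ?thesis using that[OF r(1,2)] r(3)[of "- y"] by simp
qed

text \<open>Supplies the lower bounds for Zorn's lemma. The common majorant \<open>p\<close> keeps
  the pointwise infimum finite, since \<open>- p (- x) \<le> r x\<close>; comparability lets a
  single member of the chain serve for both \<open>x\<close> and \<open>y\<close> in the proof of
  subadditivity.\<close>

lemma sublinear_chain_Inf:
  fixes p :: "'a::real_vector \<Rightarrow> real"
  assumes C: "C \<noteq> {}" "\<And>r. r \<in> C \<Longrightarrow> sublinear r" "\<And>r x. r \<in> C \<Longrightarrow> r x \<le> p x"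
    and chain: "\<And>r r'. r \<in> C \<Longrightarrow> r' \<in> C \<Longrightarrow> (\<forall>x. r x \<le> r' x) \<or> (\<forall>x. r' x \<le> r x)"
  obtains m where "sublinear m" "\<And>r x. r \<in> C \<Longrightarrow> m x \<le> r x"
proof -
  define m where "m x = (INF r\<in>C. r x)" for x
  have "- p (- x) \<le> r x" if "r \<in> C" for r x
    using sublinearD(4)[OF C(2)[OF that], of x] C(3)[OF that, of "- x"] by linarith
  then have bdd: "bdd_below ((\<lambda>r. r x) ` C)" for x by (intro bdd_belowI2[of _ "- p (- x)"])
  have le: "m x \<le> r x" if "r \<in> C" for x r
    unfolding m_def using that by (rule cINF_lower[OF bdd])
  have greatest: "t \<le> m x" if "\<And>r. r \<in> C \<Longrightarrow> t \<le> r x" for t x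
    unfolding m_def using C(1) that by (intro cINF_greatest) auto
  have add: "m (x + y) \<le> m x + m y" for x y
  proof -
    have *: "m (x + y) \<le> r x + r' y" if r: "r \<in> C" "r' \<in> C" for r r'
    proof -
      have "m (x + y) \<le> r'' x + r'' y" if "r'' \<in> C" for r''
        using le[OF that, of "x + y"] sublinearD(1)[OF C(2)[OF that], of x y] by linarith
      from this[OF r(1)] this[OF r(2)] chain[OF r] show ?thesis
        by (meson add_left_mono add_right_mono order_trans)
    qed
    have "m (x + y) - m y \<le> m x"
    proof (rule greatest)
      fix r assume r: "r \<in> C"
      have "m (x + y) - r x \<le> m y" using *[OF r] by (intro greatest) (simp add: algebra_simps)
      then show "m (x + y) - m y \<le> r x" by simp
    qed
    then show ?thesis by simp
  qed
  have hom: "m (c *\<^sub>R x) \<le> c * m x" if c: "c > 0" for c x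
  proof -
    have "m (c *\<^sub>R x) / c \<le> m x"
      using le[of _ "c *\<^sub>R x"] c
      by (intro greatest) (simp add: sublinearD(2)[OF C(2)] field_simps)
    then show ?thesis using c by (simp add: field_simps)
  qed
  obtain r0 where "r0 \<in> C" using C(1) by blast
  then have "m 0 = 0"
    using le[of r0 0] greatest[of 0 0] sublinearD(3)[OF C(2)] by fastforce
  then have "sublinear m" using add hom by (intro sublinearI)
  with le show ?thesis using that by blast
qed

text \<open>A minimal sublinear functional below \<open>p\<close> is odd by
  \<open>sublinear_odd_at\<close>, and therefore linear.\<close>

lemma linear_below_sublinear:
  fixes p :: "'a::real_vector \<Rightarrow> real"
  assumes p: "sublinear p"
  obtains u where "linear u" "\<And>x. u x \<le> p x"
proof -
  define A where "A = {r. sublinear r \<and> (\<forall>x. r x \<le> p x)}"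
  \<comment> \<open>The order is reversed: the maximal element of Zorn's lemma is a minimal
    functional.\<close>
  let ?P = "\<lambda>r r' :: 'a \<Rightarrow> real. \<forall>x. r' x \<le> r x"
  have "\<exists>m\<in>A. \<forall>a\<in>A. ?P m a \<longrightarrow> a = m"
  proof (rule predicate_Zorn)
    show "partial_order_on A (relation_of ?P A)"
      by (rule partial_order_on_relation_ofI) (auto intro: order_trans antisym simp: fun_eq_iff)
  next
    fix C assume C: "C \<in> Chains (relation_of ?P A)"
    show "\<exists>m\<in>A. \<forall>r\<in>C. ?P r m"
    proof (cases "C = {}")
      case True
      then show ?thesis using p by (auto simp: A_def)
    next
      case False
      have sub: "r \<in> A" if "r \<in> C" for r
        using C that by (auto simp: Chains_def relation_of_def)
      have chain: "(\<forall>x. r x \<le> r' x) \<or> (\<forall>x. r' x \<le> r x)" if "r \<in> C" "r' \<in> C" for r r'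
        using C that by (auto simp: Chains_def relation_of_def)
      obtain m where m: "sublinear m" "\<And>r x. r \<in> C \<Longrightarrow> m x \<le> r x"
        using sublinear_chain_Inf[of C p] False sub chain unfolding A_def by blast
      then have "m \<in> A" using False sub unfolding A_def by (blast intro: order_trans)
      then show ?thesis using m by blast
    qed
  qed
  then obtain m where mA: "m \<in> A" and max: "\<And>a. a \<in> A \<Longrightarrow> (\<forall>x. a x \<le> m x) \<Longrightarrow> a = m" by blast
  have m: "sublinear m" "m x \<le> p x" for x using mA by (auto simp: A_def)
  have min: "r = m" if "sublinear r" "\<And>x. r x \<le> m x" for r
    using that mA by (intro max) (auto simp: A_def intro: order_trans)
  have "m (- y) \<le> - m y" for y
  proof -
    obtain r where r: "sublinear r" "\<And>x. r x \<le> m x" "r (- y) \<le> - m y"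
      using sublinear_odd_at[OF m(1)] by blast
    then have "r = m" by (intro min)
    with r(3) show ?thesis by simp
  qed
  then have "linear m" by (rule sublinear_odd_imp_linear[OF m(1)])
  with m that show ?thesis by blast
qed

text \<open>A sublinear \<open>r\<close> below \<open>p\<close> that is at most \<open>u\<close> on
  \<open>Y\<close> has a linear minorant \<open>v\<close>. Comparing \<open>v\<close> with
  \<open>u\<close> at \<open>y\<close> and at \<open>- y\<close> forces equality on
  \<open>Y\<close>.\<close>

theorem hahn_banach:
  fixes p :: "'a::real_vector \<Rightarrow> real"
  assumes p: "sublinear p" and Y: "subspace Y"
    and add: "\<And>x y. x \<in> Y \<Longrightarrow> y \<in> Y \<Longrightarrow> u (x + y) = u x + u y"
    and scale: "\<And>c x. x \<in> Y \<Longrightarrow> u (c *\<^sub>R x) = c * u x"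
    and le: "\<And>y. y \<in> Y \<Longrightarrow> u y \<le> p y"
  obtains v where "linear v" "\<And>x. v x \<le> p x" "\<And>y. y \<in> Y \<Longrightarrow> v y = u y"
proof -
  have neg: "- y \<in> Y" "u (- y) = - u y" if "y \<in> Y" for y
    using that Y scale[of y "-1"] by (auto simp: subspace_neg)
  obtain r where r: "sublinear r" "\<And>x. r x \<le> p x" "\<And>y. y \<in> Y \<Longrightarrow> r y \<le> u y"
  proof (rule sublinear_infimal_convolution[OF p, of Y u])
    show "u 0 = 0" using scale[of 0 0] Y by (simp add: subspace_0)
    show "- p (- z) \<le> u z" if "z \<in> Y" for z using le[of "- z"] neg that by fastforce
  qed (use Y add scale in \<open>auto simp: subspace_0 subspace_add subspace_scale\<close>)
  obtain v where v: "linear v" "\<And>x. v x \<le> r x" using linear_below_sublinear[OF r(1)] by blast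
  have "v y = u y" if y: "y \<in> Y" for y
  proof -
    have "v (- y) \<le> u (- y)" using v(2)[of "- y"] r(3)[OF neg(1)[OF y]] by linarith
    then have "u y \<le> v y" using neg(2)[OF y] linear_neg[OF v(1), of y] by simp
    moreover have "v y \<le> u y" using v(2)[of y] r(3)[OF y] by linarith
    ultimately show ?thesis by simp
  qed
  moreover have "v x \<le> p x" for x using v(2)[of x] r(2)[of x] by linarith
  ultimately show ?thesis using v(1) that by blast
qed

section \<open>Extension of bounded functionals\<close>

lemma blinfun_of_bounded_linear_functional:
  fixes u :: "'a::real_normed_vector \<Rightarrow> real"
  assumes "linear u" and "\<And>x. u x \<le> C * norm x" and "C \<ge> 0"
  obtains v :: "'a \<Rightarrow>\<^sub>L real" where "\<And>x. blinfun_apply v x = u x" "norm v \<le> C"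
proof -
  have "\<bar>u x\<bar> \<le> norm x * C" for x
    using assms(2)[of x] assms(2)[of "- x"] linear_neg[OF assms(1), of x] by (simp add: mult.commute)
  then have "bounded_linear u"
    using assms(1) by (intro bounded_linear_intro[where K = C]) (auto simp: linear_add linear_cmul)
  then have "blinfun_apply (Blinfun u) x = u x" for x by (rule bounded_linear_Blinfun_apply[THEN fun_cong])
  moreover from this have "norm (Blinfun u) \<le> C"
    using \<open>\<And>x. \<bar>u x\<bar> \<le> norm x * C\<close> assms(3) by (intro norm_blinfun_bound) (auto simp: mult.commute)
  ultimately show ?thesis using that by blast
qed

lemma sublinear_norm: "c \<ge> 0 \<Longrightarrow> sublinear (\<lambda>x::'a::real_normed_vector. c * norm x)"
  using norm_triangle_ineq[THEN mult_left_mono, of c]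
  by (auto simp: sublinear_def distrib_left)

lemma hahn_banach_norm:
  fixes Y :: "'a::real_normed_vector set" and u :: "'a \<Rightarrow> real"
  assumes Y: "subspace Y"
    and add: "\<And>x y. x \<in> Y \<Longrightarrow> y \<in> Y \<Longrightarrow> u (x + y) = u x + u y"
    and scale: "\<And>c x. x \<in> Y \<Longrightarrow> u (c *\<^sub>R x) = c * u x"
    and le: "\<And>y. y \<in> Y \<Longrightarrow> \<bar>u y\<bar> \<le> c * norm y" and c: "c \<ge> 0"
  obtains v :: "'a \<Rightarrow>\<^sub>L real" where "norm v \<le> c" "\<And>y. y \<in> Y \<Longrightarrow> blinfun_apply v y = u y"
proof -
  have "u y \<le> c * norm y" if "y \<in> Y" for y using le[OF that] by linarith
  then obtain w where w: "linear w" "\<And>x. w x \<le> c * norm x" "\<And>y. y \<in> Y \<Longrightarrow> w y = u y"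
    using hahn_banach[OF sublinear_norm[OF c] Y add scale] by metis
  obtain v :: "'a \<Rightarrow>\<^sub>L real" where "\<And>x. blinfun_apply v x = w x" "norm v \<le> c"
    using blinfun_of_bounded_linear_functional[OF w(1,2) c] by blast
  with w that show ?thesis by auto
qed

text \<open>Once \<open>q\<close> has been lowered by \<open>sublinear_odd_at\<close>, every linear
  functional below the result takes the value \<open>q x\<close> at \<open>x\<close>.\<close>

lemma hahn_banach_support:
  fixes q :: "'a::real_normed_vector \<Rightarrow> real"
  assumes q: "sublinear q" and le: "\<And>x. q x \<le> C * norm x" and C: "C \<ge> 0"
  obtains v :: "'a \<Rightarrow>\<^sub>L real" where "\<And>y. blinfun_apply v y \<le> q y" "blinfun_apply v x = q x"
proof -
  obtain r where r: "sublinear r" "\<And>y. r y \<le> q y" "r (- x) \<le> - q x"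
    using sublinear_odd_at[OF q] by blast
  obtain u where u: "linear u" "\<And>y. u y \<le> r y" using linear_below_sublinear[OF r(1)] by blast
  have uq: "u y \<le> q y" for y using u(2)[of y] r(2)[of y] by linarith
  have "u (- x) \<le> - q x" using u(2)[of "- x"] r(3) by linarith
  then have eq: "u x = q x" using uq[of x] linear_neg[OF u(1), of x] by simp
  have "u y \<le> C * norm y" for y using uq[of y] le[of y] by linarith
  then obtain v :: "'a \<Rightarrow>\<^sub>L real" where "\<And>x. blinfun_apply v x = u x"
    using blinfun_of_bounded_linear_functional[OF u(1) _ C] by blast
  then show ?thesis using that[of v] uq eq by simp
qed

section \<open>Upper limits and convex blocks\<close>

text \<open>The limit superior with values in \<open>real\<close>, as the infimum of the eventual
  upper bounds. It has this meaning for bounded sequences, the setting of the lemmas below.\<close>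

definition upper_limit :: "(nat \<Rightarrow> real) \<Rightarrow> real" where
  "upper_limit a = Inf {t. \<forall>\<^sub>F n in sequentially. a n \<le> t}"

context
  fixes a :: "nat \<Rightarrow> real" and M :: real
  assumes bound: "\<And>n. \<bar>a n\<bar> \<le> M"
begin

lemma upper_limit_le:
  assumes "\<forall>\<^sub>F n in sequentially. a n \<le> t"
  shows "upper_limit a \<le> t"
proof -
  have "- M \<le> t" if ev: "\<forall>\<^sub>F n in sequentially. a n \<le> t" for t
  proof -
    obtain n where "a n \<le> t" using eventually_happens'[OF _ ev] by auto
    then show ?thesis using bound[of n] by simp
  qed
  then have "bdd_below {t. \<forall>\<^sub>F n in sequentially. a n \<le> t}" by (intro bdd_belowI[of _ "- M"]) auto
  then show ?thesis unfolding upper_limit_def using assms by (intro cInf_lower) auto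
qed

lemma upper_limit_eventually:
  assumes "upper_limit a < t"
  shows "\<forall>\<^sub>F n in sequentially. a n \<le> t"
proof -
  have "\<forall>\<^sub>F n in sequentially. a n \<le> M" using bound by (auto simp: abs_le_iff)
  then have "{t. \<forall>\<^sub>F n in sequentially. a n \<le> t} \<noteq> {}" by blast
  from cInf_lessD[OF this, of t] obtain t' where "\<forall>\<^sub>F n in sequentially. a n \<le> t'" "t' < t"
    using assms unfolding upper_limit_def by blast
  then show ?thesis by (auto elim: eventually_mono)
qed

lemma upper_limit_frequently:
  assumes "t < upper_limit a"
  shows "\<exists>n\<ge>N. t < a n"
proof (rule ccontr)
  assume "\<not> (\<exists>n\<ge>N. t < a n)"
  then have "\<forall>\<^sub>F n in sequentially. a n \<le> t" by (auto simp: eventually_sequentially not_less)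
  with upper_limit_le assms show False by fastforce
qed

lemma upper_limit_bound: "\<bar>upper_limit a\<bar> \<le> M"
proof -
  have "upper_limit a \<le> M" using bound by (intro upper_limit_le) (auto simp: abs_le_iff)
  moreover have "- M \<le> upper_limit a"
  proof (rule ccontr)
    assume "\<not> - M \<le> upper_limit a"
    then have "\<forall>\<^sub>F n in sequentially. a n \<le> (upper_limit a + - M) / 2"
      by (intro upper_limit_eventually) simp
    then obtain n where "a n \<le> (upper_limit a + - M) / 2"
      using eventually_happens'[of sequentially] by auto
    with \<open>\<not> - M \<le> upper_limit a\<close> bound[of n] show False by (simp add: abs_le_iff)
  qed
  ultimately show ?thesis by simp
qed

end

lemma upper_limit_eqI:
  assumes "a \<longlonglongrightarrow> L" and bound: "\<And>n. \<bar>a n\<bar> \<le> M"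
  shows "upper_limit a = L"
proof (rule antisym)
  show "upper_limit a \<le> L"
  proof (rule field_le_epsilon)
    fix e :: real assume "e > 0"
    then have "\<forall>\<^sub>F n in sequentially. a n < L + e" using assms(1) by (intro order_tendstoD) auto
    then show "upper_limit a \<le> L + e"
      by (intro upper_limit_le[OF bound]) (auto elim: eventually_mono)
  qed
  show "L \<le> upper_limit a"
  proof (rule field_le_epsilon)
    fix e :: real assume "e > 0"
    then have "\<forall>\<^sub>F n in sequentially. a n \<le> upper_limit a + e"
      by (intro upper_limit_eventually[OF bound]) auto
    then show "L \<le> upper_limit a + e" by (intro tendsto_upperbound[OF assms(1)]) auto
  qed
qed

text \<open>Plays the part of a limit of the functionals, which need not converge pointwise; it is
  sublinear instead of linear.\<close>

definition limsup_fun :: "(nat \<Rightarrow> 'e::real_normed_vector \<Rightarrow>\<^sub>L real) \<Rightarrow> 'e \<Rightarrow> real" where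
  "limsup_fun G x = upper_limit (\<lambda>n. blinfun_apply (G n) x)"

section \<open>Convex blocks of a sequence\<close>

definition cotail :: "(nat \<Rightarrow> 'a::real_vector) \<Rightarrow> nat \<Rightarrow> 'a set" where
  "cotail G n = convex hull (G ` {n..})"

text \<open>The blocks may overlap. Only the lower bound on the indices matters, since it prevents
  upper limits from increasing.\<close>

definition convex_block :: "(nat \<Rightarrow> 'a::real_vector) \<Rightarrow> (nat \<Rightarrow> 'a) \<Rightarrow> bool" where
  "convex_block H G \<longleftrightarrow> (\<forall>n. H n \<in> cotail G n)"

lemma convex_cotail [simp]: "convex (cotail G n)"
  by (simp add: cotail_def)

lemma cotail_antimono: "m \<le> n \<Longrightarrow> cotail G n \<subseteq> cotail G m"
  unfolding cotail_def by (intro hull_mono image_mono) auto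

lemma cotail_superset: "k \<ge> n \<Longrightarrow> G k \<in> cotail G n"
  unfolding cotail_def by (intro hull_inc) auto

lemma cotail_least: "convex C \<Longrightarrow> (\<And>k. k \<ge> n \<Longrightarrow> G k \<in> C) \<Longrightarrow> cotail G n \<subseteq> C"
  unfolding cotail_def by (intro hull_minimal) auto

lemma convex_block_refl: "convex_block G G"
  by (simp add: convex_block_def cotail_superset)

lemma convex_block_cotail:
  assumes "convex_block H G" shows "cotail H n \<subseteq> cotail G n"
  using assms cotail_antimono[of n _ G] by (intro cotail_least) (auto simp: convex_block_def)

lemma convex_block_trans: "convex_block H G \<Longrightarrow> convex_block G F \<Longrightarrow> convex_block H F"
  using convex_block_cotail[of G F] by (auto simp: convex_block_def)

lemma convex_block_norm_le:
  fixes G :: "nat \<Rightarrow> 'a::real_normed_vector"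
  assumes "convex_block H G" and "\<And>n. norm (G n) \<le> c"
  shows "norm (H n) \<le> c"
proof -
  have "cotail G n \<subseteq> cball 0 c" using assms(2) by (intro cotail_least) auto
  then show ?thesis using assms(1) by (auto simp: convex_block_def)
qed

lemma convex_apply_le: "convex {h :: 'e::real_normed_vector \<Rightarrow>\<^sub>L real. blinfun_apply h x \<le> t}"
proof -
  have "convex ((\<lambda>h :: 'e \<Rightarrow>\<^sub>L real. blinfun_apply h x) -` {..t})"
    by (intro convex_linear_vimage) (auto simp: linear_iff blinfun.add_left blinfun.scaleR_left)
  then show ?thesis by (simp add: vimage_def)
qed

lemma apply_le_norm:
  fixes h :: "'e::real_normed_vector \<Rightarrow>\<^sub>L real"
  assumes "norm h \<le> c" shows "\<bar>blinfun_apply h x\<bar> \<le> c * norm x"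
  using norm_blinfun[of h x] assms mult_right_mono[OF assms norm_ge_zero[of x]] by simp

section \<open>Upper limits along a bounded sequence of functionals\<close>

context
  fixes G :: "nat \<Rightarrow> 'e::real_normed_vector \<Rightarrow>\<^sub>L real"
  assumes G: "\<And>n. norm (G n) \<le> 1"
begin

lemma blinfun_seq_bound: "\<bar>blinfun_apply (G n) x\<bar> \<le> norm x"
  using apply_le_norm[OF G[of n], of x] by simp

lemma limsup_fun_bound: "\<bar>limsup_fun G x\<bar> \<le> norm x"
  unfolding limsup_fun_def using blinfun_seq_bound by (rule upper_limit_bound)

lemma limsup_fun_eventually:
  "limsup_fun G x < t \<Longrightarrow> \<forall>\<^sub>F n in sequentially. blinfun_apply (G n) x \<le> t"
  unfolding limsup_fun_def using blinfun_seq_bound by (rule upper_limit_eventually)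

lemma limsup_fun_frequently:
  "t < limsup_fun G x \<Longrightarrow> \<exists>n\<ge>N. t < blinfun_apply (G n) x"
  unfolding limsup_fun_def using blinfun_seq_bound by (rule upper_limit_frequently)

lemma limsup_fun_le:
  "\<forall>\<^sub>F n in sequentially. blinfun_apply (G n) x \<le> t \<Longrightarrow> limsup_fun G x \<le> t"
  unfolding limsup_fun_def using blinfun_seq_bound by (rule upper_limit_le)

lemma sublinear_limsup_fun: "sublinear (limsup_fun G)"
proof (rule sublinearI)
  show "limsup_fun G 0 = 0" using limsup_fun_bound[of 0] by simp
next
  fix x y
  show "limsup_fun G (x + y) \<le> limsup_fun G x + limsup_fun G y"
  proof (rule field_le_epsilon)
    fix e :: real assume e: "e > 0"
    have "\<forall>\<^sub>F n in sequentially. blinfun_apply (G n) x \<le> limsup_fun G x + e / 2"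
      "\<forall>\<^sub>F n in sequentially. blinfun_apply (G n) y \<le> limsup_fun G y + e / 2"
      using e by (intro limsup_fun_eventually; simp)+
    then have "\<forall>\<^sub>F n in sequentially. blinfun_apply (G n) (x + y) \<le> limsup_fun G x + limsup_fun G y + e"
      by eventually_elim (simp add: blinfun.add_right)
    then show "limsup_fun G (x + y) \<le> limsup_fun G x + limsup_fun G y + e" by (rule limsup_fun_le)
  qed
next
  fix c :: real and x assume c: "c > 0"
  show "limsup_fun G (c *\<^sub>R x) \<le> c * limsup_fun G x"
  proof (rule field_le_epsilon)
    fix e :: real assume e: "e > 0"
    have "\<forall>\<^sub>F n in sequentially. blinfun_apply (G n) x \<le> limsup_fun G x + e / c"
      using e c by (intro limsup_fun_eventually) simp
    then have "\<forall>\<^sub>F n in sequentially. blinfun_apply (G n) (c *\<^sub>R x) \<le> c * limsup_fun G x + e"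
      by eventually_elim (use c in \<open>simp add: blinfun.scaleR_right field_simps\<close>)
    then show "limsup_fun G (c *\<^sub>R x) \<le> c * limsup_fun G x + e" by (rule limsup_fun_le)
  qed
qed

lemma limsup_fun_shift_le: "limsup_fun (\<lambda>k. G (k + n)) x \<le> limsup_fun G x"
proof (rule field_le_epsilon)
  fix e :: real assume "e > 0"
  then have "\<forall>\<^sub>F k in sequentially. blinfun_apply (G k) x \<le> limsup_fun G x + e"
    by (intro limsup_fun_eventually) simp
  then have "\<forall>\<^sub>F k in sequentially. blinfun_apply (G (k + n)) x \<le> limsup_fun G x + e"
    by (rule sequentially_offset)
  moreover have "\<bar>blinfun_apply (G (k + n)) x\<bar> \<le> norm x" for k by (rule blinfun_seq_bound)
  ultimately show "limsup_fun (\<lambda>k. G (k + n)) x \<le> limsup_fun G x + e"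
    unfolding limsup_fun_def[of "\<lambda>k. G (k + n)"] by (intro upper_limit_le) auto
qed

lemma limsup_fun_le_shift: "limsup_fun G x \<le> limsup_fun (\<lambda>k. G (k + n)) x"
proof (rule field_le_epsilon)
  fix e :: real assume "e > 0"
  moreover have "\<bar>blinfun_apply (G (k + n)) x\<bar> \<le> norm x" for k by (rule blinfun_seq_bound)
  ultimately have "\<forall>\<^sub>F k in sequentially. blinfun_apply (G (k + n)) x \<le> limsup_fun (\<lambda>k. G (k + n)) x + e"
    unfolding limsup_fun_def by (intro upper_limit_eventually) auto
  then have "\<forall>\<^sub>F k in sequentially. blinfun_apply (G k) x \<le> limsup_fun (\<lambda>k. G (k + n)) x + e"
    unfolding eventually_sequentially_seg[of "\<lambda>k. blinfun_apply (G k) x \<le> _" n] .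
  then show "limsup_fun G x \<le> limsup_fun (\<lambda>k. G (k + n)) x + e" by (rule limsup_fun_le)
qed

text \<open>A half space of functionals with values at most \<open>t\<close> at \<open>x\<close> is
  convex. If it contains all late terms of \<open>G\<close>, it contains their convex
  combinations.\<close>

lemma limsup_fun_convex_block:
  assumes "convex_block H G"
  shows "limsup_fun H x \<le> limsup_fun G x"
proof (rule field_le_epsilon)
  fix e :: real assume "e > 0"
  then have "\<forall>\<^sub>F k in sequentially. blinfun_apply (G k) x \<le> limsup_fun G x + e"
    by (intro limsup_fun_eventually) simp
  then obtain N where N: "\<And>k. k \<ge> N \<Longrightarrow> blinfun_apply (G k) x \<le> limsup_fun G x + e"
    by (auto simp: eventually_sequentially)
  have "blinfun_apply (H n) x \<le> limsup_fun G x + e" if "n \<ge> N" for n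
  proof -
    have "cotail G n \<subseteq> {h. blinfun_apply h x \<le> limsup_fun G x + e}"
      using N that by (intro cotail_least convex_apply_le) auto
    then show ?thesis using assms by (auto simp: convex_block_def)
  qed
  then have "\<forall>\<^sub>F n in sequentially. blinfun_apply (H n) x \<le> limsup_fun G x + e"
    by (auto simp: eventually_sequentially)
  moreover have "\<bar>blinfun_apply (H n) x\<bar> \<le> norm x" for n
    using apply_le_norm[OF convex_block_norm_le[OF assms G], of n x] by simp
  ultimately show "limsup_fun H x \<le> limsup_fun G x + e"
    unfolding limsup_fun_def[of H] by (intro upper_limit_le) auto
qed

end

section \<open>The excess of a sequence over a functional\<close>

text \<open>The quantity minimized in James' construction. It does not increase when a bounded
  \<open>G\<close> is replaced by a block sequence, and it is 1-Lipschitz in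
  \<open>u\<close>.\<close>

definition excess :: "('e::real_normed_vector \<Rightarrow>\<^sub>L real) \<Rightarrow> (nat \<Rightarrow> 'e \<Rightarrow>\<^sub>L real) \<Rightarrow> real" where
  "excess u G = (SUP x\<in>cball 0 1. limsup_fun G x - blinfun_apply u x)"

lemma excess_least:
  assumes "\<And>x. norm x \<le> 1 \<Longrightarrow> limsup_fun G x - blinfun_apply u x \<le> t"
  shows "excess u G \<le> t"
  unfolding excess_def using assms by (intro cSUP_least) auto

lemma excess_upper:
  assumes G: "\<And>n. norm (G n) \<le> 1" and x: "norm x \<le> 1"
  shows "limsup_fun G x - blinfun_apply u x \<le> excess u G"
proof -
  have "limsup_fun G x - blinfun_apply u x \<le> 1 + norm u" if "norm x \<le> 1" for x
  proof -
    have "norm u * norm x \<le> norm u" using mult_left_mono[OF that norm_ge_zero[of u]] by simp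
    then show ?thesis
      using limsup_fun_bound[of G x, OF G] apply_le_norm[of u "norm u" x] that by linarith
  qed
  then have "bdd_above ((\<lambda>x. limsup_fun G x - blinfun_apply u x) ` cball 0 1)"
    by (intro bdd_aboveI2[of _ _ "1 + norm u"]) auto
  then show ?thesis unfolding excess_def using x by (intro cSUP_upper) auto
qed

lemma excess_nonneg: "(\<And>n. norm (G n) \<le> 1) \<Longrightarrow> 0 \<le> excess u G"
  using excess_upper[of G 0 u] limsup_fun_bound[of G 0] by simp

lemma excess_mono:
  assumes H: "\<And>n. norm (H n) \<le> 1" and "\<And>x. limsup_fun G x \<le> limsup_fun H x"
  shows "excess u G \<le> excess u H"
proof (rule excess_least)
  fix x :: 'a assume "norm x \<le> 1"
  then show "limsup_fun G x - blinfun_apply u x \<le> excess u H"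
    using excess_upper[of H x u, OF H] assms(2)[of x] by linarith
qed

lemma excess_lipschitz:
  assumes G: "\<And>n. norm (G n) \<le> 1"
  shows "excess u G \<le> excess v G + norm (u - v)"
proof (rule excess_least)
  fix x :: 'a assume x: "norm x \<le> 1"
  have "blinfun_apply v x - blinfun_apply u x \<le> norm (u - v)"
    using apply_le_norm[of "u - v" "norm (u - v)" x] mult_left_mono[OF x norm_ge_zero[of "u - v"]]
    by (simp add: blinfun.diff_left)
  then show "limsup_fun G x - blinfun_apply u x \<le> excess v G + norm (u - v)"
    using excess_upper[of G x v, OF G x] by linarith
qed

section \<open>James' construction\<close>

text \<open>The coefficients of James' series are the differences
  \<open>weight n - weight (Suc n)\<close>, so \<open>weight n\<close> is the mass left at step
  \<open>n\<close>, out of a total mass 1. With factorials, \<open>weight (Suc n) / weight n\<close>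
  tends to 0.\<close>

definition weight :: "nat \<Rightarrow> real" where
  "weight n = 1 / fact (Suc n)"

lemma weight_simps:
  shows weight_pos: "weight n > 0" and weight_0: "weight 0 = 1"
    and weight_Suc: "weight n = real (n + 2) * weight (Suc n)"
    and weight_Suc_less: "weight (Suc n) < weight n"
proof -
  show pos: "weight n > 0" for n by (simp add: weight_def)
  show "weight 0 = 1" by (simp add: weight_def)
  show eq: "weight n = real (n + 2) * weight (Suc n)"
    by (simp add: weight_def field_simps del: of_nat_Suc) 
  show "weight (Suc n) < weight n" using mult_strict_right_mono[OF _ pos[of "Suc n"], of 1 "real (n + 2)"] unfolding eq by simp
qed

lemma weight_tendsto_0: "weight \<longlonglongrightarrow> 0"
proof (rule tendsto_sandwich[of "\<lambda>_. 0" _ _ "\<lambda>n. inverse (real (Suc n))"])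
  have "real (Suc n) \<le> fact (Suc n)" for n
    using fact_ge_self[of "Suc n"] by (metis of_nat_fact of_nat_le_iff)
  then show "\<forall>\<^sub>F n in sequentially. weight n \<le> inverse (real (Suc n))"
    by (intro always_eventually allI) (simp add: weight_def field_simps del: fact_Suc of_nat_Suc)
qed (use weight_pos LIMSEQ_inverse_real_of_nat in \<open>auto simp: less_imp_le simp del: of_nat_Suc\<close>)

text \<open>
  At step \<open>n\<close> the choice of \<open>g n\<close> and of the next block sequence minimizes the excess up to \<open>\<epsilon> n\<close>.
  The sets \<open>W n\<close> of competitors decrease, hence the minimal values increase and \<open>v\<close>, a limit of
  competitors, is as bad as all of them.
\<close>

lemma james_construction:
  fixes F :: "nat \<Rightarrow> 'e::real_normed_vector \<Rightarrow>\<^sub>L real"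
  assumes F: "\<And>n. norm (F n) \<le> 1" and \<epsilon>: "\<And>n. \<epsilon> n > 0"
  obtains u g v where "u 0 = f" "\<And>n. u (Suc n) = u n + (weight n - weight (Suc n)) *\<^sub>R g n"
    and "\<And>n. g n \<in> cotail F n" "\<And>n. u n + weight n *\<^sub>R g n - f \<in> cotail F 0"
    and "\<And>n. norm (v - u n) \<le> weight n"
    and "\<And>n. excess (u n + weight n *\<^sub>R g n) g \<le> excess v g + \<epsilon> n"
proof -
  \<comment> \<open>A competitor spends the whole remaining mass \<open>weight n\<close> on a single
    element of \<open>cotail G n\<close>.\<close>
  define W where "W n u G = (\<lambda>h. u + weight n *\<^sub>R h) ` cotail G n"
    for n and u and G :: "nat \<Rightarrow> 'e \<Rightarrow>\<^sub>L real"
  \<comment> \<open>Almost optimal is the competitor that spends all remaining mass on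
    \<open>g\<close>; the actual step to \<open>u'\<close> spends only
    \<open>weight n - weight (Suc n)\<close> of it and keeps the rest for later.\<close>
  define step where "step n u G u' G' g \<longleftrightarrow>
      g \<in> cotail G n \<and> u' = u + (weight n - weight (Suc n)) *\<^sub>R g \<and> convex_block G' G \<and>
      (\<forall>w H. w \<in> W n u G \<longrightarrow> convex_block H G \<longrightarrow> excess (u + weight n *\<^sub>R g) G' \<le> excess w H + \<epsilon> n)"
    for n u G u' G' g
  have ex: "\<exists>u' G' g. step n u G u' G' g" if G: "\<And>k. norm (G k) \<le> 1" for n u G
  proof -
    define I where "I = {excess w H |w H. w \<in> W n u G \<and> convex_block H G}"
    have "u + weight n *\<^sub>R G n \<in> W n u G" by (auto simp: W_def cotail_superset)
    then have "I \<noteq> {}" using convex_block_refl[of G] by (auto simp: I_def)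
    have "excess w H \<ge> 0" if "convex_block H G" for w H
      using convex_block_norm_le[of H G 1, OF that G] by (intro excess_nonneg)
    then have bdd: "bdd_below I" by (auto simp: I_def intro!: bdd_belowI[of _ 0])
    obtain g H where g: "g \<in> cotail G n" and H: "convex_block H G"
      and lt: "excess (u + weight n *\<^sub>R g) H < Inf I + \<epsilon> n"
      using cInf_lessD[OF \<open>I \<noteq> {}\<close>, of "Inf I + \<epsilon> n"] \<epsilon>[of n] by (auto simp: I_def W_def)
    have "excess (u + weight n *\<^sub>R g) H \<le> excess w H' + \<epsilon> n"
      if "w \<in> W n u G" "convex_block H' G" for w H'
    proof -
      have "Inf I \<le> excess w H'" using that by (intro cInf_lower[OF _ bdd]) (auto simp: I_def)
      with lt show ?thesis by linarith
    qed
    with g H show ?thesis unfolding step_def by blast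
  qed
  have "\<exists>s'. (\<forall>k. norm (snd s' k) \<le> 1) \<and> (\<exists>g. step n (fst s) (snd s) (fst s') (snd s') g)"
    if s: "\<forall>k. norm (snd s k) \<le> 1" for n s
  proof -
    obtain u' G' g where *: "step n (fst s) (snd s) u' G' g"
      using ex[of "snd s" n "fst s"] s by blast
    then have "\<forall>k. norm (G' k) \<le> 1"
      using convex_block_norm_le[of G' "snd s" 1] s by (auto simp: step_def)
    with * show ?thesis by (intro exI[of _ "(u', G')"]) auto
  qed
  then have "\<exists>s. \<forall>n. ((\<forall>k. norm (snd (s n) k) \<le> 1) \<and> (n = 0 \<longrightarrow> s n = (f, F))) \<and>
      (\<exists>g. step n (fst (s n)) (snd (s n)) (fst (s (Suc n))) (snd (s (Suc n))) g)"
    using F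
    by (intro dependent_nat_choice[where P = "\<lambda>n s. (\<forall>k. norm (snd s k) \<le> 1) \<and> (n = 0 \<longrightarrow> s = (f, F))"])
      auto
  then obtain s where s: "\<And>n k. norm (snd (s n) k) \<le> 1" "s 0 = (f, F)"
    "\<And>n. \<exists>g. step n (fst (s n)) (snd (s n)) (fst (s (Suc n))) (snd (s (Suc n))) g"
    by blast
  define u where "u n = fst (s n)" for n
  define G where "G n = snd (s n)" for n
  obtain g where g: "\<And>n. step n (u n) (G n) (u (Suc n)) (G (Suc n)) (g n)"
    using s(3) unfolding u_def G_def by metis
  have G1: "norm (G n k) \<le> 1" for n k using s(1) by (simp add: G_def)
  have gG: "g n \<in> cotail (G n) n" and uS: "u (Suc n) = u n + (weight n - weight (Suc n)) *\<^sub>R g n"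
    and GS: "convex_block (G (Suc n)) (G n)"
    and opt: "\<And>w H. w \<in> W n (u n) (G n) \<Longrightarrow> convex_block H (G n) \<Longrightarrow>
      excess (u n + weight n *\<^sub>R g n) (G (Suc n)) \<le> excess w H + \<epsilon> n" for n
    using g[of n] by (auto simp: step_def)
  have block: "convex_block (G m) (G n)" if "n \<le> m" for n m
    using that
  proof (induction rule: dec_induct)
    case (step m)
    then show ?case using GS[of m] convex_block_trans by blast
  qed (rule convex_block_refl)
  have gGn: "g m \<in> cotail (G n) m" if "n \<le> m" for n m
    using gG[of m] convex_block_cotail[OF block[OF that], of m] by blast
  have G0: "G 0 = F" and u0: "u 0 = f" using s(2) by (simp_all add: G_def u_def)
  have gF: "g n \<in> cotail F n" for n using gGn[of 0 n] by (simp add: G0)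
  have g1: "norm (g n) \<le> 1" for n
    using convex_block_norm_le[of g F 1] gF F by (auto simp: convex_block_def)
  \<comment> \<open>This makes a tail of \<open>g\<close> itself an admissible \<open>H\<close> in
    the minimization at step \<open>n\<close>.\<close>
  have shift_block: "convex_block (\<lambda>k. g (k + n)) (G n)" for n
    using gGn[of n] cotail_antimono[of _ _ "G n"] unfolding convex_block_def by (meson le_add1 le_add2 subsetD)
  have W_Suc: "W (Suc n) (u (Suc n)) (G (Suc n)) \<subseteq> W n (u n) (G n)" for n
  proof
    fix w assume "w \<in> W (Suc n) (u (Suc n)) (G (Suc n))"
    then obtain h where h: "h \<in> cotail (G (Suc n)) (Suc n)" "w = u (Suc n) + weight (Suc n) *\<^sub>R h"
      by (auto simp: W_def)
    \<comment> \<open>With \<open>l\<close> the fraction of the mass that is kept, a competitor at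
      step \<open>Suc n\<close> given by \<open>h\<close> is the competitor at step \<open>n\<close>
      given by a convex combination of \<open>g n\<close> and \<open>h\<close>.\<close>
    define l where "l = weight (Suc n) / weight n"
    have l: "0 \<le> l" "l \<le> 1" "weight (Suc n) = weight n * l"
      using weight_pos[of n] weight_pos[of "Suc n"] weight_Suc_less[of n] by (simp_all add: l_def)
    have "h \<in> cotail (G n) n"
      using h(1) convex_block_cotail[OF GS] cotail_antimono[of n "Suc n" "G n"] by auto
    then have "(1 - l) *\<^sub>R g n + l *\<^sub>R h \<in> cotail (G n) n"
      using l gG[of n] by (intro convexD_alt) auto
    moreover have "w = u n + weight n *\<^sub>R ((1 - l) *\<^sub>R g n + l *\<^sub>R h)"
      unfolding h(2) uS l(3) by (simp add: algebra_simps)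
    ultimately show "w \<in> W n (u n) (G n)" by (auto simp: W_def)
  qed
  have W_mono: "W m (u m) (G m) \<subseteq> W n (u n) (G n)" if "n \<le> m" for n m
    using that W_Suc by (induction rule: dec_induct) blast+
  have mem_W: "u m + weight m *\<^sub>R g m \<in> W n (u n) (G n)" if "n \<le> m" for n m
    using W_mono[OF that] gG[of m] by (auto simp: W_def)
  have "u n + weight n *\<^sub>R g n - f \<in> cotail F 0" for n
    using mem_W[of 0 n] by (auto simp: W_def u0 G0 weight_0)
  have udiff: "norm (u m - u n) \<le> weight n - weight m" if "n \<le> m" for n m
    using that
  proof (induction rule: dec_induct)
    case (step m)
    have "norm ((weight m - weight (Suc m)) *\<^sub>R g m) \<le> weight m - weight (Suc m)"
      using weight_Suc_less[of m] g1[of m] by (simp add: mult_left_le)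
    moreover have eq: "u (Suc m) - u n = (u m - u n) + (weight m - weight (Suc m)) *\<^sub>R g m"
      by (simp add: uS)
    ultimately show ?case
      using norm_triangle_ineq[of "u m - u n" "(weight m - weight (Suc m)) *\<^sub>R g m"] step.IH
      unfolding eq by linarith
  qed simp
  have "Cauchy u"
  proof (rule metric_CauchyI)
    fix e :: real assume "e > 0"
    then obtain N where N: "weight N < e"
      using order_tendstoD(2)[OF weight_tendsto_0] by (auto simp: eventually_sequentially)
    have small: "norm (u m - u N) \<le> weight N" if "m \<ge> N" for m
      using udiff[OF that] weight_pos[of m] by linarith
    obtain N' where N': "weight N' < e / 2"
      using order_tendstoD(2)[OF weight_tendsto_0, of "e / 2"] \<open>e > 0\<close> by (auto simp: eventually_sequentially)
    have "dist (u m) (u n) < e" if "m \<ge> N'" "n \<ge> N'" for m n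
      using udiff[OF that(1)] udiff[OF that(2)] weight_pos[of m] weight_pos[of n] N'
        norm_triangle_ineq4[of "u m - u N'" "u n - u N'"] by (simp add: dist_norm)
    then show "\<exists>M. \<forall>m\<ge>M. \<forall>n\<ge>M. dist (u m) (u n) < e" by blast
  qed
  then obtain v where v: "u \<longlonglongrightarrow> v" using Cauchy_convergent convergentD by blast
  have vu: "norm (v - u n) \<le> weight n" for n
  proof (rule tendsto_upperbound)
    show "(\<lambda>m. norm (u m - u n)) \<longlonglongrightarrow> norm (v - u n)" by (intro tendsto_intros v)
    show "\<forall>\<^sub>F m in sequentially. norm (u m - u n) \<le> weight n"
      unfolding eventually_sequentially
    proof (intro exI allI impI)
      fix m assume "n \<le> m"
      then show "norm (u m - u n) \<le> weight n" using udiff[of n m] weight_pos[of m] by simp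
    qed
  qed simp
  \<comment> \<open>For \<open>m \<ge> n\<close> the point
    \<open>u m + weight m *\<^sub>R g m\<close> is still a competitor at step \<open>n\<close>, and
    it lies within \<open>2 * weight m\<close> of \<open>v\<close>. The claim follows as
    \<open>m\<close> tends to infinity.\<close>
  have "excess (u n + weight n *\<^sub>R g n) g \<le> excess v g + \<epsilon> n" for n
  proof (rule tendsto_lowerbound)
    show "(\<lambda>m. excess v g + 2 * weight m + \<epsilon> n) \<longlonglongrightarrow> excess v g + \<epsilon> n"
      using tendsto_mult_right_zero[OF weight_tendsto_0, of 2] by (auto intro!: tendsto_eq_intros)
    have "excess (u n + weight n *\<^sub>R g n) g \<le> excess v g + 2 * weight m + \<epsilon> n" if m: "n \<le> m" for m
    proof -
      let ?z = "u m + weight m *\<^sub>R g m" and ?g = "\<lambda>k. g (k + n)"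
      have "limsup_fun g x \<le> limsup_fun (G (Suc n)) x" for x
        using limsup_fun_le_shift[of g x "Suc n"] g1
          limsup_fun_convex_block[of "G (Suc n)" "\<lambda>k. g (k + Suc n)" x] G1 shift_block[of "Suc n"]
        by (meson order_trans)
      then have "excess (u n + weight n *\<^sub>R g n) g \<le> excess (u n + weight n *\<^sub>R g n) (G (Suc n))"
        using G1 by (intro excess_mono)
      also have "\<dots> \<le> excess ?z ?g + \<epsilon> n" using opt[OF mem_W[OF m] shift_block] .
      also have "excess ?z ?g \<le> excess ?z g"
        using limsup_fun_shift_le[of g n] g1 by (intro excess_mono) auto
      also have "\<dots> \<le> excess v g + norm (?z - v)" using g1 by (rule excess_lipschitz)
      also have "norm (?z - v) \<le> norm (u m - v) + norm (weight m *\<^sub>R g m)"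
        using norm_triangle_ineq[of "u m - v" "weight m *\<^sub>R g m"] by (simp add: algebra_simps)
      also have "norm (u m - v) \<le> weight m" using vu[of m] by (simp add: norm_minus_commute)
      also have "norm (weight m *\<^sub>R g m) \<le> weight m"
        using g1[of m] weight_pos[of m] by (simp add: mult_left_le)
      finally show ?thesis by simp
    qed
    then show "\<forall>\<^sub>F m in sequentially.
        excess (u n + weight n *\<^sub>R g n) g \<le> excess v g + 2 * weight m + \<epsilon> n"
      by (auto simp: eventually_sequentially)
  qed simp
  with u0 uS gF \<open>\<And>n. u n + weight n *\<^sub>R g n - f \<in> cotail F 0\<close> vu that show ?thesis by blast
qed

text \<open>
  If the excess were attained at \<open>x\<close>, then \<open>D n\<close>, the tail of the series for the excess at \<open>x\<close>, would
  be at least a fixed multiple of \<open>weight n\<close>. But \<open>g n x\<close> comes arbitrarily close to its upper limit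
  \<open>l\<close>, and \<open>weight (Suc n)\<close> is negligible compared with \<open>weight n\<close>.
\<close>

lemma james_excess_not_attained:
  fixes g :: "nat \<Rightarrow> 'e::real_normed_vector \<Rightarrow>\<^sub>L real"
  assumes g: "\<And>n. norm (g n) \<le> 1"
    and u: "\<And>n. u (Suc n) = u n + (weight n - weight (Suc n)) *\<^sub>R g n"
    and v: "\<And>n. norm (v - u n) \<le> weight n"
    and \<theta>: "\<theta> > 0" "norm (u 0) + \<theta> \<le> excess v g"
    and gap: "\<And>n. excess (u n + weight n *\<^sub>R g n) g \<le> excess v g + \<theta> * weight (Suc n) / 2 ^ (n + 2)"
    and x: "norm x = 1"
  shows "limsup_fun g x - blinfun_apply v x \<noteq> excess v g"
proof
  define l where "l = limsup_fun g x"
  define D where "D n = l * weight n + blinfun_apply (u n) x - blinfun_apply v x" for n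
  assume "limsup_fun g x - blinfun_apply v x = excess v g"
  then have att: "excess v g = l - blinfun_apply v x" by (simp add: l_def)
  have D_Suc: "D (Suc n) = D n - (weight n - weight (Suc n)) * (l - blinfun_apply (g n) x)" for n
    by (simp add: D_def u blinfun.add_left blinfun.scaleR_left) (simp add: algebra_simps)
  \<comment> \<open>The point \<open>x\<close> attains the excess over \<open>v\<close>, while its
    value for the competitor is at most the excess over the competitor; \<open>gap\<close> compares
    the two.\<close>
  have step: "weight n * (l - blinfun_apply (g n) x) \<le> D n + \<theta> * weight (Suc n) / 2 ^ (n + 2)" for n
  proof -
    have "l - blinfun_apply (u n + weight n *\<^sub>R g n) x \<le> excess v g + \<theta> * weight (Suc n) / 2 ^ (n + 2)"
      using excess_upper[of g x "u n + weight n *\<^sub>R g n", OF g] x gap[of n] by (simp add: l_def)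
    then show ?thesis
      unfolding att D_def by (simp add: blinfun.add_left blinfun.scaleR_left algebra_simps)
  qed
  \<comment> \<open>The factor \<open>1/2 + 1 / 2 ^ (n + 1)\<close> decreases from 1 to 1/2; its
    decrements absorb exactly the errors allowed by \<open>gap\<close>.\<close>
  have lower: "weight n * \<theta> * (1/2 + 1 / 2 ^ (n + 1)) \<le> D n" for n
  proof (induction n)
    case 0
    have "\<bar>blinfun_apply (u 0) x\<bar> \<le> norm (u 0)" using apply_le_norm[of "u 0" "norm (u 0)" x] x by simp
    then have "\<theta> \<le> D 0" using \<theta>(2) att by (simp add: D_def weight_0)
    then show ?case by (simp add: weight_0)
  next
    case (Suc n)
    define r where "r = weight (Suc n) / weight n"
    define e where "e = \<theta> * weight (Suc n) / 2 ^ (n + 2)"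
    have r: "0 \<le> r" "r \<le> 1" "weight (Suc n) = r * weight n"
      using weight_pos[of n] weight_pos[of "Suc n"] weight_Suc_less[of n] by (simp_all add: r_def)
    have e: "e \<ge> 0" using \<theta>(1) weight_pos[of "Suc n"] by (simp add: e_def)
    have "(weight n - weight (Suc n)) * (l - blinfun_apply (g n) x)
        = (1 - r) * (weight n * (l - blinfun_apply (g n) x))"
      by (simp add: r(3) algebra_simps)
    also have "\<dots> \<le> (1 - r) * (D n + e)" using step[of n] r(2) by (intro mult_left_mono) (auto simp: e_def)
    also have "\<dots> \<le> D n + e - r * D n"
      using mult_nonneg_nonneg[OF r(1) e] by (simp add: algebra_simps)
    finally have "r * D n - e \<le> D (Suc n)" unfolding D_Suc by linarith
    moreover have "r * (weight n * \<theta> * (1/2 + 1 / 2 ^ (n + 1))) \<le> r * D n"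
      using Suc r(1) by (intro mult_left_mono)
    moreover have "r * (weight n * \<theta> * (1/2 + 1 / 2 ^ (n + 1))) - e
        = weight (Suc n) * \<theta> * (1/2 + 1 / 2 ^ (Suc n + 1))"
      unfolding e_def r(3) by (simp add: field_simps)
    ultimately show ?case by linarith
  qed
  \<comment> \<open>For an \<open>n \<ge> N\<close> at which \<open>g n x\<close> is within
    \<open>\<theta> / 8\<close> of \<open>l\<close>, the bounds on \<open>D n\<close> force
    \<open>(n + 2) * \<theta> * 3 \<le> 16\<close>, whereas the choice of \<open>N\<close> gives
    \<open>8 < (n + 2) * \<theta>\<close>.\<close>
  obtain N :: nat where N: "8 / \<theta> < real N" using reals_Archimedean2 by blast
  obtain n where n: "n \<ge> N" "l - \<theta> / 8 < blinfun_apply (g n) x"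
    using limsup_fun_frequently[of g "l - \<theta> / 8" x N, OF g] \<theta>(1) by (auto simp: l_def)
  have "\<bar>blinfun_apply (u (Suc n) - v) x\<bar> \<le> weight (Suc n)"
    using apply_le_norm[of "u (Suc n) - v" "weight (Suc n)" x] v[of "Suc n"] x
    by (simp add: norm_minus_commute)
  moreover have "l * weight (Suc n) \<le> weight (Suc n)"
    using limsup_fun_bound[of g x, OF g] x weight_pos[of "Suc n"] by (simp add: l_def)
  ultimately have "D (Suc n) \<le> 2 * weight (Suc n)" by (simp add: D_def blinfun.diff_left)
  moreover have "(weight n - weight (Suc n)) * (l - blinfun_apply (g n) x) \<le> (weight n - weight (Suc n)) * (\<theta> / 8)"
    using n(2) weight_Suc_less[of n] by (intro mult_left_mono) auto
  moreover have "\<dots> \<le> weight n * (\<theta> / 8)"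
    using weight_pos[of "Suc n"] \<theta>(1) by (intro mult_right_mono) auto
  ultimately have "D n \<le> weight n * (\<theta> / 8) + 2 * weight (Suc n)" unfolding D_Suc by linarith
  moreover have "weight n * \<theta> / 2 \<le> weight n * \<theta> * (1/2 + 1 / 2 ^ (n + 1))"
    using \<theta>(1) weight_pos[of n] by (simp add: field_simps)
  ultimately have "weight n * \<theta> / 2 \<le> weight n * (\<theta> / 8) + 2 * weight (Suc n)"
    using lower[of n] by linarith
  then have "weight (Suc n) * (real (n + 2) * \<theta> * 3) \<le> weight (Suc n) * 16"
    unfolding weight_Suc[of n] by (simp add: algebra_simps)
  then have "real (n + 2) * \<theta> * 3 \<le> 16" using weight_pos[of "Suc n"] by simp
  moreover have "8 < real (n + 2) * \<theta>"
  proof -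
    have "8 / \<theta> < real (n + 2)" using N n(1) by linarith
    then show ?thesis using \<theta>(1) by (simp add: field_simps)
  qed
  ultimately show False by linarith
qed

section \<open>Spaces on which seminorms attain their suprema\<close>

text \<open>
  The bound by \<open>\<bar>f x\<bar> + c * norm x\<close> with \<open>c < \<alpha>\<close> says that no weakly null sequence in the unit
  sphere is maximizing for \<open>q\<close>.
\<close>

definition seminorms_attain :: "'e::real_normed_vector itself \<Rightarrow> bool" where
  "seminorms_attain _ \<longleftrightarrow>
     (\<forall>q (f :: 'e \<Rightarrow>\<^sub>L real) c \<alpha>. sublinear q \<longrightarrow> (\<forall>x. q (- x) = q x) \<longrightarrow>
        (\<forall>x. q x \<le> \<bar>blinfun_apply f x\<bar> + c * norm x) \<longrightarrow> c < \<alpha> \<longrightarrow>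
        (\<forall>x. norm x = 1 \<longrightarrow> q x \<le> \<alpha>) \<longrightarrow> (\<forall>e>0. \<exists>x. norm x = 1 \<and> \<alpha> - e < q x) \<longrightarrow>
        (\<exists>x. norm x = 1 \<and> q x = \<alpha>))"

lemma seminorms_attainD:
  fixes f :: "'e::real_normed_vector \<Rightarrow>\<^sub>L real"
  assumes "seminorms_attain TYPE('e)" and "sublinear q" and "\<And>x. q (- x) = q x"
    and "\<And>x. q x \<le> \<bar>blinfun_apply f x\<bar> + c * norm x" and "c < \<alpha>"
    and "\<And>x. norm x = 1 \<Longrightarrow> q x \<le> \<alpha>" and "\<And>e. e > 0 \<Longrightarrow> \<exists>x. norm x = 1 \<and> \<alpha> - e < q x"
  obtains x where "norm x = 1" "q x = \<alpha>"
  using assms unfolding seminorms_attain_def by blast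

text \<open>Turns a one-sided functional into a seminorm, as \<open>seminorms_attain\<close>
  requires.\<close>

lemma sublinear_symmetrize:
  assumes r: "sublinear r"
  shows "sublinear (\<lambda>x. max (r x) (r (- x)))"
proof (rule sublinearI)
  fix x y
  have "r (- (x + y)) \<le> r (- x) + r (- y)" using sublinearD(1)[OF r, of "- x" "- y"] by simp
  then show "max (r (x + y)) (r (- (x + y))) \<le> max (r x) (r (- x)) + max (r y) (r (- y))"
    using sublinearD(1)[OF r, of x y] by linarith
next
  fix c :: real and x assume c: "c > 0"
  then have "r (c *\<^sub>R x) = c * r x" "r (- (c *\<^sub>R x)) = c * r (- x)"
    using sublinearD(2)[OF r, of c x] sublinearD(2)[OF r, of c "- x"] by auto
  then show "max (r (c *\<^sub>R x)) (r (- (c *\<^sub>R x))) \<le> c * max (r x) (r (- x))"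
    using c by (simp add: max_mult_distrib_left)
qed (simp add: sublinearD(3)[OF r])

text \<open>The symmetrization of \<open>limsup_fun g - v\<close> has the same supremum over the
  sphere and is at most \<open>\<bar>v x\<bar> + norm x\<close>. An excess above 1 therefore makes
  \<open>seminorms_attain\<close> applicable, and the point obtained is correct up to its
  sign.\<close>

lemma excess_attained:
  fixes v :: "'e::real_normed_vector \<Rightarrow>\<^sub>L real"
  assumes attain: "seminorms_attain TYPE('e)"
    and g: "\<And>n. norm (g n) \<le> 1" and gt: "1 < excess v g"
  obtains x where "norm x = 1" "limsup_fun g x - blinfun_apply v x = excess v g"
proof -
  let ?\<alpha> = "excess v g"
  define r where "r x = limsup_fun g x - blinfun_apply v x" for x
  note lim = sublinear_limsup_fun[of g, OF g]
  have r: "sublinear r"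
    using sublinearD[OF lim] unfolding sublinear_def r_def
    by (auto simp: blinfun.add_right blinfun.scaleR_right algebra_simps)
  define q where "q x = max (r x) (r (- x))" for x
  have r_le: "r x \<le> ?\<alpha>" if "norm x \<le> 1" for x
    using excess_upper[of g x v, OF g that] by (simp add: r_def)
  obtain x where x: "norm x = 1" "q x = ?\<alpha>"
  proof (rule seminorms_attainD[OF attain, of q v 1 ?\<alpha>])
    show "sublinear q" unfolding q_def by (rule sublinear_symmetrize[OF r])
    show "q (- x) = q x" for x by (simp add: q_def max.commute)
    show "q x \<le> \<bar>blinfun_apply v x\<bar> + 1 * norm x" for x
      using limsup_fun_bound[of g x, OF g] limsup_fun_bound[of g "- x", OF g]
      unfolding q_def r_def blinfun.minus_right norm_minus_cancel by linarith
    show "q x \<le> ?\<alpha>" if "norm x = 1" for x using r_le[of x] r_le[of "- x"] that by (simp add: q_def)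
    fix e :: real assume e: "e > 0"
    \<comment> \<open>The maximum with 0 ensures \<open>r x > 0\<close>, so that \<open>r\<close>
      does not decrease when \<open>x\<close> is stretched to the unit sphere.\<close>
    let ?t = "max (?\<alpha> - e) 0"
    have "?t < ?\<alpha>" using e gt by simp
    then obtain x where x: "norm x \<le> 1" "?t < r x"
      using excess_least[of g v ?t] unfolding r_def by fastforce
    have "x \<noteq> 0" using x(2) sublinearD(3)[OF r] by auto
    then have n: "norm x > 0" by simp
    have "r (inverse (norm x) *\<^sub>R x) = inverse (norm x) * r x"
      using n by (intro sublinearD(2)[OF r]) simp
    moreover have "r x \<le> inverse (norm x) * r x"
      using n x mult_right_mono[of 1 "inverse (norm x)" "r x"] by (simp add: one_le_inverse_iff)
    ultimately have "?\<alpha> - e < q (inverse (norm x) *\<^sub>R x)" using x(2) unfolding q_def by linarith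
    then show "\<exists>x. norm x = 1 \<and> ?\<alpha> - e < q x"
      using n by (intro exI[of _ "inverse (norm x) *\<^sub>R x"]) simp
  qed (use gt in auto)
  then consider "r x = ?\<alpha>" | "r (- x) = ?\<alpha>" unfolding q_def by (metis max_def)
  then show ?thesis using that[of x] that[of "- x"] x(1) by cases (auto simp: r_def)
qed

text \<open>
  Takes the place of reflexivity. In the proof \<open>f\<close> extends a large multiple of a convex combination
  \<open>h\<close> of almost minimal norm on \<open>Y\<close>: adding a convex combination to \<open>f\<close> then increases the norm by a
  fixed amount, and the size of \<open>f\<close> excludes weakly null maximizing sequences.
\<close>

lemma small_convex_combination:
  fixes F :: "nat \<Rightarrow> 'e::real_normed_vector \<Rightarrow>\<^sub>L real"
  assumes attain: "seminorms_attain TYPE('e)" and Y: "subspace Y"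
    and F: "\<And>n. norm (F n) \<le> 1" and F0: "\<And>y. y \<in> Y \<Longrightarrow> (\<lambda>n. blinfun_apply (F n) y) \<longlonglongrightarrow> 0"
    and \<delta>: "\<delta> > 0"
  obtains g where "g \<in> convex hull (range F)" "\<And>y. y \<in> Y \<Longrightarrow> \<bar>blinfun_apply g y\<bar> \<le> \<delta> * norm y"
proof (rule ccontr)
  note found = that
  assume "\<not> thesis"
  then have none: "\<exists>y\<in>Y. \<bar>blinfun_apply g y\<bar> > \<delta> * norm y" if "g \<in> cotail F 0" for g
    using found[of g] that unfolding cotail_def by (force simp: not_le)
  \<comment> \<open>The norm of the restriction of \<open>u\<close> to \<open>Y\<close>.\<close>
  define \<nu> where "\<nu> u = (SUP y\<in>Y \<inter> cball 0 1. blinfun_apply u y)" for u :: "'e \<Rightarrow>\<^sub>L real"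
  have Y0: "0 \<in> Y" using Y by (rule subspace_0)
  have "bdd_above (blinfun_apply u ` (Y \<inter> cball 0 1))" for u :: "'e \<Rightarrow>\<^sub>L real"
  proof (rule bdd_aboveI2)
    fix y assume y: "y \<in> Y \<inter> cball 0 1"
    have "norm u * norm y \<le> norm u * 1" using y by (intro mult_left_mono) auto
    then show "blinfun_apply u y \<le> norm u" using apply_le_norm[of u "norm u" y] by simp
  qed
  then have \<nu>_upper: "blinfun_apply u y \<le> \<nu> u" if "y \<in> Y" "norm y \<le> 1" for u y
    unfolding \<nu>_def using that by (intro cSUP_upper) auto
  have \<nu>_least: "\<nu> u \<le> t" if "\<And>y. y \<in> Y \<Longrightarrow> norm y \<le> 1 \<Longrightarrow> blinfun_apply u y \<le> t" for u t
    unfolding \<nu>_def using that Y0 by (intro cSUP_least) auto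
  have \<nu>_apply: "\<bar>blinfun_apply u y\<bar> \<le> \<nu> u * norm y" if y: "y \<in> Y" for u y
  proof (cases "y = 0")
    case False
    have "blinfun_apply u (c *\<^sub>R y) \<le> \<nu> u" if "\<bar>c\<bar> = inverse (norm y)" for c
      using that y Y False by (intro \<nu>_upper) (auto simp: subspace_scale)
    from this[of "inverse (norm y)"] this[of "- inverse (norm y)"]
    have "inverse (norm y) * \<bar>blinfun_apply u y\<bar> \<le> \<nu> u"
      by (auto simp: blinfun.scaleR_right blinfun.minus_right abs_if)
    then show ?thesis using False by (simp add: field_simps)
  qed simp
  have \<nu>_scale: "\<nu> u * c \<le> \<nu> (c *\<^sub>R u)" if c: "c > 0" for c u
  proof -
    have "\<nu> u \<le> \<nu> (c *\<^sub>R u) / c"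
    proof (rule \<nu>_least)
      fix y assume "y \<in> Y" "norm y \<le> 1"
      then have "c * blinfun_apply u y \<le> \<nu> (c *\<^sub>R u)"
        using \<nu>_upper[of y "c *\<^sub>R u"] by (simp add: blinfun.scaleR_left)
      then show "blinfun_apply u y \<le> \<nu> (c *\<^sub>R u) / c" using c by (simp add: field_simps)
    qed
    then show ?thesis using c by (simp add: field_simps)
  qed
  have \<nu>_ge: "\<delta> \<le> \<nu> g" if g: "g \<in> cotail F 0" for g
  proof (rule ccontr)
    obtain y where y: "y \<in> Y" "\<bar>blinfun_apply g y\<bar> > \<delta> * norm y" using none[OF g] by blast
    assume "\<not> \<delta> \<le> \<nu> g"
    then have "\<nu> g * norm y \<le> \<delta> * norm y" by (intro mult_right_mono) auto
    with \<nu>_apply[OF y(1), of g] y(2) show False by linarith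
  qed
  define \<rho> where "\<rho> = Inf (\<nu> ` cotail F 0)"
  have ne: "cotail F 0 \<noteq> {}" using cotail_superset[of 0 0 F] by blast
  have bdd: "bdd_below (\<nu> ` cotail F 0)" using \<nu>_ge by (intro bdd_belowI2[of _ \<delta>])
  have \<rho>_le: "\<rho> \<le> \<nu> g" if "g \<in> cotail F 0" for g
    unfolding \<rho>_def using bdd that by (intro cInf_lower) auto
  have "\<delta> \<le> \<rho>" unfolding \<rho>_def using ne \<nu>_ge by (intro cInf_greatest) auto
  with \<delta> have \<rho>: "\<rho> > 0" by simp
  \<comment> \<open>Thus \<open>M * \<rho> = 1 + \<rho>\<close>, which brings the excess below above
    the threshold 1 of \<open>excess_attained\<close>.\<close>
  define M where "M = 1 / \<rho> + 1"
  have M: "M > 0" "M * \<rho> > 1" using \<rho> by (simp_all add: M_def field_simps add_pos_pos)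
  \<comment> \<open>The tolerance is such that multiplication by \<open>M\<close> turns it into
    \<open>\<rho> / 2\<close>, half of the increase proved in \<open>\<nu>f\<close>.\<close>
  obtain h where h: "h \<in> cotail F 0" "\<nu> h < \<rho> + \<rho> / (2 * M)"
    using cInf_lessD[of "\<nu> ` cotail F 0" "\<rho> + \<rho> / (2 * M)"] ne \<rho> M(1) unfolding \<rho>_def[symmetric] by auto
  have \<nu>h: "M * \<nu> h \<le> M * \<rho> + \<rho> / 2"
    using mult_left_mono[OF less_imp_le[OF h(2)], of M] M(1) by (simp add: algebra_simps)
  have \<nu>h0: "0 \<le> M * \<nu> h" using M(1) \<nu>_ge[OF h(1)] \<delta> by simp
  obtain f :: "'e \<Rightarrow>\<^sub>L real" where f: "norm f \<le> M * \<nu> h" "\<And>y. y \<in> Y \<Longrightarrow> blinfun_apply f y = M * blinfun_apply h y"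
  proof (rule hahn_banach_norm[OF Y, of "\<lambda>y. M * blinfun_apply h y" "M * \<nu> h"])
    show "\<bar>M * blinfun_apply h y\<bar> \<le> M * \<nu> h * norm y" if "y \<in> Y" for y
      using mult_left_mono[OF \<nu>_apply[OF that, of h], of M] M(1) by (simp add: abs_mult mult.assoc)
  qed (use \<nu>h0 in \<open>auto simp: blinfun.add_right blinfun.scaleR_right algebra_simps\<close>)
  \<comment> \<open>On \<open>Y\<close> the functional \<open>f + k\<close> is \<open>M + 1\<close>
    times a convex combination of \<open>h\<close> and \<open>k\<close>, whose restriction has norm
    at least \<open>\<rho>\<close>.\<close>
  have \<nu>f: "M * \<rho> + \<rho> \<le> \<nu> (f + k)" if k: "k \<in> cotail F 0" for k
  proof -
    define k' where "k' = (M / (M + 1)) *\<^sub>R h + (1 / (M + 1)) *\<^sub>R k"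
    have "k' \<in> cotail F 0"
      unfolding k'_def using M(1) h(1) k by (intro convexD) (auto simp: add_divide_distrib[symmetric])
    then have "\<rho> * (M + 1) \<le> \<nu> k' * (M + 1)" using \<rho>_le M(1) by (intro mult_right_mono) auto
    also have "\<dots> \<le> \<nu> ((M + 1) *\<^sub>R k')" using M(1) by (intro \<nu>_scale) simp
    also have "\<dots> \<le> \<nu> (f + k)"
    proof (rule \<nu>_least)
      fix y assume y: "y \<in> Y" "norm y \<le> 1"
      have "blinfun_apply ((M + 1) *\<^sub>R k') y = blinfun_apply (f + k) y"
        using M(1) by (simp add: k'_def scaleR_add_right f(2)[OF y(1)] blinfun.add_left blinfun.scaleR_left)
      then show "blinfun_apply ((M + 1) *\<^sub>R k') y \<le> \<nu> (f + k)" using \<nu>_upper[OF y, of "f + k"] by simp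
    qed
    finally show ?thesis by (simp add: algebra_simps)
  qed
  \<comment> \<open>The margin in James' argument: the excess of \<open>v\<close> will be at least
    \<open>M * \<rho> + \<rho>\<close>, while \<open>norm f\<close> is at most
    \<open>M * \<rho> + \<rho> / 2\<close>.\<close>
  define \<theta> where "\<theta> = \<rho> / 2"
  have \<theta>: "\<theta> > 0" using \<rho> by (simp add: \<theta>_def)
  obtain u g v where u0: "u 0 = f" and u: "\<And>n. u (Suc n) = u n + (weight n - weight (Suc n)) *\<^sub>R g n"
    and gF: "\<And>n. g n \<in> cotail F n" and ug: "\<And>n. u n + weight n *\<^sub>R g n - f \<in> cotail F 0"
    and vu: "\<And>n. norm (v - u n) \<le> weight n"
    and gap: "\<And>n. excess (u n + weight n *\<^sub>R g n) g \<le> excess v g + \<theta> * weight (Suc n) / 2 ^ (n + 2)"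
    using james_construction[of F "\<lambda>n. \<theta> * weight (Suc n) / 2 ^ (n + 2)" f] F \<theta> weight_pos by auto
  have block: "convex_block g F" using gF by (simp add: convex_block_def)
  have g1: "norm (g n) \<le> 1" for n using convex_block_norm_le[of g F 1, OF block F] .
  \<comment> \<open>On \<open>Y\<close> the upper limit cannot lower the excess: evaluated at
    \<open>- y\<close>, it shows that the excess over a functional \<open>w\<close> is at least
    \<open>w y\<close>, hence at least \<open>\<nu> w\<close>.\<close>
  have lim0: "0 \<le> limsup_fun g y" if y: "y \<in> Y" for y
  proof -
    have "limsup_fun F z = 0" if "z \<in> Y" for z
      unfolding limsup_fun_def using F0[OF that] blinfun_seq_bound[of F _ z, OF F] by (rule upper_limit_eqI)
    then have "limsup_fun g (- y) \<le> 0"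
      using limsup_fun_convex_block[of F g "- y", OF F block] y Y by (simp add: subspace_neg)
    then show ?thesis using sublinearD(4)[OF sublinear_limsup_fun[of g, OF g1], of y] by simp
  qed
  have ge: "M * \<rho> + \<rho> \<le> excess v g"
  proof (rule tendsto_upperbound)
    show "(\<lambda>n. M * \<rho> + \<rho> - 2 * weight n) \<longlonglongrightarrow> M * \<rho> + \<rho>"
      using tendsto_mult_right_zero[OF weight_tendsto_0, of 2] by (auto intro!: tendsto_eq_intros)
    have "M * \<rho> + \<rho> - 2 * weight n \<le> excess v g" for n
    proof -
      let ?w = "u n + weight n *\<^sub>R g n"
      have "M * \<rho> + \<rho> \<le> \<nu> ?w" using \<nu>f[OF ug[of n]] by simp
      also have "\<dots> \<le> excess ?w g"
      proof (rule \<nu>_least)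
        fix y assume y: "y \<in> Y" "norm y \<le> 1"
        then have "- y \<in> Y" using Y by (simp add: subspace_neg)
        then show "blinfun_apply ?w y \<le> excess ?w g"
          using lim0[of "- y"] excess_upper[of g "- y" ?w, OF g1] y(2) by (simp add: blinfun.minus_right)
      qed
      also have "\<dots> \<le> excess v g + norm (?w - v)" using g1 by (rule excess_lipschitz)
      also have "norm (?w - v) \<le> norm (u n - v) + norm (weight n *\<^sub>R g n)"
        using norm_triangle_ineq[of "u n - v" "weight n *\<^sub>R g n"] by (simp add: algebra_simps)
      also have "norm (u n - v) \<le> weight n" using vu[of n] by (simp add: norm_minus_commute)
      also have "norm (weight n *\<^sub>R g n) \<le> weight n"
        using g1[of n] weight_pos[of n] by (simp add: mult_left_le)
      finally show ?thesis by simp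
    qed
    then show "\<forall>\<^sub>F n in sequentially. M * \<rho> + \<rho> - 2 * weight n \<le> excess v g" by simp
  qed simp
  have "1 < excess v g" using ge M(2) \<rho> by linarith
  then obtain x where x: "norm x = 1" "limsup_fun g x - blinfun_apply v x = excess v g"
    using excess_attained[OF attain, of g v] g1 by blast
  have "norm (u 0) + \<theta> \<le> excess v g" using f(1) \<nu>h ge by (simp add: u0 \<theta>_def)
  with james_excess_not_attained[of g u v \<theta> x] g1 u vu \<theta> gap x show False by blast
qed

section \<open>Functionals on infinite dimensional spaces\<close>

lemma blinfun_norming:
  fixes u :: "'e::real_normed_vector \<Rightarrow>\<^sub>L real"
  assumes "t < norm u" "0 \<le> t"
  obtains x where "norm x = 1" "t < blinfun_apply u x"
proof (rule ccontr)
  note found = that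
  assume no: "\<not> thesis"
  have le: "blinfun_apply u x \<le> t" if "norm x = 1" for x
  proof (rule ccontr)
    assume "\<not> blinfun_apply u x \<le> t"
    then show False using found[of x] that no by simp
  qed
  have "norm (blinfun_apply u x) \<le> t * norm x" for x
  proof (cases "x = 0")
    case False
    then have "blinfun_apply u (inverse (norm x) *\<^sub>R x) \<le> t" "blinfun_apply u (- (inverse (norm x) *\<^sub>R x)) \<le> t"
      by (auto intro!: le)
    then have "inverse (norm x) * \<bar>blinfun_apply u x\<bar> \<le> t"
      by (auto simp: blinfun.scaleR_right blinfun.minus_right abs_if)
    then show ?thesis using False by (simp add: field_simps)
  qed simp
  then have "norm u \<le> t" using assms(2) by (intro norm_blinfun_bound)
  with assms(1) show False by simp
qed

section \<open>Functionals that separate or are normed by finite sets\<close>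

lemma nonzero_functional:
  fixes x :: "'e::real_normed_vector"
  assumes "x \<noteq> 0"
  obtains v :: "'e \<Rightarrow>\<^sub>L real" where "blinfun_apply v x = 1"
proof -
  obtain v :: "'e \<Rightarrow>\<^sub>L real" where "blinfun_apply v x = norm x"
    using hahn_banach_support[of norm 1 x] sublinear_norm[of 1, where ?'a = 'e] by auto
  then have "blinfun_apply (inverse (norm x) *\<^sub>R v) x = 1"
    using assms by (simp add: blinfun.scaleR_left)
  then show ?thesis by (rule that)
qed

text \<open>A new generator \<open>a\<close> outside the span is handled by a rank one correction in
  the direction \<open>b = a - P a\<close>, on which the old projection vanishes.\<close>

lemma projection_onto_finite_span:
  fixes A :: "'e::real_normed_vector set"
  assumes "finite A"
  obtains P where "bounded_linear P" "\<And>x. P x \<in> span A" "\<And>x. x \<in> span A \<Longrightarrow> P x = x"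
proof -
  have "\<exists>P. bounded_linear P \<and> (\<forall>x. P x \<in> span A) \<and> (\<forall>x\<in>span A. P x = x)"
    using assms
  proof induction
    case empty
    show ?case by (intro exI[of _ "\<lambda>_. 0"]) (auto simp: bounded_linear_zero)
  next
    case (insert a A)
    then obtain P where P: "bounded_linear P" "\<And>x. P x \<in> span A" "\<And>x. x \<in> span A \<Longrightarrow> P x = x" by blast
    show ?case
    proof (cases "a \<in> span A")
      case True
      then show ?thesis using P by (simp add: span_redundant) blast
    next
      case False
      define b where "b = a - P a"
      have "b \<noteq> 0" using False P(2)[of a] by (auto simp: b_def)
      then obtain v :: "'e \<Rightarrow>\<^sub>L real" where v: "blinfun_apply v b = 1" using nonzero_functional by blast
      define Q where "Q x = P x + blinfun_apply v (x - P x) *\<^sub>R b" for x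
      have Q: "bounded_linear Q"
        unfolding Q_def
        by (intro bounded_linear_add P(1) bounded_linear_scaleR_left[THEN bounded_linear_compose]
            blinfun.bounded_linear_right[THEN bounded_linear_compose] bounded_linear_sub bounded_linear_ident)
      have "subspace {x. Q x = x}"
        using Q by (auto simp: subspace_def linear_0 linear_add linear_cmul dest!: bounded_linear.linear)
      moreover have "Q x = x" if "x \<in> insert a A" for x
        using that v P(3)[of x] by (auto simp: Q_def b_def span_base)
      ultimately have "span (insert a A) \<subseteq> {x. Q x = x}" by (intro span_minimal) auto
      moreover have "Q x \<in> span (insert a A)" for x
      proof -
        have "P z \<in> span (insert a A)" for z using P(2)[of z] span_mono[of A "insert a A"] by auto
        then show ?thesis
          unfolding Q_def b_def by (intro span_add span_scale span_diff) (auto simp: span_base)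
      qed
      ultimately show ?thesis using Q by blast
    qed
  qed
  then show ?thesis using that by blast
qed

text \<open>The complementary projection \<open>x - P x\<close> kills \<open>A\<close>; it is
  followed by a functional that is nonzero on its range, and the composition is normalized.\<close>

lemma annihilating_functional:
  fixes A :: "'e::real_normed_vector set"
  assumes "finite A" and "span A \<noteq> UNIV"
  obtains v :: "'e \<Rightarrow>\<^sub>L real" where "norm v = 1" "\<And>a. a \<in> A \<Longrightarrow> blinfun_apply v a = 0"
proof -
  obtain P where P: "bounded_linear P" "\<And>x. P x \<in> span A" "\<And>x. x \<in> span A \<Longrightarrow> P x = x"
    using projection_onto_finite_span[OF assms(1)] by blast
  obtain y where "y \<notin> span A" using assms(2) by blast
  then have "y - P y \<noteq> 0" using P(2)[of y] by auto
  then obtain w :: "'e \<Rightarrow>\<^sub>L real" where w: "blinfun_apply w (y - P y) = 1" using nonzero_functional by blast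
  have "bounded_linear (\<lambda>x. blinfun_apply w (x - P x))"
    by (intro blinfun.bounded_linear_right[THEN bounded_linear_compose] bounded_linear_sub P(1) bounded_linear_ident)
  then have u: "blinfun_apply (Blinfun (\<lambda>x. blinfun_apply w (x - P x))) x = blinfun_apply w (x - P x)" for x
    by (rule bounded_linear_Blinfun_apply[THEN fun_cong])
  define u where "u = Blinfun (\<lambda>x. blinfun_apply w (x - P x))"
  have "u \<noteq> 0" using u[of y] w by (auto simp: u_def)
  show ?thesis
  proof
    show "norm (inverse (norm u) *\<^sub>R u) = 1" using \<open>u \<noteq> 0\<close> by simp
    show "blinfun_apply (inverse (norm u) *\<^sub>R u) a = 0" if "a \<in> A" for a
      using u[of a] P(3)[of a] that by (simp add: u_def blinfun.scaleR_left span_base)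
  qed
qed

text \<open>The functionals nearly normed by a given \<open>a\<close> form an open set, and these
  sets cover everything, \<open>a = 0\<close> taking care of the functionals of norm below
  \<open>e\<close>. Compactness leaves finitely many of them.\<close>

lemma finite_norming_set:
  fixes C :: "('e::real_normed_vector \<Rightarrow>\<^sub>L real) set"
  assumes "compact C" "e > 0"
  obtains A where "finite A" "A \<subseteq> cball 0 1" "\<And>u. u \<in> C \<Longrightarrow> \<exists>a\<in>A. norm u - e < blinfun_apply u a"
proof -
  define U where "U a = {u :: 'e \<Rightarrow>\<^sub>L real. norm u - e < blinfun_apply u a}" for a
  have op: "open (U a)" for a unfolding U_def by (intro open_Collect_less continuous_intros)
  have ex: "\<exists>a\<in>cball 0 1. u \<in> U a" for u
  proof (cases "norm u < e")
    case True
    then have "u \<in> U 0" by (simp add: U_def)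
    then show ?thesis by (intro bexI[of _ 0]) simp_all
  next
    case False
    then obtain x where "norm x = 1" "norm u - e < blinfun_apply u x"
      using blinfun_norming[of "norm u - e" u] assms(2) by auto
    then show ?thesis by (intro bexI[of _ x]) (simp_all add: U_def)
  qed
  have "C \<subseteq> (\<Union>a\<in>cball 0 1. U a)" using ex by auto
  from compactE_image[OF assms(1) op this]
  obtain A where "A \<subseteq> cball 0 1" "finite A" and cover: "C \<subseteq> (\<Union>a\<in>A. U a)" by metis
  moreover have "\<exists>a\<in>A. norm u - e < blinfun_apply u a" if "u \<in> C" for u
    using cover that unfolding U_def by auto
  ultimately show ?thesis using that by metis
qed

text \<open>
  Mazur's construction of basic sequences, in the dual: the subspace spanned by the sets \<open>A n\<close>
  norms the span of the \<open>f n\<close>, and the \<open>f n\<close> tend to \<open>0\<close> pointwise on it.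
\<close>

locale mazur_sequence =
  fixes f :: "nat \<Rightarrow> 'e::real_normed_vector \<Rightarrow>\<^sub>L real" and A :: "nat \<Rightarrow> 'e set"
  assumes norm_f: "norm (f n) = 1" and A_ball: "A n \<subseteq> cball 0 1"
    and vanish: "n < m \<Longrightarrow> a \<in> A n \<Longrightarrow> blinfun_apply (f m) a = 0"
    and norming: "(\<And>i. \<bar>c i\<bar> \<le> 1) \<Longrightarrow> \<exists>a\<in>A n. norm (\<Sum>i\<le>n. c i *\<^sub>R f i) - 1 / real (Suc n)
      < blinfun_apply (\<Sum>i\<le>n. c i *\<^sub>R f i) a"

section \<open>Existence of Mazur sequences\<close>

lemma mazur_sequence_exists:
  assumes inf: "\<And>A :: 'e::real_normed_vector set. finite A \<Longrightarrow> span A \<noteq> UNIV"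
  obtains f :: "nat \<Rightarrow> 'e::real_normed_vector \<Rightarrow>\<^sub>L real" and A where "mazur_sequence f A"
proof -
  \<comment> \<open>Iterating \<open>T\<close> from \<open>{0}\<close> yields compact sets that
    contain every combination of the functionals chosen so far with coefficients in
    \<open>[-1, 1]\<close>.\<close>
  define T where "T C f = (\<lambda>(u, c). u + c *\<^sub>R f) ` (C \<times> {-1..1::real})"
    for C and f :: "'e \<Rightarrow>\<^sub>L real"
  define good where "good n C A f \<longleftrightarrow> compact C \<and> finite A \<and> A \<subseteq> cball 0 1 \<and> norm f = 1 \<and>
      (\<forall>u\<in>C. \<exists>a\<in>A. norm u - 1 / real (Suc n) < blinfun_apply u a)"
    for n C and A :: "'e set" and f :: "'e \<Rightarrow>\<^sub>L real"
  \<comment> \<open>The order of the choices matters: \<open>f'\<close> first annihilates the old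
    set \<open>A\<close>, then \<open>A\<close> is enlarged so as to norm the combinations that
    involve \<open>f'\<close>.\<close>
  have next_step: "\<exists>A' f'. good n (T C f') A' f' \<and> A \<subseteq> A' \<and> (\<forall>a\<in>A. blinfun_apply f' a = 0)"
    if CA: "compact C" "finite A" "A \<subseteq> cball 0 1" for n C A
  proof -
    obtain f' :: "'e \<Rightarrow>\<^sub>L real" where f': "norm f' = 1" "\<And>a. a \<in> A \<Longrightarrow> blinfun_apply f' a = 0"
      using annihilating_functional[OF CA(2) inf[OF CA(2)]] by blast
    have "compact (T C f')"
      unfolding T_def case_prod_unfold
      by (intro compact_continuous_image continuous_intros compact_Times CA compact_Icc)
    moreover from this obtain A' where A': "finite A'" "A' \<subseteq> cball 0 1"
      "\<And>u. u \<in> T C f' \<Longrightarrow> \<exists>a\<in>A'. norm u - 1 / real (Suc n) < blinfun_apply u a"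
      using finite_norming_set[of "T C f'" "1 / real (Suc n)"] by auto
    moreover have "\<forall>u\<in>T C f'. \<exists>a\<in>A \<union> A'. norm u - 1 / real (Suc n) < blinfun_apply u a"
      using A'(3) by blast
    ultimately have "good n (T C f') (A \<union> A') f'"
      using CA f'(1) unfolding good_def by (intro conjI) simp_all
    then show ?thesis using f'(2) by blast
  qed
  define P where "P n s \<longleftrightarrow> (case s of (C, A, f) \<Rightarrow> good n C A f \<and> (n = 0 \<longrightarrow> C = T {0} f))" for n s
  define Q where "Q s s' \<longleftrightarrow> (case (s, s') of ((C, A, f), (C', A', f')) \<Rightarrow>
      C' = T C f' \<and> A \<subseteq> A' \<and> (\<forall>a\<in>A. blinfun_apply f' a = 0))"
    for s s' :: "('e \<Rightarrow>\<^sub>L real) set \<times> 'e set \<times> ('e \<Rightarrow>\<^sub>L real)"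
  have "\<exists>s. \<forall>n. P n (s n) \<and> Q (s n) (s (Suc n))"
  proof (rule dependent_nat_choice[where Q = "\<lambda>n. Q"])
    have "\<exists>A' f'. good 0 (T {0} f') A' f' \<and> {} \<subseteq> A' \<and> (\<forall>a\<in>{}. blinfun_apply f' a = 0)"
      by (rule next_step) simp_all
    then obtain A f where "good 0 (T {0} f) A f" by blast
    then show "\<exists>s. P 0 s" by (intro exI[of _ "(T {0} f, A, f)"]) (simp add: P_def)
  next
    fix s n assume "P n s"
    obtain C A f where s: "s = (C, A, f)" by (cases s)
    with \<open>P n s\<close> have "good n C A f" by (simp add: P_def)
    then obtain A' f' where "good (Suc n) (T C f') A' f'" "A \<subseteq> A'" "\<forall>a\<in>A. blinfun_apply f' a = 0"
      using next_step[of C A "Suc n"] unfolding good_def by metis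
    then show "\<exists>s'. P (Suc n) s' \<and> Q s s'"
      by (intro exI[of _ "(T C f', A', f')"]) (simp add: P_def Q_def s)
  qed
  then obtain s where s: "\<And>n. P n (s n)" "\<And>n. Q (s n) (s (Suc n))" by blast
  define C where "C n = fst (s n)" for n
  define A where "A n = fst (snd (s n))" for n
  define f where "f n = snd (snd (s n))" for n
  have good: "good n (C n) (A n) (f n)" and C0: "C 0 = T {0} (f 0)" for n
    using s(1)[of n] s(1)[of 0] unfolding P_def C_def A_def f_def by (simp_all add: case_prod_beta)
  have CS: "C (Suc n) = T (C n) (f (Suc n))" and AS: "A n \<subseteq> A (Suc n)"
    and fS: "\<And>a. a \<in> A n \<Longrightarrow> blinfun_apply (f (Suc n)) a = 0" for n
    using s(2)[of n] unfolding Q_def C_def A_def f_def by (simp_all add: case_prod_beta)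
  have "mazur_sequence f A"
  proof
    show "norm (f n) = 1" "A n \<subseteq> cball 0 1" for n using good[of n] unfolding good_def by blast+
    show "blinfun_apply (f m) a = 0" if nm: "n < m" "a \<in> A n" for n m a
    proof -
      have k: "m = Suc (m - 1)" "n \<le> m - 1" using nm(1) by auto
      have "A n \<subseteq> A (m - 1)" using lift_Suc_mono_le[of A n "m - 1", OF AS k(2)] .
      then show ?thesis using fS[of a "m - 1"] nm(2) k(1) by auto
    qed
    fix c :: "nat \<Rightarrow> real" and n assume c: "\<And>i. \<bar>c i\<bar> \<le> 1"
    have "(\<Sum>i\<le>n. c i *\<^sub>R f i) \<in> C n"
    proof (induction n)
      case 0
      have "(\<Sum>i\<le>0. c i *\<^sub>R f i) = (\<lambda>(u, c). u + c *\<^sub>R f 0) (0, c 0)" by simp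
      moreover have "(0, c 0) \<in> {0} \<times> {-1..1}" using c[of 0] by (simp add: abs_le_iff)
      ultimately show ?case unfolding C0 T_def by (rule image_eqI)
    next
      case (Suc n)
      then have "(\<Sum>i\<le>n. c i *\<^sub>R f i, c (Suc n)) \<in> C n \<times> {-1..1}"
        using c[of "Suc n"] by (simp add: abs_le_iff)
      moreover have "(\<Sum>i\<le>Suc n. c i *\<^sub>R f i)
          = (\<lambda>(u, c). u + c *\<^sub>R f (Suc n)) (\<Sum>i\<le>n. c i *\<^sub>R f i, c (Suc n))" by simp
      ultimately show ?case unfolding CS T_def by (intro image_eqI)
    qed
    then show "\<exists>a\<in>A n. norm (\<Sum>i\<le>n. c i *\<^sub>R f i) - 1 / real (Suc n) < blinfun_apply (\<Sum>i\<le>n. c i *\<^sub>R f i) a"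
      using good[of n] unfolding good_def by blast
  qed
  then show ?thesis by (rule that)
qed

section \<open>The norming subspace of a Mazur sequence\<close>

context mazur_sequence
begin

definition Y :: "'e set" where "Y = span (\<Union>n. A n)"

lemma subspace_Y: "subspace Y"
  by (simp add: Y_def)

lemma A_subset_Y: "A n \<subseteq> Y"
  unfolding Y_def by (meson UN_upper UNIV_I order_trans span_superset)

lemma eventually_vanish:
  assumes "y \<in> Y"
  obtains N where "\<And>m. m \<ge> N \<Longrightarrow> blinfun_apply (f m) y = 0"
proof -
  have "subspace {y. \<exists>N. \<forall>m\<ge>N. blinfun_apply (f m) y = 0}"
    unfolding subspace_def
  proof (intro conjI ballI allI)
    fix x y assume "x \<in> {y. \<exists>N. \<forall>m\<ge>N. blinfun_apply (f m) y = 0}" "y \<in> {y. \<exists>N. \<forall>m\<ge>N. blinfun_apply (f m) y = 0}"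
    then obtain N N' where "\<forall>m\<ge>N. blinfun_apply (f m) x = 0" "\<forall>m\<ge>N'. blinfun_apply (f m) y = 0" by blast
    then show "x + y \<in> {y. \<exists>N. \<forall>m\<ge>N. blinfun_apply (f m) y = 0}"
      by (auto simp: blinfun.add_right intro!: exI[of _ "max N N'"])
  qed (auto simp: blinfun.scaleR_right)
  moreover have "(\<Union>n. A n) \<subseteq> {y. \<exists>N. \<forall>m\<ge>N. blinfun_apply (f m) y = 0}"
  proof
    fix y assume "y \<in> (\<Union>n. A n)"
    then obtain n where "y \<in> A n" by blast
    then have "\<forall>m\<ge>Suc n. blinfun_apply (f m) y = 0" using vanish by (auto simp: Suc_le_eq)
    then show "y \<in> {y. \<exists>N. \<forall>m\<ge>N. blinfun_apply (f m) y = 0}" by blast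
  qed
  ultimately have "Y \<subseteq> {y. \<exists>N. \<forall>m\<ge>N. blinfun_apply (f m) y = 0}"
    unfolding Y_def by (rule span_minimal[rotated])
  then show ?thesis using assms that by blast
qed

lemma tendsto_0_on_Y: "y \<in> Y \<Longrightarrow> (\<lambda>n. blinfun_apply (f n) y) \<longlonglongrightarrow> 0"
proof (rule tendsto_eventually)
  assume "y \<in> Y"
  then obtain N where "\<And>m. m \<ge> N \<Longrightarrow> blinfun_apply (f m) y = 0" by (rule eventually_vanish) blast
  then show "\<forall>\<^sub>F n in sequentially. blinfun_apply (f n) y = 0" by (auto simp: eventually_sequentially)
qed

text \<open>A convex combination of the \<open>f i\<close> has coefficients in
  \<open>[-1, 1]\<close> and equals its \<open>n\<close>-th partial sum for all large
  \<open>n\<close>. Hence \<open>A n\<close> norms it up to \<open>1 / (n + 1)\<close>, an error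
  that disappears in the limit.\<close>

lemma norm_le_on_Y:
  assumes u: "u \<in> convex hull (range f)" and le: "\<And>y. y \<in> Y \<Longrightarrow> \<bar>blinfun_apply u y\<bar> \<le> \<delta> * norm y"
    and \<delta>: "\<delta> \<ge> 0"
  shows "norm u \<le> \<delta>"
proof -
  define D where "D = {u. \<exists>N c. (\<forall>i. \<bar>c i\<bar> \<le> 1) \<and> (\<forall>n\<ge>N. u = (\<Sum>i\<le>n. c i *\<^sub>R f i))}"
  have "convex D"
    unfolding convex_def
  proof (intro ballI allI impI)
    fix u v and a b :: real
    assume uv: "u \<in> D" "v \<in> D" and ab: "0 \<le> a" "0 \<le> b" "a + b = 1"
    obtain N c where c: "\<forall>i. \<bar>c i\<bar> \<le> 1" "\<forall>n\<ge>N. u = (\<Sum>i\<le>n. c i *\<^sub>R f i)" using uv(1) by (auto simp: D_def)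
    obtain N' c' where c': "\<forall>i. \<bar>c' i\<bar> \<le> 1" "\<forall>n\<ge>N'. v = (\<Sum>i\<le>n. c' i *\<^sub>R f i)" using uv(2) by (auto simp: D_def)
    have "\<bar>a * c i + b * c' i\<bar> \<le> 1" for i
    proof -
      have "\<bar>a * c i + b * c' i\<bar> \<le> a * \<bar>c i\<bar> + b * \<bar>c' i\<bar>"
        using abs_triangle_ineq[of "a * c i" "b * c' i"] ab by (simp add: abs_mult)
      also have "\<dots> \<le> a * 1 + b * 1" using c(1) c'(1) ab by (intro add_mono mult_left_mono) auto
      finally show ?thesis using ab by simp
    qed
    moreover have "a *\<^sub>R u + b *\<^sub>R v = (\<Sum>i\<le>n. (a * c i + b * c' i) *\<^sub>R f i)" if "n \<ge> max N N'" for n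
    proof -
      have "u = (\<Sum>i\<le>n. c i *\<^sub>R f i)" "v = (\<Sum>i\<le>n. c' i *\<^sub>R f i)" using c(2) c'(2) that by auto
      then show ?thesis by (simp only: scaleR_add_left sum.distrib scaleR_sum_right scaleR_scaleR)
    qed
    ultimately show "a *\<^sub>R u + b *\<^sub>R v \<in> D"
      unfolding D_def mem_Collect_eq
      by (intro exI[of _ "max N N'"] exI[of _ "\<lambda>i. a * c i + b * c' i"] conjI allI impI)
  qed
  moreover have "f k \<in> D" for k
  proof -
    have *: "f k = (\<Sum>i\<le>n. (if i = k then 1 else 0) *\<^sub>R f i)" if "n \<ge> k" for n
    proof -
      have "(\<Sum>i\<le>n. (if i = k then 1 else 0) *\<^sub>R f i) = (\<Sum>i\<le>n. if i = k then f i else 0)"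
        by (intro sum.cong) auto
      then show ?thesis using that by simp
    qed
    show ?thesis
      unfolding D_def mem_Collect_eq
    proof (intro exI conjI allI impI)
      show "\<bar>if i = k then 1 else 0\<bar> \<le> (1::real)" for i by simp
    qed (rule *)
  qed
  ultimately have "convex hull (range f) \<subseteq> D" by (intro hull_minimal) auto
  with u have "u \<in> D" by blast
  then obtain N c where c: "\<And>i. \<bar>c i\<bar> \<le> 1" "\<And>n. n \<ge> N \<Longrightarrow> u = (\<Sum>i\<le>n. c i *\<^sub>R f i)"
    unfolding D_def mem_Collect_eq by metis
  show ?thesis
  proof (rule tendsto_lowerbound)
    show "(\<lambda>n. \<delta> + inverse (real (Suc n))) \<longlonglongrightarrow> \<delta>"
      using tendsto_add[OF tendsto_const LIMSEQ_inverse_real_of_nat] by (simp del: of_nat_Suc)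
    have "norm u \<le> \<delta> + inverse (real (Suc n))" if n: "n \<ge> N" for n
    proof -
      obtain a where a: "a \<in> A n" "norm u - 1 / real (Suc n) < blinfun_apply u a"
        using norming[of c n] c(1) unfolding c(2)[OF n, symmetric] by blast
      have "\<delta> * norm a \<le> \<delta> * 1" using a(1) A_ball[of n] \<delta> by (intro mult_left_mono) auto
      then have "blinfun_apply u a \<le> \<delta>" using le[of a] a(1) A_subset_Y[of n] by force
      with a(2) show ?thesis by (simp add: inverse_eq_divide del: of_nat_Suc)
    qed
    then show "\<forall>\<^sub>F n in sequentially. norm u \<le> \<delta> + inverse (real (Suc n))"
      unfolding eventually_sequentially by blast
  qed simp
qed

text \<open>If \<open>f n x\<close> were at least \<open>e\<close> infinitely often, a convex
  combination of these \<open>f n\<close> would be small on \<open>Y\<close>, hence small in norm by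
  \<open>norm_le_on_Y\<close>; yet its value at \<open>x\<close> is still at least \<open>e\<close>.
  Negative values are covered by \<open>- x\<close>.\<close>

lemma weak_star_null:
  assumes attain: "seminorms_attain TYPE('e)"
  shows "(\<lambda>n. blinfun_apply (f n) x) \<longlonglongrightarrow> 0"
proof -
  have False if inf: "infinite {n. e \<le> blinfun_apply (f n) x}" and e: "e > 0" for e x
  proof -
    define r where "r = enumerate {n. e \<le> blinfun_apply (f n) x}"
    have r: "strict_mono r" "\<And>k. e \<le> blinfun_apply (f (r k)) x"
      using strict_mono_enumerate[OF inf] enumerate_in_set[OF inf] by (auto simp: r_def)
    have "(\<lambda>k. blinfun_apply (f (r k)) y) \<longlonglongrightarrow> 0" if "y \<in> Y" for y
      using LIMSEQ_subseq_LIMSEQ[OF tendsto_0_on_Y[OF that] r(1)] by (simp add: o_def)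
    note r0 = this
    have "x \<noteq> 0" using r(2)[of 0] e by auto
    then have pos: "e / (2 * norm x) > 0" using e by simp
    have "norm (f (r k)) \<le> 1" for k by (simp add: norm_f)
    note small = small_convex_combination[OF attain subspace_Y this r0 pos]
    have "\<exists>g. g \<in> convex hull (range (\<lambda>k. f (r k))) \<and>
        (\<forall>y\<in>Y. \<bar>blinfun_apply g y\<bar> \<le> e / (2 * norm x) * norm y)"
    proof (rule small)
      fix g assume "g \<in> convex hull (range (\<lambda>k. f (r k)))"
        and "\<And>y. y \<in> Y \<Longrightarrow> \<bar>blinfun_apply g y\<bar> \<le> e / (2 * norm x) * norm y"
      then show ?thesis by (intro exI[of _ g] conjI ballI)
    qed
    then obtain g where g: "g \<in> convex hull (range (\<lambda>k. f (r k)))"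
      and gY: "\<forall>y\<in>Y. \<bar>blinfun_apply g y\<bar> \<le> e / (2 * norm x) * norm y"
      by (elim exE conjE)
    have "convex hull (range (\<lambda>k. f (r k))) \<subseteq> convex hull (range f)" by (intro hull_mono) auto
    then have "g \<in> convex hull (range f)" using g by (rule subsetD)
    then have "norm g \<le> e / (2 * norm x)" using bspec[OF gY] less_imp_le[OF pos] by (rule norm_le_on_Y)
    then have "blinfun_apply g x \<le> e / 2"
      using apply_le_norm[of g "e / (2 * norm x)" x] \<open>x \<noteq> 0\<close> by simp
    moreover have "convex hull (range (\<lambda>k. f (r k))) \<subseteq> {h. blinfun_apply h (- x) \<le> - e}"
      using r(2) by (intro hull_minimal convex_apply_le) (auto simp: blinfun.minus_right)
    then have "g \<in> {h. blinfun_apply h (- x) \<le> - e}" using g by (rule subsetD)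
    then have "e \<le> blinfun_apply g x" by (simp add: blinfun.minus_right)
    ultimately show False using e by simp
  qed
  note no_inf = this
  show ?thesis
  proof (rule LIMSEQ_I)
    fix e :: real assume e: "e > 0"
    define S where "S = {n. e \<le> blinfun_apply (f n) x} \<union> {n. e \<le> blinfun_apply (f n) (- x)}"
    have "finite S" using no_inf[of e x] no_inf[of e "- x"] e unfolding S_def by blast
    then obtain N where N: "\<forall>n\<in>S. n < N" unfolding finite_nat_set_iff_bounded by (elim exE)
    have "norm (blinfun_apply (f n) x - 0) < e" if "n \<ge> N" for n
    proof (rule ccontr)
      assume "\<not> norm (blinfun_apply (f n) x - 0) < e"
      then have "n \<in> S" by (auto simp: S_def blinfun.minus_right)
      then show False using N that by auto
    qed
    then show "\<exists>N. \<forall>n\<ge>N. norm (blinfun_apply (f n) x - 0) < e" by (intro exI[of _ N] allI impI)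
  qed
qed

end

section \<open>Perturbation by weak-star null sequences\<close>

text \<open>At a fixed \<open>x\<close> of norm 1 the late terms of the supremum are at most about
  \<open>\<bar>h x\<bar>\<close>, and the finitely many others are below \<open>\<rho>\<close>
  because their norms are. So the supremum \<open>\<rho>\<close> over the sphere is not attained,
  although \<open>1 < \<rho>\<close> makes \<open>seminorms_attain\<close> applicable.\<close>

lemma norm_add_weak_star_null_less:
  fixes g :: "nat \<Rightarrow> 'e::real_normed_vector \<Rightarrow>\<^sub>L real"
  assumes attain: "seminorms_attain TYPE('e)"
    and g0: "\<And>x. (\<lambda>n. blinfun_apply (g n) x) \<longlonglongrightarrow> 0" and g1: "\<And>n. norm (g n) \<le> 1"
    and \<rho>: "1 < \<rho>" "norm h < \<rho>"
  shows "\<exists>n. norm (h + g n) < \<rho>"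
proof (rule ccontr)
  assume "\<not> ?thesis"
  then have ge: "\<rho> \<le> norm (h + g n)" for n by (simp add: not_less)
  \<comment> \<open>The prescribed norms of the \<open>v n\<close>: they increase strictly from 0 to
    \<open>\<rho>\<close> without reaching it.\<close>
  define b where "b n = \<rho> * (1 - inverse (real (Suc n)))" for n
  define a where "a n = b n / norm (h + g n)" for n
  define v where "v n = a n *\<^sub>R (h + g n)" for n
  define q where "q x = (SUP n. \<bar>blinfun_apply (v n) x\<bar>)" for x
  have b: "0 \<le> b n" "b n < \<rho>" for n
    using \<rho>(1) by (simp_all add: b_def inverse_le_1_iff del: of_nat_Suc)
  have pos: "norm (h + g n) > 0" for n using ge[of n] \<rho>(1) by linarith
  have norm_v: "norm (v n) = b n" for n using pos[of n] b(1)[of n] by (simp add: v_def a_def)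
  have a: "0 \<le> a n" "a n \<le> 1" for n
    using pos[of n] b[of n] ge[of n] by (simp_all add: a_def divide_le_eq)
  have v_le: "\<bar>blinfun_apply (v n) x\<bar> \<le> \<bar>blinfun_apply h x\<bar> + \<bar>blinfun_apply (g n) x\<bar>" for n x
  proof -
    have "\<bar>blinfun_apply (v n) x\<bar> = a n * \<bar>blinfun_apply (h + g n) x\<bar>"
      using a(1)[of n] by (simp add: v_def blinfun.scaleR_left abs_mult)
    also have "\<dots> \<le> 1 * \<bar>blinfun_apply (h + g n) x\<bar>" using a(2)[of n] by (intro mult_right_mono) auto
    finally show ?thesis by (simp add: blinfun.add_left)
  qed
  have v_le_b: "\<bar>blinfun_apply (v n) x\<bar> \<le> b n * norm x" for n x
    using apply_le_norm[of "v n" "b n" x] by (simp add: norm_v)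
  have v_le_\<rho>: "\<bar>blinfun_apply (v n) x\<bar> \<le> \<rho> * norm x" for n x
    using v_le_b[of n x] mult_right_mono[OF less_imp_le[OF b(2)[of n]] norm_ge_zero[of x]] by linarith
  have bdd: "bdd_above (range (\<lambda>n. \<bar>blinfun_apply (v n) x\<bar>))" for x
    using v_le_\<rho>[of _ x] by (intro bdd_aboveI2)
  have q_upper: "\<bar>blinfun_apply (v n) x\<bar> \<le> q x" for n x
    unfolding q_def by (rule cSUP_upper[OF UNIV_I bdd])
  have q_least: "q x \<le> t" if "\<And>n. \<bar>blinfun_apply (v n) x\<bar> \<le> t" for x t
    unfolding q_def using that by (intro cSUP_least) auto
  obtain x where x: "norm x = 1" "q x = \<rho>"
  proof (rule seminorms_attainD[OF attain, of q h 1 \<rho>])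
    show "sublinear q"
    proof (rule sublinearI)
      fix x y
      show "q (x + y) \<le> q x + q y"
      proof (rule q_least)
        fix n
        have "\<bar>blinfun_apply (v n) (x + y)\<bar> \<le> \<bar>blinfun_apply (v n) x\<bar> + \<bar>blinfun_apply (v n) y\<bar>"
          by (simp add: blinfun.add_right)
        then show "\<bar>blinfun_apply (v n) (x + y)\<bar> \<le> q x + q y"
          using q_upper[of n x] q_upper[of n y] by linarith
      qed
      fix c :: real assume "c > 0"
      then show "q (c *\<^sub>R x) \<le> c * q x"
        using q_upper[of _ x] by (intro q_least) (simp add: blinfun.scaleR_right abs_mult)
    qed (simp add: q_def)
    show "q (- x) = q x" for x by (simp add: q_def blinfun.minus_right)
    show "q x \<le> \<bar>blinfun_apply h x\<bar> + 1 * norm x" for x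
    proof (rule q_least)
      fix n
      show "\<bar>blinfun_apply (v n) x\<bar> \<le> \<bar>blinfun_apply h x\<bar> + 1 * norm x"
        using v_le[of n x] apply_le_norm[OF g1[of n], of x] by linarith
    qed
    show "q x \<le> \<rho>" if "norm x = 1" for x using v_le_\<rho>[of _ x] that by (intro q_least) simp
    fix e :: real assume e: "e > 0"
    have "b \<longlonglongrightarrow> \<rho> * (1 - 0)"
      unfolding b_def by (intro tendsto_intros LIMSEQ_inverse_real_of_nat)
    then have "\<forall>\<^sub>F n in sequentially. max (\<rho> - e) 0 < b n"
      using e \<rho>(1) by (intro order_tendstoD) auto
    then obtain n where n: "max (\<rho> - e) 0 < norm (v n)"
      unfolding norm_v using eventually_happens'[OF sequentially_bot] by blast
    then obtain x where x: "norm x = 1" "max (\<rho> - e) 0 < blinfun_apply (v n) x"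
      using blinfun_norming[of "max (\<rho> - e) 0" "v n"] by auto
    then have "\<rho> - e < q x" using q_upper[of n x] by linarith
    with x(1) show "\<exists>x. norm x = 1 \<and> \<rho> - e < q x" by blast
  qed (use \<rho> in auto)
  \<comment> \<open>Half the distance from \<open>norm h\<close> to \<open>\<rho>\<close>: once
    \<open>\<bar>g n x\<bar> < \<eta>\<close>, the term of index \<open>n\<close> is at most
    \<open>\<rho> - \<eta>\<close>. Earlier terms are bounded by \<open>b N\<close>.\<close>
  define \<eta> where "\<eta> = (\<rho> - norm h) / 2"
  have "\<eta> > 0" using \<rho>(2) by (simp add: \<eta>_def)
  then obtain N where N: "\<And>n. n \<ge> N \<Longrightarrow> \<bar>blinfun_apply (g n) x\<bar> < \<eta>"
    using LIMSEQ_D[OF g0[of x], of \<eta>] by auto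
  have "\<bar>blinfun_apply (v n) x\<bar> \<le> max (\<rho> - \<eta>) (b N)" for n
  proof (cases "n \<ge> N")
    case True
    have "\<bar>blinfun_apply h x\<bar> \<le> norm h" using apply_le_norm[of h "norm h" x] x(1) by simp
    then have "\<bar>blinfun_apply (v n) x\<bar> \<le> \<rho> - \<eta>"
      using v_le[of n x] N[OF True] unfolding \<eta>_def by argo
    then show ?thesis by simp
  next
    case False
    then have "b n \<le> b N" unfolding b_def using \<rho>(1)
      by (intro mult_left_mono diff_mono le_imp_inverse_le) auto
    then show ?thesis using v_le_b[of n x] x(1) by simp
  qed
  then have "q x \<le> max (\<rho> - \<eta>) (b N)" by (rule q_least)
  with x(2) b(2)[of N] \<open>\<eta> > 0\<close> show False by simp
qed

section \<open>Series along a Mazur sequence\<close>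

context mazur_sequence
begin

lemma norm_add_less:
  assumes attain: "seminorms_attain TYPE('e)" and e: "e > 0"
  shows "\<exists>n>N. norm (h + f n) < max 1 (norm h) + e"
proof -
  have "(\<lambda>n. blinfun_apply (f (n + Suc N)) x) \<longlonglongrightarrow> 0" for x
    using weak_star_null[OF attain, of x] by (rule LIMSEQ_ignore_initial_segment)
  then obtain n where "norm (h + f (n + Suc N)) < max 1 (norm h) + e"
    using norm_add_weak_star_null_less[OF attain, of "\<lambda>n. f (n + Suc N)" "max 1 (norm h) + e" h] norm_f e
    by fastforce
  then show ?thesis by (intro exI[of _ "n + Suc N"]) simp
qed

text \<open>The sums start with norm 1, and the next index is chosen so that the bound grows by at
  most \<open>(1/2) ^ Suc n\<close>. The maximum with 1 in \<open>norm_add_less\<close> does no harm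
  because \<open>1 \<le> 2 - (1/2) ^ n\<close>.\<close>

lemma bounded_partial_sums:
  assumes attain: "seminorms_attain TYPE('e)"
  obtains r :: "nat \<Rightarrow> nat" where "strict_mono r" "\<And>n. norm (\<Sum>k\<le>n. f (r k)) \<le> 2"
proof -
  define P where "P n s \<longleftrightarrow> norm (snd s) \<le> 2 - (1/2) ^ n \<and> (n = 0 \<longrightarrow> snd s = f (fst s))"
    for n and s :: "nat \<times> ('e \<Rightarrow>\<^sub>L real)"
  define Q where "Q s s' \<longleftrightarrow> fst s < fst s' \<and> snd s' = snd s + f (fst s')"
    for s s' :: "nat \<times> ('e \<Rightarrow>\<^sub>L real)"
  have "\<exists>s. \<forall>n. P n (s n) \<and> Q (s n) (s (Suc n))"
  proof (rule dependent_nat_choice[where Q = "\<lambda>n. Q"])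
    show "\<exists>s. P 0 s" by (intro exI[of _ "(0, f 0)"]) (simp add: P_def norm_f)
  next
    fix s n assume "P n s"
    then have "norm (snd s) \<le> 2 - (1/2) ^ n" by (simp add: P_def)
    moreover have "(1/2 :: real) ^ n \<le> 1" by (rule power_le_one) auto
    moreover obtain m where m: "m > fst s"
      "norm (snd s + f m) < max 1 (norm (snd s)) + (1/2) ^ Suc n"
      using norm_add_less[OF attain, of "(1/2) ^ Suc n"] by force
    moreover have "(1/2 :: real) ^ Suc n = (1/2) ^ n / 2" by simp
    ultimately have "norm (snd s + f m) \<le> 2 - (1/2) ^ Suc n" by linarith
    with m(1) show "\<exists>s'. P (Suc n) s' \<and> Q s s'"
      by (intro exI[of _ "(m, snd s + f m)"]) (simp add: P_def Q_def)
  qed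
  then obtain s where s: "\<And>n. P n (s n)" "\<And>n. Q (s n) (s (Suc n))" by blast
  define r where "r n = fst (s n)" for n
  have "strict_mono r" using s(2) by (auto simp: strict_mono_Suc_iff r_def Q_def)
  moreover have s0: "snd (s 0) = f (fst (s 0))"
    and sS: "snd (s (Suc n)) = snd (s n) + f (fst (s (Suc n)))" for n
    using s(1)[of 0] s(2)[of n] by (simp_all add: P_def Q_def)
  have sum: "(\<Sum>k\<le>n. f (r k)) = snd (s n)" for n
    by (induction n) (simp_all add: r_def s0 sS)
  have "norm (\<Sum>k\<le>n. f (r k)) \<le> 2" for n
  proof -
    have "norm (snd (s n)) \<le> 2 - (1/2) ^ n" using s(1)[of n] by (simp add: P_def)
    then show ?thesis unfolding sum using zero_le_power[of "1/2 :: real" n] by linarith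
  qed
  ultimately show ?thesis by (rule that)
qed

text \<open>Filling the gaps with zero coefficients turns the combination into a full partial sum up
  to \<open>r k\<close>, and \<open>k \<le> r k\<close> weakens the error to
  \<open>1 / (k + 1)\<close>.\<close>

lemma norm_subsequence_combination:
  assumes r: "strict_mono r" and d: "\<And>j. \<bar>d j\<bar> \<le> 1"
  obtains a where "a \<in> A (r k)"
    "norm (\<Sum>j\<le>k. d j *\<^sub>R f (r j)) - 1 / real (Suc k) < blinfun_apply (\<Sum>j\<le>k. d j *\<^sub>R f (r j)) a"
proof -
  define c where "c i = (if i \<in> r ` {..k} then d (inv_into UNIV r i) else 0)" for i
  have inj: "inj r" using r by (rule strict_mono_imp_inj_on)
  have "(\<Sum>i\<le>r k. c i *\<^sub>R f i) = (\<Sum>i\<in>r ` {..k}. c i *\<^sub>R f i)"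
    using r by (intro sum.mono_neutral_right) (auto simp: c_def strict_mono_less_eq)
  also have "\<dots> = (\<Sum>j\<le>k. d j *\<^sub>R f (r j))"
    using inj_on_subset[OF inj subset_UNIV, of "{..k}"]
    by (subst sum.reindex) (auto simp: c_def inv_f_f[OF inj] intro!: sum.cong)
  finally have eq: "(\<Sum>i\<le>r k. c i *\<^sub>R f i) = (\<Sum>j\<le>k. d j *\<^sub>R f (r j))" .
  have "\<bar>c i\<bar> \<le> 1" for i using d by (simp add: c_def)
  then obtain a where a: "a \<in> A (r k)" "norm (\<Sum>j\<le>k. d j *\<^sub>R f (r j)) - 1 / real (Suc (r k))
      < blinfun_apply (\<Sum>j\<le>k. d j *\<^sub>R f (r j)) a"
    using norming[of c "r k"] unfolding eq by blast
  have "1 / real (Suc (r k)) \<le> 1 / real (Suc k)"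
    using strict_mono_imp_increasing[OF r, of k] by (intro divide_left_mono) auto
  then show ?thesis using that[OF a(1)] a(2) by linarith
qed

text \<open>At each point of \<open>Y\<close> the partial sums are eventually constant. Their limit
  is bounded by \<open>c\<close> on \<open>Y\<close> and extends to the whole space; outside
  \<open>Y\<close> the extension need not be a limit of the sums.\<close>

lemma partial_sums_limit:
  assumes r: "strict_mono r" and bound: "\<And>n. norm (\<Sum>k\<le>n. f (r k)) \<le> c"
  obtains w where "norm w \<le> c"
    "\<And>y. y \<in> Y \<Longrightarrow> (\<lambda>n. blinfun_apply (\<Sum>k\<le>n. f (r k)) y) \<longlonglongrightarrow> blinfun_apply w y"
proof -
  define S where "S n = (\<Sum>k\<le>n. f (r k))" for n
  define w where "w y = lim (\<lambda>n. blinfun_apply (S n) y)" for y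
  have lim: "(\<lambda>n. blinfun_apply (S n) y) \<longlonglongrightarrow> w y" if y: "y \<in> Y" for y
  proof -
    obtain N where N: "\<And>m. m \<ge> N \<Longrightarrow> blinfun_apply (f m) y = 0" using y by (rule eventually_vanish) blast
    have const: "blinfun_apply (S n) y = blinfun_apply (S N) y" if "n \<ge> N" for n
      using that
    proof (induction rule: dec_induct)
      case (step n)
      then have "Suc n \<le> r (Suc n)" using strict_mono_imp_increasing[OF r] by blast
      with step have "blinfun_apply (f (r (Suc n))) y = 0" by (intro N) linarith
      with step.IH show ?case by (simp add: S_def blinfun.add_left)
    qed simp
    have "(\<lambda>n. blinfun_apply (S n) y) \<longlonglongrightarrow> blinfun_apply (S N) y"
      by (intro tendsto_eventually eventually_sequentiallyI[of N] const)
    then show ?thesis unfolding w_def by (simp add: limI)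
  qed
  have c: "0 \<le> c" using order_trans[OF norm_ge_zero bound[of 0]] .
  obtain v :: "'e \<Rightarrow>\<^sub>L real" where v: "norm v \<le> c" "\<And>y. y \<in> Y \<Longrightarrow> blinfun_apply v y = w y"
  proof (rule hahn_banach_norm[OF subspace_Y, of w c])
    fix x y assume xy: "x \<in> Y" "y \<in> Y"
    have "(\<lambda>n. blinfun_apply (S n) (x + y)) \<longlonglongrightarrow> w x + w y"
      unfolding blinfun.add_right by (intro tendsto_add lim xy)
    with lim[OF subspace_add[OF subspace_Y xy]] show "w (x + y) = w x + w y" by (rule LIMSEQ_unique)
  next
    fix t :: real and y assume y: "y \<in> Y"
    have "(\<lambda>n. blinfun_apply (S n) (t *\<^sub>R y)) \<longlonglongrightarrow> t * w y"
      unfolding blinfun.scaleR_right real_scaleR_def by (intro tendsto_mult tendsto_const lim y)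
    with lim[OF subspace_scale[OF subspace_Y y]] show "w (t *\<^sub>R y) = t * w y" by (rule LIMSEQ_unique)
    have "\<bar>blinfun_apply (S n) y\<bar> \<le> c * norm y" for n
      using bound[of n] unfolding S_def by (rule apply_le_norm)
    then show "\<bar>w y\<bar> \<le> c * norm y"
      by (intro tendsto_upperbound[OF tendsto_rabs[OF lim[OF y]]]) auto
  qed (use c in auto)
  show ?thesis
  proof (rule that[OF v(1)])
    fix y assume y: "y \<in> Y"
    show "(\<lambda>n. blinfun_apply (\<Sum>k\<le>n. f (r k)) y) \<longlonglongrightarrow> blinfun_apply v y"
      using lim[OF y] unfolding v(2)[OF y] S_def .
  qed
qed

text \<open>The scaled remainders \<open>R n\<close> tend to 0 on \<open>Y\<close>, so some convex
  combination \<open>g\<close> of them is small there. On \<open>Y\<close>,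
  \<open>4 *\<^sub>R g\<close> is a series in the \<open>f (r j)\<close> whose coefficients are
  eventually 1. Since \<open>Y\<close> norms its partial sums, these are small too, although two
  late consecutive ones differ by a functional of norm 1.\<close>

lemma seminorms_do_not_attain: "\<not> seminorms_attain TYPE('e)"
proof
  assume attain: "seminorms_attain TYPE('e)"
  obtain r :: "nat \<Rightarrow> nat" where r: "strict_mono r" and bound: "\<And>n. norm (\<Sum>k\<le>n. f (r k)) \<le> 2"
    using bounded_partial_sums[OF attain] by blast
  obtain w where w: "norm w \<le> 2"
    and lim: "\<And>y. y \<in> Y \<Longrightarrow> (\<lambda>n. blinfun_apply (\<Sum>k\<le>n. f (r k)) y) \<longlonglongrightarrow> blinfun_apply w y"
    using partial_sums_limit[OF r bound] by blast
  define S where "S n = (\<Sum>k\<le>n. f (r k))" for n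
  \<comment> \<open>Both \<open>w\<close> and \<open>S n\<close> have norm at most 2, so the factor
    \<open>1/4\<close> normalizes their difference.\<close>
  define R where "R n = (1/4) *\<^sub>R (w - S n)" for n
  have R1: "norm (R n) \<le> 1" for n
    using norm_triangle_ineq4[of w "S n"] w bound[of n] by (simp add: R_def S_def)
  have R0: "(\<lambda>n. blinfun_apply (R n) y) \<longlonglongrightarrow> 0" if "y \<in> Y" for y
  proof -
    have "(\<lambda>n. (1/4) * (blinfun_apply w y - blinfun_apply (S n) y))
        \<longlonglongrightarrow> (1/4) * (blinfun_apply w y - blinfun_apply w y)"
      unfolding S_def by (intro tendsto_intros lim that)
    then show ?thesis by (simp add: R_def blinfun.scaleR_left blinfun.diff_left)
  qed
  have "\<exists>g. g \<in> convex hull (range R) \<and> (\<forall>y\<in>Y. \<bar>blinfun_apply g y\<bar> \<le> 1/32 * norm y)"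
  proof (rule small_convex_combination[OF attain subspace_Y R1 R0, of "1/32"])
    fix g assume "g \<in> convex hull (range R)" "\<And>y. y \<in> Y \<Longrightarrow> \<bar>blinfun_apply g y\<bar> \<le> 1/32 * norm y"
    then show ?thesis by (intro exI[of _ g] conjI ballI)
  qed simp_all
  then obtain g where g: "g \<in> convex hull (range R)"
    and small: "\<forall>y\<in>Y. \<bar>blinfun_apply g y\<bar> \<le> 1/32 * norm y" by (elim exE conjE)
  \<comment> \<open>The form of the series shared by all convex combinations of remainders; the
    factor 4 undoes the scaling in \<open>R\<close>.\<close>
  define tail where "tail g d N \<longleftrightarrow> (\<forall>j. 0 \<le> d j \<and> d j \<le> 1) \<and> (\<forall>j\<ge>N. d j = 1) \<and>
      (\<forall>y\<in>Y. (\<lambda>n. \<Sum>j\<le>n. d j * blinfun_apply (f (r j)) y) \<longlonglongrightarrow> 4 * blinfun_apply g y)"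
    for g and d :: "nat \<Rightarrow> real" and N :: nat
  define G where "G = {g. \<exists>d N. tail g d N}"
  have "convex G"
    unfolding convex_def
  proof (intro ballI allI impI)
    fix u v and s t :: real
    assume uv: "u \<in> G" "v \<in> G" and st: "0 \<le> s" "0 \<le> t" "s + t = 1"
    obtain d N where d: "tail u d N" using uv(1) unfolding G_def by blast
    obtain d' N' where d': "tail v d' N'" using uv(2) unfolding G_def by blast
    have "tail (s *\<^sub>R u + t *\<^sub>R v) (\<lambda>j. s * d j + t * d' j) (max N N')"
      unfolding tail_def
    proof (intro conjI allI impI ballI)
      fix j
      have dj: "0 \<le> d j" "d j \<le> 1" "0 \<le> d' j" "d' j \<le> 1" using d d' by (simp_all add: tail_def)
      then show "0 \<le> s * d j + t * d' j" using st by simp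
      have "s * d j + t * d' j \<le> s * 1 + t * 1" using dj st by (intro add_mono mult_left_mono)
      then show "s * d j + t * d' j \<le> 1" using st by simp
      show "s * d j + t * d' j = 1" if "max N N' \<le> j" using that d d' st(3) by (simp add: tail_def)
    next
      fix y assume y: "y \<in> Y"
      have "(\<lambda>n. s * (\<Sum>j\<le>n. d j * blinfun_apply (f (r j)) y) + t * (\<Sum>j\<le>n. d' j * blinfun_apply (f (r j)) y))
          \<longlonglongrightarrow> s * (4 * blinfun_apply u y) + t * (4 * blinfun_apply v y)"
        using d d' y by (intro tendsto_intros) (simp_all add: tail_def)
      then show "(\<lambda>n. \<Sum>j\<le>n. (s * d j + t * d' j) * blinfun_apply (f (r j)) y)
          \<longlonglongrightarrow> 4 * blinfun_apply (s *\<^sub>R u + t *\<^sub>R v) y"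
        by (simp add: blinfun.add_left blinfun.scaleR_left sum_distrib_left distrib_right sum.distrib
            mult.assoc distrib_left mult.left_commute[of 4])
    qed
    then show "s *\<^sub>R u + t *\<^sub>R v \<in> G" unfolding G_def by blast
  qed
  moreover have "R N \<in> G" for N
  proof -
    have "tail (R N) (\<lambda>j. if j \<le> N then 0 else 1) (Suc N)"
      unfolding tail_def
    proof (intro conjI allI impI ballI)
      fix y assume y: "y \<in> Y"
      have eq: "(\<Sum>j\<le>n. (if j \<le> N then 0 else 1) * blinfun_apply (f (r j)) y)
          = blinfun_apply (S n) y - blinfun_apply (S N) y" if "n \<ge> N" for n
        using that
      proof (induction rule: dec_induct)
        case base
        show ?case by (simp add: sum.neutral)
      next
        case (step n)
        then show ?case by (simp add: S_def blinfun.add_left)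
      qed
      have "4 * blinfun_apply (R N) y = blinfun_apply w y - blinfun_apply (S N) y"
        by (simp add: R_def blinfun.scaleR_left blinfun.diff_left)
      moreover have "(\<lambda>n. blinfun_apply (S n) y - blinfun_apply (S N) y) \<longlonglongrightarrow> blinfun_apply w y - blinfun_apply (S N) y"
        unfolding S_def by (intro tendsto_intros lim y)
      ultimately have "(\<lambda>n. blinfun_apply (S n) y - blinfun_apply (S N) y) \<longlonglongrightarrow> 4 * blinfun_apply (R N) y"
        by simp
      then show "(\<lambda>n. \<Sum>j\<le>n. (if j \<le> N then 0 else 1) * blinfun_apply (f (r j)) y) \<longlonglongrightarrow> 4 * blinfun_apply (R N) y"
        by (rule Lim_transform_eventually) (intro eventually_sequentiallyI[of N] eq[symmetric])
    qed auto
    then show ?thesis unfolding G_def by blast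
  qed
  ultimately have "convex hull (range R) \<subseteq> G" by (intro hull_minimal) auto
  then have "g \<in> G" using g by (rule subsetD)
  then obtain d N where d: "tail g d N" unfolding G_def by blast
  then have d1: "\<bar>d j\<bar> \<le> 1" for j by (simp add: tail_def abs_le_iff)
  define U where "U k = (\<Sum>j\<le>k. d j *\<^sub>R f (r j))" for k
  \<comment> \<open>The functionals after index \<open>r k\<close> vanish on \<open>A (r k)\<close>.
    At the norming point \<open>a\<close> the whole series therefore equals \<open>U k\<close>, and
    its value \<open>4 * g a\<close> is at most \<open>4 * (1/32) = 1/8\<close>.\<close>
  have U: "norm (U k) \<le> 1/8 + 1 / real (Suc k)" for k
  proof -
    obtain a where a: "a \<in> A (r k)" "norm (U k) - 1 / real (Suc k) < blinfun_apply (U k) a"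
      unfolding U_def by (rule norm_subsequence_combination[OF r d1])
    have aY: "a \<in> Y" using A_subset_Y a(1) by (rule subsetD)
    have eq: "(\<Sum>j\<le>n. d j * blinfun_apply (f (r j)) a) = blinfun_apply (U k) a" if "n \<ge> k" for n
      using that
    proof (induction rule: dec_induct)
      case base
      show ?case by (simp add: U_def blinfun.sum_left blinfun.scaleR_left)
    next
      case (step n)
      then have "r k < r (Suc n)" using strict_mono_less[OF r, of k "Suc n"] by simp
      then have "blinfun_apply (f (r (Suc n))) a = 0" using a(1) by (rule vanish)
      with step.IH show ?case by simp
    qed
    have "(\<lambda>n. \<Sum>j\<le>n. d j * blinfun_apply (f (r j)) a) \<longlonglongrightarrow> blinfun_apply (U k) a"
      by (intro tendsto_eventually eventually_sequentiallyI[of k] eq)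
    moreover have "(\<lambda>n. \<Sum>j\<le>n. d j * blinfun_apply (f (r j)) a) \<longlonglongrightarrow> 4 * blinfun_apply g a"
      using d aY by (simp add: tail_def)
    ultimately have "blinfun_apply (U k) a = 4 * blinfun_apply g a" by (rule LIMSEQ_unique)
    moreover have "\<bar>blinfun_apply g a\<bar> \<le> 1/32 * norm a" using small aY by (rule bspec)
    moreover have "norm a \<le> 1" using subsetD[OF A_ball a(1)] by simp
    ultimately show ?thesis using a(2) by linarith
  qed
  \<comment> \<open>From \<open>N\<close> on the coefficients are 1, and from 7 on the error
    \<open>1 / (k + 1)\<close> is at most \<open>1/8\<close>; two norms of at most
    \<open>1/4\<close> cannot add up to 1.\<close>
  define k where "k = max N 7"
  have "d (Suc k) = 1" using d by (simp add: tail_def k_def)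
  then have "U (Suc k) - U k = f (r (Suc k))" by (simp add: U_def)
  then have "1 \<le> norm (U (Suc k)) + norm (U k)"
    using norm_triangle_ineq4[of "U (Suc k)" "U k"] norm_f[of "r (Suc k)"] by simp
  also have "\<dots> \<le> (1/8 + 1 / real (Suc (Suc k))) + (1/8 + 1 / real (Suc k))"
    by (intro add_mono U)
  also have "\<dots> \<le> (1/8 + 1/8) + (1/8 + 1/8)"
    by (intro add_mono order_refl divide_left_mono) (auto simp: k_def)
  finally show False by simp
qed

end

theorem seminorms_attain_imp_finite_dim:
  assumes attain: "seminorms_attain TYPE('e::real_normed_vector)"
  shows "\<exists>A :: 'e::real_normed_vector set. finite A \<and> span A = UNIV"
proof (rule ccontr)
  assume "\<not> ?thesis"
  then have "span A \<noteq> UNIV" if "finite A" for A :: "'e set" using that by blast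
  then obtain f :: "nat \<Rightarrow> 'e \<Rightarrow>\<^sub>L real" and A where "mazur_sequence f A"
    using mazur_sequence_exists by blast
  then show False using mazur_sequence.seminorms_do_not_attain attain by blast
qed

section \<open>Reduction of the weak maximizing property to seminorms\<close>

text \<open>The space l-infinity over the index type. It is the target of the operators below, since
  a supremum of moduli of functionals is the norm of an operator into it.\<close>

definition bounded_functions :: "complex set \<Rightarrow> ('i \<Rightarrow> complex) normed_module" where
  "bounded_functions K =
     \<lparr>carrier = {b. range b \<subseteq> K \<and> bounded (range b)}, mult = (\<lambda>b _. b), one = (\<lambda>_. 0),
      zero = (\<lambda>_. 0), add = (\<lambda>b c i. b i + c i), smult = (\<lambda>a b i. a * b i),
      nrm = (\<lambda>b. SUP i. cmod (b i))\<rparr>"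

lemma bounded_functions_simps:
  shows "carrier (bounded_functions K) = {b. range b \<subseteq> K \<and> bounded (range b)}"
    and "\<zero>\<^bsub>bounded_functions K\<^esub> = (\<lambda>_. 0)"
    and "b \<oplus>\<^bsub>bounded_functions K\<^esub> c = (\<lambda>i. b i + c i)"
    and "a \<odot>\<^bsub>bounded_functions K\<^esub> b = (\<lambda>i. a * b i)"
    and "nrm (bounded_functions K) b = (SUP i. cmod (b i))"
  by (simp_all add: bounded_functions_def)

lemma nrm_bounded_functions_upper:
  assumes "bounded (range b)"
  shows "cmod (b i) \<le> nrm (bounded_functions K) b"
proof -
  obtain C where "\<And>i. cmod (b i) \<le> C" using assms by (auto simp: bounded_iff)
  then have "bdd_above (range (\<lambda>i. cmod (b i)))" by (intro bdd_aboveI2)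
  then show ?thesis unfolding bounded_functions_simps by (intro cSUP_upper) auto
qed

lemma nrm_bounded_functions_least:
  "(\<And>i. cmod (b i) \<le> t) \<Longrightarrow> nrm (bounded_functions K) b \<le> t"
  unfolding bounded_functions_simps by (intro cSUP_least) auto

lemma bounded_range_cmod_le: "(\<And>i. cmod (b i) \<le> C) \<Longrightarrow> bounded (range b)"
  by (auto simp: bounded_iff)

lemma bounded_functions_memI:
  "(\<And>i. b i \<in> K) \<Longrightarrow> (\<And>i. cmod (b i) \<le> C) \<Longrightarrow> b \<in> carrier (bounded_functions K)"
  unfolding bounded_functions_simps using bounded_range_cmod_le by auto

lemma bounded_functions_memD:
  assumes "b \<in> carrier (bounded_functions K)"
  shows "b i \<in> K" and "cmod (b i) \<le> nrm (bounded_functions K) b"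
  using assms nrm_bounded_functions_upper[of b i K] unfolding bounded_functions_simps(1) by auto

text \<open>For completeness, a Cauchy sequence converges pointwise, the limits stay in the closed
  set \<open>K\<close>, and the uniform Cauchy condition makes the convergence uniform.\<close>

lemma banach_module_bounded_functions:
  assumes K: "K = \<real> \<or> K = UNIV"
  shows "banach_module K (bounded_functions K :: ('i \<Rightarrow> complex) normed_module)"
proof -
  let ?F = "bounded_functions K :: ('i \<Rightarrow> complex) normed_module"
  note mem = bounded_functions_memD
  have Kc: "0 \<in> K" "1 \<in> K" "\<And>a b. a \<in> K \<Longrightarrow> b \<in> K \<Longrightarrow> a + b \<in> K"
    "\<And>a b. a \<in> K \<Longrightarrow> b \<in> K \<Longrightarrow> a * b \<in> K" "\<And>a. a \<in> K \<Longrightarrow> - a \<in> K" "closed K"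
    using K closed_complex_Reals by auto
  have cring: "cring (scalar_ring K)"
  proof (rule cringI)
    show "abelian_group (scalar_ring K)"
    proof (rule abelian_groupI)
      fix x assume "x \<in> carrier (scalar_ring K)"
      then show "\<exists>y\<in>carrier (scalar_ring K). y \<oplus>\<^bsub>scalar_ring K\<^esub> x = \<zero>\<^bsub>scalar_ring K\<^esub>"
        using Kc(5) by (intro bexI[of _ "- x"]) auto
    qed (auto simp: Kc)
    show "comm_monoid (scalar_ring K)" by (rule comm_monoidI) (auto simp: Kc)
  qed (auto simp: algebra_simps)
  have addc: "b \<oplus>\<^bsub>?F\<^esub> c \<in> carrier ?F" if b: "b \<in> carrier ?F" and c: "c \<in> carrier ?F" for b c
  proof (rule bounded_functions_memI)
    fix i
    show "(b \<oplus>\<^bsub>?F\<^esub> c) i \<in> K" using mem(1)[OF b] mem(1)[OF c] Kc by (simp add: bounded_functions_simps)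
    show "cmod ((b \<oplus>\<^bsub>?F\<^esub> c) i) \<le> nrm ?F b + nrm ?F c"
      using mem(2)[OF b, of i] mem(2)[OF c, of i] norm_triangle_ineq[of "b i" "c i"]
      by (simp add: bounded_functions_simps(3))
  qed
  have smultc: "a \<odot>\<^bsub>?F\<^esub> b \<in> carrier ?F" if a: "a \<in> K" and b: "b \<in> carrier ?F" for a b
  proof (rule bounded_functions_memI)
    fix i
    show "(a \<odot>\<^bsub>?F\<^esub> b) i \<in> K" using a mem(1)[OF b] Kc by (simp add: bounded_functions_simps)
    show "cmod ((a \<odot>\<^bsub>?F\<^esub> b) i) \<le> cmod a * nrm ?F b"
      using mult_left_mono[OF mem(2)[OF b, of i], of "cmod a"]
      by (simp add: bounded_functions_simps(4) norm_mult)
  qed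
  have neg: "(\<lambda>i. - b i) \<in> carrier ?F" if b: "b \<in> carrier ?F" for b
    using mem[OF b] Kc by (intro bounded_functions_memI[where C = "nrm ?F b"]) auto
  have ag: "abelian_group ?F"
  proof (rule abelian_groupI)
    show "\<zero>\<^bsub>?F\<^esub> \<in> carrier ?F"
      using Kc by (intro bounded_functions_memI[where C = 0]) (auto simp: bounded_functions_simps)
    show "\<exists>y\<in>carrier ?F. y \<oplus>\<^bsub>?F\<^esub> x = \<zero>\<^bsub>?F\<^esub>" if "x \<in> carrier ?F" for x
      using neg[OF that] by (intro bexI[of _ "\<lambda>i. - x i"]) (auto simp: bounded_functions_simps)
  qed (use addc in \<open>auto simp: bounded_functions_simps algebra_simps\<close>)
  have mod: "module (scalar_ring K) ?F"
    by (rule moduleI[OF cring ag]) (use smultc in \<open>auto simp: bounded_functions_simps algebra_simps\<close>)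
  interpret module "scalar_ring K" ?F by (rule mod)
  have minus: "b \<ominus>\<^bsub>?F\<^esub> c = (\<lambda>i. b i - c i)" if b: "b \<in> carrier ?F" and c: "c \<in> carrier ?F" for b c
  proof -
    have "\<ominus>\<^bsub>?F\<^esub> c = (\<lambda>i. - c i)"
      using neg[OF c] c by (intro M.minus_equality) (auto simp: bounded_functions_simps)
    then show ?thesis by (simp add: a_minus_def bounded_functions_simps)
  qed
  have complete: "\<exists>x\<in>carrier ?F. (\<lambda>n. nrm ?F (X n \<ominus>\<^bsub>?F\<^esub> x)) \<longlonglongrightarrow> 0"
    if X: "\<And>n. X n \<in> carrier ?F"
      and cauchy: "\<And>e. e > 0 \<Longrightarrow> \<exists>M. \<forall>m\<ge>M. \<forall>n\<ge>M. nrm ?F (X m \<ominus>\<^bsub>?F\<^esub> X n) < e" for X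
  proof -
    have close: "\<exists>M. \<forall>m\<ge>M. \<forall>n\<ge>M. \<forall>i. cmod (X m i - X n i) < e" if e: "e > 0" for e
    proof -
      obtain M where M: "\<And>m n. m \<ge> M \<Longrightarrow> n \<ge> M \<Longrightarrow> nrm ?F (X m \<ominus>\<^bsub>?F\<^esub> X n) < e"
        using cauchy[OF e] by blast
      have "cmod (X m i - X n i) < e" if "m \<ge> M" "n \<ge> M" for m n i
      proof -
        have "X m \<ominus>\<^bsub>?F\<^esub> X n \<in> carrier ?F" by (intro M.minus_closed X)
        from mem(2)[OF this, of i] M[OF that] show ?thesis by (simp only: minus[OF X X])
      qed
      then show ?thesis by blast
    qed
    have "Cauchy (\<lambda>n. X n i)" for i
      using close by (intro metric_CauchyI) (metis dist_norm)
    then have "\<exists>l. (\<lambda>n. X n i) \<longlonglongrightarrow> l" for i by (simp add: Cauchy_convergent_iff convergent_def)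
    then obtain x where x: "\<And>i. (\<lambda>n. X n i) \<longlonglongrightarrow> x i" by metis
    have xK: "x i \<in> K" for i
      using mem(1)[OF X] by (intro closed_sequentially[OF Kc(6) _ x]) auto
    have near: "\<exists>M. \<forall>n\<ge>M. \<forall>i. cmod (X n i - x i) \<le> e" if e: "e > 0" for e
    proof -
      obtain M where M: "\<And>m n i. m \<ge> M \<Longrightarrow> n \<ge> M \<Longrightarrow> cmod (X m i - X n i) < e"
        using close[OF e] by blast
      have "cmod (X n i - x i) \<le> e" if n: "n \<ge> M" for n i
      proof (rule tendsto_upperbound)
        show "(\<lambda>m. cmod (X n i - X m i)) \<longlonglongrightarrow> cmod (X n i - x i)" by (intro tendsto_intros x)
        show "\<forall>\<^sub>F m in sequentially. cmod (X n i - X m i) \<le> e"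
          using M[OF n] by (intro eventually_sequentiallyI[of M]) (simp add: less_imp_le)
      qed simp
      then show ?thesis by blast
    qed
    obtain M where M: "\<And>i. cmod (X M i - x i) \<le> 1" using near[of 1] by auto
    have "cmod (x i) \<le> nrm ?F (X M) + 1" for i
      using norm_triangle_ineq4[of "X M i" "X M i - x i"] mem(2)[OF X[of M], of i] M[of i] by simp
    then have xc: "x \<in> carrier ?F" using xK by (intro bounded_functions_memI)
    have "(\<lambda>n. nrm ?F (X n \<ominus>\<^bsub>?F\<^esub> x)) \<longlonglongrightarrow> 0"
    proof (rule LIMSEQ_I)
      fix e :: real assume "e > 0"
      then obtain M where M: "\<And>n i. n \<ge> M \<Longrightarrow> cmod (X n i - x i) \<le> e / 2" using near[of "e / 2"] by auto
      have "norm (nrm ?F (X n \<ominus>\<^bsub>?F\<^esub> x) - 0) < e" if "n \<ge> M" for n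
      proof -
        have sub: "X n \<ominus>\<^bsub>?F\<^esub> x \<in> carrier ?F" using X xc by simp
        have "nrm ?F (X n \<ominus>\<^bsub>?F\<^esub> x) \<le> e / 2"
          using M[OF that] X xc by (intro nrm_bounded_functions_least) (simp add: minus)
        moreover have "0 \<le> nrm ?F (X n \<ominus>\<^bsub>?F\<^esub> x)"
          using order_trans[OF norm_ge_zero mem(2)[OF sub]] .
        ultimately show ?thesis using \<open>e > 0\<close> by simp
      qed
      then show "\<exists>M. \<forall>n\<ge>M. norm (nrm ?F (X n \<ominus>\<^bsub>?F\<^esub> x) - 0) < e" by blast
    qed
    with xc show ?thesis by blast
  qed
  show ?thesis
    unfolding banach_module_def
  proof (intro conjI ballI allI impI)
    show "module (scalar_ring K) ?F" by (rule mod)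
  next
    fix x assume x: "x \<in> carrier ?F"
    show "0 \<le> nrm ?F x" using order_trans[OF norm_ge_zero mem(2)[OF x]] .
    show "nrm ?F x = 0 \<longleftrightarrow> x = \<zero>\<^bsub>?F\<^esub>"
    proof
      assume "nrm ?F x = 0"
      then have "cmod (x i) \<le> 0" for i using mem(2)[OF x, of i] by simp
      then show "x = \<zero>\<^bsub>?F\<^esub>" by (simp add: bounded_functions_simps fun_eq_iff)
    qed (simp add: bounded_functions_simps)
    fix y assume y: "y \<in> carrier ?F"
    show "nrm ?F (x \<oplus>\<^bsub>?F\<^esub> y) \<le> nrm ?F x + nrm ?F y"
    proof (rule nrm_bounded_functions_least)
      fix i show "cmod ((x \<oplus>\<^bsub>?F\<^esub> y) i) \<le> nrm ?F x + nrm ?F y"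
        using mem(2)[OF x, of i] mem(2)[OF y, of i] norm_triangle_ineq[of "x i" "y i"]
        by (simp add: bounded_functions_simps(3))
    qed
  next
    fix c x assume c: "c \<in> K" and x: "x \<in> carrier ?F"
    have le: "cmod c * cmod (x i) \<le> nrm ?F (c \<odot>\<^bsub>?F\<^esub> x)" for i
      using mem(2)[OF smultc[OF c x], of i] by (simp add: bounded_functions_simps(4) norm_mult)
    have "nrm ?F (c \<odot>\<^bsub>?F\<^esub> x) \<le> cmod c * nrm ?F x"
      using mult_left_mono[OF mem(2)[OF x], of "cmod c"]
      by (intro nrm_bounded_functions_least) (simp add: bounded_functions_simps(4) norm_mult)
    moreover have "cmod c * nrm ?F x \<le> nrm ?F (c \<odot>\<^bsub>?F\<^esub> x)"
    proof (cases "c = 0")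
      case True
      then show ?thesis using order_trans[OF norm_ge_zero mem(2)[OF smultc[OF c x]]] by simp
    next
      case False
      then have "nrm ?F x \<le> nrm ?F (c \<odot>\<^bsub>?F\<^esub> x) / cmod c"
        using le by (intro nrm_bounded_functions_least) (simp add: field_simps)
      then show ?thesis using False by (simp add: field_simps)
    qed
    ultimately show "nrm ?F (c \<odot>\<^bsub>?F\<^esub> x) = cmod c * nrm ?F x" by simp
  next
    fix X :: "nat \<Rightarrow> 'i \<Rightarrow> complex"
    assume "\<forall>n. X n \<in> carrier ?F" "\<forall>e>0. \<exists>M. \<forall>m\<ge>M. \<forall>n\<ge>M. nrm ?F (X m \<ominus>\<^bsub>?F\<^esub> X n) < e"
    then show "\<exists>x\<in>carrier ?F. (\<lambda>n. nrm ?F (X n \<ominus>\<^bsub>?F\<^esub> x)) \<longlonglongrightarrow> 0" using complete by blast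
  qed
qed

section \<open>Real functionals and functionals over the scalar field\<close>

locale scalar_mult_space =
  fixes K :: "complex set" and s :: "complex \<Rightarrow> 'e::real_normed_vector \<Rightarrow> 'e"
  assumes K: "K = \<real> \<or> K = UNIV" and s: "scalar_mult K s"
begin

lemma s_simps:
  shows s_real: "s (complex_of_real r) x = r *\<^sub>R x"
    and s_add: "c \<in> K \<Longrightarrow> s c (x + y) = s c x + s c y"
    and s_add_left: "c \<in> K \<Longrightarrow> d \<in> K \<Longrightarrow> s (c + d) x = s c x + s d x"
    and s_mult: "c \<in> K \<Longrightarrow> d \<in> K \<Longrightarrow> s (c * d) x = s c (s d x)"
    and norm_s: "c \<in> K \<Longrightarrow> norm (s c x) = cmod c * norm x"
  using s unfolding scalar_mult_def by blast+

lemma K_real: "complex_of_real r \<in> K"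
  using K by auto

lemma s_one: "s 1 x = x"
  using s_real[of 1 x] by simp

lemma s_diff_left: "c \<in> K \<Longrightarrow> d \<in> K \<Longrightarrow> s (c - d) x = s c x - s d x"
  using s_add_left[of "c - d" d x] K by auto

text \<open>The \<open>K\<close>-linear functional with real part \<open>u\<close>. The cases are
  separated because \<open>s \<i>\<close> is meaningful only for \<open>K = UNIV\<close>.\<close>

definition complexify :: "('e \<Rightarrow>\<^sub>L real) \<Rightarrow> 'e \<Rightarrow> complex" where
  "complexify u x = (if K = \<real> then complex_of_real (blinfun_apply u x)
     else Complex (blinfun_apply u x) (- blinfun_apply u (s \<i> x)))"

lemma Re_complexify: "Re (complexify u x) = blinfun_apply u x"
  by (simp add: complexify_def)

lemma complexify_in_K: "complexify u x \<in> K"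
  using K by (auto simp: complexify_def)

lemma complexify_add: "complexify u (x + y) = complexify u x + complexify u y"
  using K by (auto simp: complexify_def s_add blinfun.add_right complex_eq_iff)

lemma complexify_s:
  assumes c: "c \<in> K" shows "complexify u (s c x) = c * complexify u x"
proof (cases "K = \<real>")
  case True
  then obtain r where "c = complex_of_real r" using c by (auto elim: Reals_cases)
  moreover have "complexify u y = complex_of_real (blinfun_apply u y)" for y
    unfolding complexify_def using True by simp
  ultimately show ?thesis by (simp add: s_real blinfun.scaleR_right)
next
  case False
  then have U: "K = UNIV" using K by blast
  \<comment> \<open>Reduces compatibility with complex scalars to the real linearity of
    \<open>u\<close>; it is used for both \<open>c\<close> and \<open>\<i> * c\<close>.\<close>
  have exp: "s d x = Re d *\<^sub>R x + Im d *\<^sub>R s \<i> x" for d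
  proof -
    have inK: "k \<in> K" for k by (simp add: U)
    have "d = complex_of_real (Re d) + complex_of_real (Im d) * \<i>" by (simp add: complex_eq_iff)
    then have "s d x = s (complex_of_real (Re d) + complex_of_real (Im d) * \<i>) x" by (rule arg_cong)
    also have "\<dots> = s (complex_of_real (Re d)) x + s (complex_of_real (Im d)) (s \<i> x)"
      by (simp only: s_add_left[OF inK inK] s_mult[OF inK inK])
    finally show ?thesis by (simp only: s_real)
  qed
  have "s \<i> (s c x) = s (\<i> * c) x" using s_mult[of \<i> c x] U by simp
  then have "blinfun_apply u (s \<i> (s c x)) = - Im c * blinfun_apply u x + Re c * blinfun_apply u (s \<i> x)"
    using exp[of "\<i> * c"] by (simp add: blinfun.diff_right blinfun.scaleR_right)
  moreover have "blinfun_apply u (s c x) = Re c * blinfun_apply u x + Im c * blinfun_apply u (s \<i> x)"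
    unfolding exp[of c] by (simp add: blinfun.add_right blinfun.scaleR_right)
  ultimately show ?thesis using False by (simp add: complexify_def complex_eq_iff algebra_simps)
qed

definition unit_scalars :: "complex set" where
  "unit_scalars = {c \<in> K. cmod c = 1}"

text \<open>Multiplying \<open>x\<close> by the conjugate phase of the value makes the value real
  and nonnegative, so the modulus is a value of \<open>u\<close> itself.\<close>

lemma cmod_complexify:
  obtains c where "c \<in> unit_scalars" "cmod (complexify u x) = blinfun_apply u (s c x)"
proof (cases "complexify u x = 0")
  case True
  then have "blinfun_apply u (s 1 x) = 0" using Re_complexify[of u x] by (simp add: s_one)
  then show ?thesis using that[of 1] True K_real[of 1] by (simp add: unit_scalars_def)
next
  case False
  define z where "z = complexify u x"
  define c where "c = cnj z / complex_of_real (cmod z)"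
  have "z \<in> K" by (simp add: z_def complexify_in_K)
  then have "cnj z \<in> K" using K by (auto simp: complex_is_Real_iff)
  then have c: "c \<in> unit_scalars"
    using K False unfolding unit_scalars_def c_def z_def[symmetric] by (auto simp: norm_divide)
  have "cnj z * z = complex_of_real (cmod z) * complex_of_real (cmod z)"
    using complex_norm_square[of z] by (simp add: power2_eq_square mult.commute)
  then have "c * z = complex_of_real (cmod z)" using False by (simp add: c_def z_def field_simps)
  then have "complexify u (s c x) = complex_of_real (cmod z)"
    using c complexify_s[of c u x] by (simp add: unit_scalars_def z_def)
  then have "blinfun_apply u (s c x) = cmod z" using Re_complexify[of u "s c x"] by simp
  then show ?thesis using that[OF c] by (simp add: z_def)
qed

lemma apply_le_cmod_complexify:
  assumes "c \<in> unit_scalars"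
  shows "blinfun_apply u (s c x) \<le> cmod (complexify u x)"
  using complex_Re_le_cmod[of "complexify u (s c x)"] assms
  by (simp add: Re_complexify complexify_s unit_scalars_def norm_mult)

lemma cmod_complexify_le: "cmod (complexify u x) \<le> norm u * norm x"
proof -
  obtain c where c: "c \<in> unit_scalars" "cmod (complexify u x) = blinfun_apply u (s c x)"
    by (rule cmod_complexify)
  have "norm (s c x) = norm x" using c(1) by (simp add: unit_scalars_def norm_s)
  then show ?thesis using c(2) apply_le_norm[of u "norm u" "s c x"] by simp
qed

lemma Blinfun_complexify: "blinfun_apply (Blinfun (complexify u)) = complexify u"
proof (rule bounded_linear_Blinfun_apply, rule bounded_linear_intro[where K = "norm u"])
  show "complexify u (r *\<^sub>R x) = r *\<^sub>R complexify u x" for r x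
    using complexify_s[OF K_real, of u r x] by (simp add: s_real scaleR_conv_of_real)
  show "cmod (complexify u x) \<le> norm x * norm u" for x
    using cmod_complexify_le[of u x] by (simp add: mult.commute)
qed (rule complexify_add)

text \<open>The complexification of \<open>u\<close> lies in the dual over \<open>K\<close>, and
  \<open>u\<close> is its real part.\<close>

lemma weakly_null_imp_tendsto_0:
  assumes "weakly_null K s x"
  shows "(\<lambda>n. blinfun_apply (u :: 'e \<Rightarrow>\<^sub>L real) (x n)) \<longlonglongrightarrow> 0"
proof -
  have "Blinfun (complexify u) \<in> dual_space K s"
    by (simp add: dual_space_def Blinfun_complexify complexify_in_K complexify_s)
  then have "(\<lambda>n. blinfun_apply (Blinfun (complexify u)) (x n)) \<longlonglongrightarrow> 0"
    using assms unfolding weakly_null_def by (rule bspec[rotated])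
  then have "(\<lambda>n. complexify u (x n)) \<longlonglongrightarrow> 0" by (simp only: Blinfun_complexify)
  then have "(\<lambda>n. Re (complexify u (x n))) \<longlonglongrightarrow> Re 0" by (rule tendsto_Re)
  then show ?thesis by (simp add: Re_complexify)
qed

lemma compact_unit_scalars: "compact unit_scalars"
proof -
  have "unit_scalars = K \<inter> sphere 0 1" by (auto simp: unit_scalars_def)
  moreover have "closed K" using K closed_complex_Reals by auto
  ultimately show ?thesis by (simp add: closed_Int_compact)
qed

lemma one_in_unit_scalars: "1 \<in> unit_scalars"
  using K_real[of 1] by (simp add: unit_scalars_def)

text \<open>
  A seminorm \<open>q\<close> is the supremum of the real functionals below it. Their complexifications
  define an operator into a space of bounded functions, whose norm at \<open>x\<close> is the maximum of \<open>q\<close>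
  over the scalar multiples of \<open>x\<close> of the same norm.
\<close>

lemma WMP_all_imp_seminorms_attain:
  assumes WMP: "WMP_all K s"
  shows "seminorms_attain TYPE('e)"
  unfolding seminorms_attain_def
proof (intro allI impI)
  fix q and f :: "'e \<Rightarrow>\<^sub>L real" and c \<alpha> :: real
  assume q: "sublinear q" and sym: "\<forall>x. q (- x) = q x"
    and q_le: "\<forall>x. q x \<le> \<bar>blinfun_apply f x\<bar> + c * norm x" and c: "c < \<alpha>"
    and q_sphere: "\<forall>x. norm x = 1 \<longrightarrow> q x \<le> \<alpha>"
    and approx: "\<forall>e>0. \<exists>x. norm x = 1 \<and> \<alpha> - e < q x"
  have q0: "0 \<le> q x" for x using sublinearD(4)[OF q, of x] sym by simp
  obtain z :: 'e where z: "norm z = 1" using approx[rule_format, of 1] by auto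
  have \<alpha>0: "0 \<le> \<alpha>" using order_trans[OF q0 q_sphere[rule_format, OF z]] .
  have q_norm: "q x \<le> \<alpha> * norm x" for x
  proof (cases "x = 0")
    case False
    then have "q (inverse (norm x) *\<^sub>R x) \<le> \<alpha>" using q_sphere by simp
    moreover have "q (inverse (norm x) *\<^sub>R x) = inverse (norm x) * q x"
      by (rule sublinearD(2)[OF q]) simp
    ultimately have "inverse (norm x) * q x \<le> \<alpha>" by (simp only:)
    then show ?thesis using False by (simp add: field_simps)
  qed (simp add: sublinearD(3)[OF q])
  define U where "U = {u :: 'e \<Rightarrow>\<^sub>L real. \<forall>x. blinfun_apply u x \<le> q x}"
  \<comment> \<open>The index type consists of all real functionals; the coordinates outside
    \<open>U\<close> are filled with 0, which leaves the supremum of the moduli unchanged.\<close>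
  define T where "T x = (\<lambda>u. if u \<in> U then complexify u x else 0)" for x
  let ?F = "bounded_functions K :: (('e \<Rightarrow>\<^sub>L real) \<Rightarrow> complex) normed_module"
  have cmod_le: "cmod (complexify u x) \<le> t"
    if u: "u \<in> U" and t: "\<And>k. k \<in> unit_scalars \<Longrightarrow> q (s k x) \<le> t" for u x t
  proof -
    obtain k where k: "k \<in> unit_scalars" "cmod (complexify u x) = blinfun_apply u (s k x)"
      by (rule cmod_complexify)
    have "blinfun_apply u (s k x) \<le> q (s k x)" using u by (simp add: U_def)
    with t[OF k(1)] k(2) show ?thesis by linarith
  qed
  have q_unit: "q (s k x) \<le> \<alpha> * norm x" if "k \<in> unit_scalars" for k x
    using q_norm[of "s k x"] that by (simp add: unit_scalars_def norm_s)
  have T_least: "nrm ?F (T x) \<le> t" if "\<And>k. k \<in> unit_scalars \<Longrightarrow> q (s k x) \<le> t" for x t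
  proof (rule nrm_bounded_functions_least)
    fix u
    have "0 \<le> t" using order_trans[OF q0 that[OF one_in_unit_scalars]] .
    then show "cmod (T x u) \<le> t" using cmod_le[of u x t] that by (simp add: T_def)
  qed
  have T_mem: "T x \<in> carrier ?F" for x
  proof (rule bounded_functions_memI)
    show "T x u \<in> K" for u using complexify_in_K K_real[of 0] by (simp add: T_def)
    show "cmod (T x u) \<le> \<alpha> * norm x" for u
      using cmod_le[of u x "\<alpha> * norm x"] q_unit \<alpha>0 by (simp add: T_def)
  qed
  \<comment> \<open>A functional that supports \<open>q\<close> at \<open>s k x\<close> belongs to
    \<open>U\<close>, and its coordinate is large enough.\<close>
  have T_upper: "q (s k x) \<le> nrm ?F (T x)" if k: "k \<in> unit_scalars" for k x
  proof -
    obtain u :: "'e \<Rightarrow>\<^sub>L real" where u: "\<And>y. blinfun_apply u y \<le> q y" "blinfun_apply u (s k x) = q (s k x)"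
      using hahn_banach_support[OF q q_norm \<alpha>0, of "s k x"] by blast
    then have "T x u = complexify u x" by (simp add: T_def U_def)
    then show ?thesis
      using bounded_functions_memD(2)[OF T_mem, of x u] apply_le_cmod_complexify[OF k, of u x] u(2) by simp
  qed
  have T_q: "q x \<le> nrm ?F (T x)" for x using T_upper[OF one_in_unit_scalars, of x] by (simp add: s_one)
  have T_norm: "nrm ?F (T x) \<le> \<alpha> * norm x" for x by (rule T_least[OF q_unit])
  have bop: "bounded_op K s ?F T"
    unfolding bounded_op_def
  proof (intro conjI allI ballI)
    show "T x \<in> carrier ?F" for x by (rule T_mem)
    show "T (x + y) = T x \<oplus>\<^bsub>?F\<^esub> T y" for x y
      by (simp add: bounded_functions_simps(3) T_def complexify_add fun_eq_iff)
    show "T (s k x) = k \<odot>\<^bsub>?F\<^esub> T x" if "k \<in> K" for k x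
      using that by (simp add: bounded_functions_simps(4) T_def complexify_s fun_eq_iff)
    show "\<exists>C. \<forall>x. nrm ?F (T x) \<le> C * norm x" using T_norm by (intro exI[of _ \<alpha>] allI)
  qed
  have "\<exists>x. norm x = 1 \<and> \<alpha> - inverse (real (Suc n)) < q x" for n
    using approx by (simp del: of_nat_Suc)
  then obtain x where x: "\<And>n. norm (x n) = 1" "\<And>n. \<alpha> - inverse (real (Suc n)) < q (x n)" by metis
  have lim: "(\<lambda>n. \<alpha> - inverse (real (Suc n))) \<longlonglongrightarrow> \<alpha>"
    using tendsto_diff[OF tendsto_const LIMSEQ_inverse_real_of_nat] by (simp del: of_nat_Suc)
  have limT: "(\<lambda>n. nrm ?F (T (x n))) \<longlonglongrightarrow> \<alpha>"
  proof (rule tendsto_sandwich[OF _ _ lim tendsto_const])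
    show "\<forall>\<^sub>F n in sequentially. \<alpha> - inverse (real (Suc n)) \<le> nrm ?F (T (x n))"
      using less_imp_le[OF less_le_trans[OF x(2) T_q]] by (intro always_eventually allI)
    show "\<forall>\<^sub>F n in sequentially. nrm ?F (T (x n)) \<le> \<alpha>"
      using T_norm[of "x _"] x(1) by (intro always_eventually allI) simp
  qed
  have opn: "opnorm ?F T = \<alpha>"
  proof (rule antisym)
    have le: "nrm ?F (T y) / norm y \<le> \<alpha>" for y
      using T_norm[of y] \<alpha>0 by (cases "y = 0") (simp_all add: field_simps)
    then show "opnorm ?F T \<le> \<alpha>" unfolding opnorm_def by (intro cSUP_least) auto
    have "bdd_above (range (\<lambda>y. nrm ?F (T y) / norm y))" using le by (intro bdd_aboveI2)
    then have "nrm ?F (T (x n)) / norm (x n) \<le> opnorm ?F T" for n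
      unfolding opnorm_def by (intro cSUP_upper) auto
    then show "\<alpha> \<le> opnorm ?F T"
      using x(1) by (intro tendsto_upperbound[OF limT]) simp_all
  qed
  have "maximizing_sequence ?F T x"
    using x(1) limT by (simp add: maximizing_sequence_def opn)
  \<comment> \<open>Along a weakly null sequence \<open>f (x n)\<close> would tend to 0, and the
    bound on \<open>q\<close> would give \<open>\<alpha> \<le> c\<close>.\<close>
  moreover have "\<not> weakly_null K s x"
  proof
    assume "weakly_null K s x"
    then have "(\<lambda>n. \<bar>blinfun_apply f (x n)\<bar> + c) \<longlonglongrightarrow> \<bar>0\<bar> + c"
      by (intro tendsto_intros weakly_null_imp_tendsto_0)
    moreover have "\<alpha> - inverse (real (Suc n)) \<le> \<bar>blinfun_apply f (x n)\<bar> + c" for n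
      using x(1)[of n] x(2)[of n] q_le[rule_format, of "x n"] by simp
    ultimately have "\<alpha> \<le> \<bar>0\<bar> + c" using lim by (intro LIMSEQ_le[OF lim]) auto
    with c show False by simp
  qed
  ultimately have "attains_norm ?F T"
    using WMP_all_imp_WMP[OF WMP banach_module_bounded_functions[OF K]] bop unfolding WMP_def by blast
  then obtain y where y: "norm y = 1" "nrm ?F (T y) = \<alpha>" by (auto simp: attains_norm_def opn)
  \<comment> \<open>The operator attains its norm at \<open>y\<close>, but \<open>q\<close> may
    reach \<open>\<alpha>\<close> only at a rotation of \<open>y\<close>. By continuity and
    compactness, \<open>q (s k y)\<close> is maximal for some unit scalar \<open>k\<close>, and this
    maximum bounds the norm of \<open>T y\<close>.\<close>
  have q_lip: "q v - q w \<le> \<alpha> * norm (v - w)" for v w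
    using sublinearD(1)[OF q, of "v - w" w] q_norm[of "v - w"] by simp
  have "(\<alpha> * norm y)-lipschitz_on unit_scalars (\<lambda>k. q (s k y))"
  proof (rule lipschitz_onI)
    fix k l assume "k \<in> unit_scalars" "l \<in> unit_scalars"
    then have kl: "k \<in> K" "l \<in> K" by (auto simp: unit_scalars_def)
    have "k - l \<in> K" using kl K by auto
    then have "norm (s k y - s l y) = cmod (k - l) * norm y"
      using s_diff_left[OF kl, of y] norm_s[of "k - l" y] by simp
    then show "dist (q (s k y)) (q (s l y)) \<le> \<alpha> * norm y * dist k l"
      using q_lip[of "s k y" "s l y"] q_lip[of "s l y" "s k y"]
      by (simp add: dist_norm norm_minus_commute[of "s l y"] algebra_simps abs_le_iff)
  qed (simp add: \<alpha>0)
  then have "continuous_on unit_scalars (\<lambda>k. q (s k y))" by (rule lipschitz_on_continuous_on)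
  then obtain k where k: "k \<in> unit_scalars" "\<And>l. l \<in> unit_scalars \<Longrightarrow> q (s l y) \<le> q (s k y)"
    using continuous_attains_sup[OF compact_unit_scalars, of "\<lambda>k. q (s k y)"] one_in_unit_scalars by blast
  have "\<alpha> \<le> q (s k y)" using T_least[of y "q (s k y)"] k(2) y(2) by simp
  moreover have "q (s k y) \<le> \<alpha>" using q_unit[OF k(1), of y] y(1) by simp
  moreover have "norm (s k y) = 1" using k(1) y(1) by (simp add: unit_scalars_def norm_s)
  ultimately show "\<exists>x. norm x = 1 \<and> q x = \<alpha>" by (intro exI[of _ "s k y"]) simp
qed

text \<open>A real spanning set also spans over \<open>K\<close>, because real scalars belong to
  \<open>K\<close> and act as in the class.\<close>

lemma finite_span_imp_finite_dim:
  assumes "finite A" "span (A :: 'e set) = UNIV"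
  shows "finite_dim K s"
  unfolding finite_dim_def
proof (intro exI[of _ A] conjI allI)
  fix x
  have "x \<in> range (\<lambda>u. \<Sum>v\<in>A. u v *\<^sub>R v)" using assms span_finite[of A] by auto
  then obtain u where "x = (\<Sum>v\<in>A. u v *\<^sub>R v)" by blast
  then show "\<exists>a. (\<forall>b\<in>A. a b \<in> K) \<and> x = (\<Sum>b\<in>A. s (a b) b)"
    by (intro exI[of _ "\<lambda>b. complex_of_real (u b)"]) (simp add: K_real s_real)
qed (rule assms(1))

end

theorem proposition2p6:
  fixes K :: "complex set" and s :: "complex \<Rightarrow> 'e::banach \<Rightarrow> 'e"
  assumes "K = \<real> \<or> K = UNIV"
    and "scalar_mult K s"
    and "WMP_all K s"
    and "(CAP K s \<and> (\<exists>p>1. isometric_to_lp_square K s p)) \<or>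
         (kadec_klee_dual K s \<or> frechet_differentiable_norm TYPE('e) \<or> LUR_norm TYPE('e))"
  shows "finite_dim K s"
proof -
  interpret scalar_mult_space K s by unfold_locales (rule assms)+
  obtain A :: "'e set" where "finite A" "span A = UNIV"
    using seminorms_attain_imp_finite_dim[OF WMP_all_imp_seminorms_attain[OF assms(3)]] by blast
  then show ?thesis by (rule finite_span_imp_finite_dim)
qed

end
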